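(* A Gray-category is cofibrant if and only if its underlying sesquicategory is free on a computad.
   Context: A Gray-category is a (small) category enriched in the category $\mathbf{2}\text{-}\mathbf{Cat}$ of (strict) 2-categories and (strict) 2-functors with the (pseudo) Gray tensor product; Gray-functors are the enriched functors. A Gray-functor $F:\mathbb A\to\mathbb B$ is a trivial fibration if and only if it is surjective on objects and each 2-functor $\mathbb A(A,B)\to\mathbb B(FA,FB)$ is a trivial fibration in $\mathbf{2}\text{-}\mathbf{Cat}$, where a 2-functor is a trivial fibration if it is surjective on objects and each functor between hom-categories is surjective on objects and fully faithful. A Gray-category is cofibrant if the unique Gray-functor to it from the initial Gray-category has the left lifting property with respect to all trivial fibrations. A sesquicategory is a category enriched in $\mathbf{Cat}$ with the "funny" tensor product; explicitly, it has the structure of a 2-category with vertical composition of 2-cells and whiskering of 2-cells by 1-cells on either side, satisfying all the 2-category axioms except the middle-four interchange law. Sesquifunctors are the enriched functors; $\mathbf{SesquiCat}$ is the category of these. The underlying sesquicategory of a Gray-category is obtained by discarding the 3-cells. A computad $G$ consists of a directed graph $d,c:G_1\to G_0$, with free category $C$ on it, together with a directed graph $d,c:G_2\to C_1$, where $C_1$ is the set of morphisms of $C$ (paths in $G_1$), satisfying the globular relations $dd=dc$ and $cd=cc$. A morphism of computads consists of maps $G_0\to H_0$, $G_1\to H_1$, $G_2\to H_2$ compatible with all sources and targets; this gives a category $\mathbf{Cmptd}$. The forgetful functor $V:\mathbf{SesquiCat}\to\mathbf{Cmptd}$ sends a sesquicategory $\mathscr A$ to the computad whose 0-cells and 1-cells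 are those of $\mathscr A$ and whose 2-cells from a path $f_n\ldots f_1$ to a path $g_m\ldots g_1$ are the 2-cells in $\mathscr A$ between their composites. It has a left adjoint $H$. A sesquicategory is free on a computad if it is isomorphic to $HG$ for some computad $G$. *)

theory Defs
  imports "Graph_Theory.Arc_Walk"
begin

section \<open>Sesquicategories and 2-categories\<close>

text \<open>
  Composites are written in applicative order: \<open>g \<star> f\<close> is \<open>f\<close> followed by \<open>g\<close>, and likewise
  \<open>\<beta> \<cdot> \<alpha>\<close> for the vertical composite of 2-cells. All operations are total functions on the cell
  types; only their values on composable cells of the carriers \<open>Cell0\<close>, \<open>Cell1\<close>, \<open>Cell2\<close> matter.
\<close>

record ('o, 'm, 't) sesquicat =
  Cell0 :: "'o set"
  Cell1 :: "'m set"
  Cell2 :: "'t set"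
  src1 :: "'m \<Rightarrow> 'o"
  tgt1 :: "'m \<Rightarrow> 'o"
  id1 :: "'o \<Rightarrow> 'm"
  comp1 :: "'m \<Rightarrow> 'm \<Rightarrow> 'm"  (infixr \<open>\<star>\<index>\<close> 75)
  src2 :: "'t \<Rightarrow> 'm"
  tgt2 :: "'t \<Rightarrow> 'm"
  id2 :: "'m \<Rightarrow> 't"
  comp2 :: "'t \<Rightarrow> 't \<Rightarrow> 't"  (infixr \<open>\<cdot>\<index>\<close> 65)
  lwhisk :: "'m \<Rightarrow> 't \<Rightarrow> 't"  (infixr \<open>\<lhd>\<index>\<close> 70)
  rwhisk :: "'t \<Rightarrow> 'm \<Rightarrow> 't"  (infixl \<open>\<rhd>\<index>\<close> 70)

definition hom1 :: "('o, 'm, 't, 'z) sesquicat_scheme \<Rightarrow> 'o \<Rightarrow> 'o \<Rightarrow> 'm set" where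
  "hom1 S x y = {f \<in> Cell1 S. src1 S f = x \<and> tgt1 S f = y}"

definition hom2 :: "('o, 'm, 't, 'z) sesquicat_scheme \<Rightarrow> 'm \<Rightarrow> 'm \<Rightarrow> 't set" where
  "hom2 S f g = {\<alpha> \<in> Cell2 S. src2 S \<alpha> = f \<and> tgt2 S \<alpha> = g}"

locale sesquicategory =
  fixes S :: "('o, 'm, 't) sesquicat" (structure)
  assumes src1_closed: "f \<in> Cell1 S \<Longrightarrow> src1 S f \<in> Cell0 S"
    and tgt1_closed: "f \<in> Cell1 S \<Longrightarrow> tgt1 S f \<in> Cell0 S"
    and id1_hom: "x \<in> Cell0 S \<Longrightarrow> id1 S x \<in> hom1 S x x"
    and comp1_hom: "\<lbrakk>f \<in> hom1 S x y; g \<in> hom1 S y z\<rbrakk> \<Longrightarrow> g \<star> f \<in> hom1 S x z"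
    and comp1_id_right: "f \<in> hom1 S x y \<Longrightarrow> f \<star> id1 S x = f"
    and comp1_id_left: "f \<in> hom1 S x y \<Longrightarrow> id1 S y \<star> f = f"
    and comp1_assoc:
      "\<lbrakk>f \<in> hom1 S x y; g \<in> hom1 S y z; h \<in> hom1 S z w\<rbrakk> \<Longrightarrow> (h \<star> g) \<star> f = h \<star> (g \<star> f)"
    and src2_closed: "\<alpha> \<in> Cell2 S \<Longrightarrow> src2 S \<alpha> \<in> Cell1 S"
    and tgt2_closed: "\<alpha> \<in> Cell2 S \<Longrightarrow> tgt2 S \<alpha> \<in> Cell1 S"
    and globular_src: "\<alpha> \<in> Cell2 S \<Longrightarrow> src1 S (src2 S \<alpha>) = src1 S (tgt2 S \<alpha>)"
    and globular_tgt: "\<alpha> \<in> Cell2 S \<Longrightarrow> tgt1 S (src2 S \<alpha>) = tgt1 S (tgt2 S \<alpha>)"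
    and id2_hom: "f \<in> Cell1 S \<Longrightarrow> id2 S f \<in> hom2 S f f"
    and comp2_hom: "\<lbrakk>\<alpha> \<in> hom2 S f g; \<beta> \<in> hom2 S g h\<rbrakk> \<Longrightarrow> \<beta> \<cdot> \<alpha> \<in> hom2 S f h"
    and comp2_id_right: "\<alpha> \<in> hom2 S f g \<Longrightarrow> \<alpha> \<cdot> id2 S f = \<alpha>"
    and comp2_id_left: "\<alpha> \<in> hom2 S f g \<Longrightarrow> id2 S g \<cdot> \<alpha> = \<alpha>"
    and comp2_assoc:
      "\<lbrakk>\<alpha> \<in> hom2 S f g; \<beta> \<in> hom2 S g h; \<gamma> \<in> hom2 S h k\<rbrakk> \<Longrightarrow> (\<gamma> \<cdot> \<beta>) \<cdot> \<alpha> = \<gamma> \<cdot> (\<beta> \<cdot> \<alpha>)"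
    and lwhisk_hom:
      "\<lbrakk>f \<in> hom1 S x y; \<alpha> \<in> hom2 S f f'; g \<in> hom1 S y z\<rbrakk> \<Longrightarrow> g \<lhd> \<alpha> \<in> hom2 S (g \<star> f) (g \<star> f')"
    and lwhisk_id2: "\<lbrakk>f \<in> hom1 S x y; g \<in> hom1 S y z\<rbrakk> \<Longrightarrow> g \<lhd> id2 S f = id2 S (g \<star> f)"
    and lwhisk_comp2:
      "\<lbrakk>f \<in> hom1 S x y; \<alpha> \<in> hom2 S f f'; \<alpha>' \<in> hom2 S f' f''; g \<in> hom1 S y z\<rbrakk>
        \<Longrightarrow> g \<lhd> (\<alpha>' \<cdot> \<alpha>) = (g \<lhd> \<alpha>') \<cdot> (g \<lhd> \<alpha>)"
    and lwhisk_id1: "\<lbrakk>f \<in> hom1 S x y; \<alpha> \<in> hom2 S f f'\<rbrakk> \<Longrightarrow> id1 S y \<lhd> \<alpha> = \<alpha>"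
    and lwhisk_comp1:
      "\<lbrakk>f \<in> hom1 S x y; \<alpha> \<in> hom2 S f f'; g \<in> hom1 S y z; h \<in> hom1 S z w\<rbrakk>
        \<Longrightarrow> (h \<star> g) \<lhd> \<alpha> = h \<lhd> (g \<lhd> \<alpha>)"
    and rwhisk_hom:
      "\<lbrakk>f \<in> hom1 S x y; g \<in> hom1 S y z; \<beta> \<in> hom2 S g g'\<rbrakk> \<Longrightarrow> \<beta> \<rhd> f \<in> hom2 S (g \<star> f) (g' \<star> f)"
    and rwhisk_id2: "\<lbrakk>f \<in> hom1 S x y; g \<in> hom1 S y z\<rbrakk> \<Longrightarrow> id2 S g \<rhd> f = id2 S (g \<star> f)"
    and rwhisk_comp2:
      "\<lbrakk>f \<in> hom1 S x y; g \<in> hom1 S y z; \<beta> \<in> hom2 S g g'; \<beta>' \<in> hom2 S g' g''\<rbrakk>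
        \<Longrightarrow> (\<beta>' \<cdot> \<beta>) \<rhd> f = (\<beta>' \<rhd> f) \<cdot> (\<beta> \<rhd> f)"
    and rwhisk_id1: "\<lbrakk>g \<in> hom1 S y z; \<beta> \<in> hom2 S g g'\<rbrakk> \<Longrightarrow> \<beta> \<rhd> id1 S y = \<beta>"
    and rwhisk_comp1:
      "\<lbrakk>f \<in> hom1 S x y; g \<in> hom1 S y z; h \<in> hom1 S z w; \<gamma> \<in> hom2 S h h'\<rbrakk>
        \<Longrightarrow> \<gamma> \<rhd> (g \<star> f) = (\<gamma> \<rhd> g) \<rhd> f"
    and whisk_whisk:
      "\<lbrakk>f \<in> hom1 S x y; g \<in> hom1 S y z; \<beta> \<in> hom2 S g g'; h \<in> hom1 S z w\<rbrakk>
        \<Longrightarrow> (h \<lhd> \<beta>) \<rhd> f = h \<lhd> (\<beta> \<rhd> f)"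

text \<open>
  A strict 2-category is a sesquicategory in which the two ways of forming the horizontal
  composite of \<open>\<alpha>\<close> and \<open>\<beta>\<close> from whiskerings agree (middle-four interchange).
\<close>

locale two_category = sesquicategory +
  assumes interchange:
    "\<lbrakk>f \<in> hom1 S x y; \<alpha> \<in> hom2 S f f'; g \<in> hom1 S y z; \<beta> \<in> hom2 S g g'\<rbrakk>
      \<Longrightarrow> (g' \<lhd> \<alpha>) \<cdot> (\<beta> \<rhd> f) = (\<beta> \<rhd> f') \<cdot> (g \<lhd> \<alpha>)"

record ('o, 'm, 't, 'o2, 'm2, 't2) cellmap =
  map0 :: "'o \<Rightarrow> 'o2"
  map1 :: "'m \<Rightarrow> 'm2"
  map2 :: "'t \<Rightarrow> 't2"

text \<open>Between 2-categories these are exactly the strict 2-functors.\<close>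

locale sesquifunctor =
  S: sesquicategory S + T: sesquicategory T
  for S :: "('o, 'm, 't) sesquicat" and T :: "('o2, 'm2, 't2) sesquicat" +
  fixes F :: "('o, 'm, 't, 'o2, 'm2, 't2) cellmap"
  assumes map0_closed: "x \<in> Cell0 S \<Longrightarrow> map0 F x \<in> Cell0 T"
    and map1_hom: "f \<in> hom1 S x y \<Longrightarrow> map1 F f \<in> hom1 T (map0 F x) (map0 F y)"
    and map2_hom: "\<alpha> \<in> hom2 S f g \<Longrightarrow> map2 F \<alpha> \<in> hom2 T (map1 F f) (map1 F g)"
    and map1_id1: "x \<in> Cell0 S \<Longrightarrow> map1 F (id1 S x) = id1 T (map0 F x)"
    and map1_comp1:
      "\<lbrakk>f \<in> hom1 S x y; g \<in> hom1 S y z\<rbrakk> \<Longrightarrow> map1 F (g \<star>\<^bsub>S\<^esub> f) = map1 F g \<star>\<^bsub>T\<^esub> map1 F f"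
    and map2_id2: "f \<in> Cell1 S \<Longrightarrow> map2 F (id2 S f) = id2 T (map1 F f)"
    and map2_comp2:
      "\<lbrakk>\<alpha> \<in> hom2 S f g; \<beta> \<in> hom2 S g h\<rbrakk> \<Longrightarrow> map2 F (\<beta> \<cdot>\<^bsub>S\<^esub> \<alpha>) = map2 F \<beta> \<cdot>\<^bsub>T\<^esub> map2 F \<alpha>"
    and map2_lwhisk:
      "\<lbrakk>f \<in> hom1 S x y; \<alpha> \<in> hom2 S f f'; g \<in> hom1 S y z\<rbrakk>
        \<Longrightarrow> map2 F (g \<lhd>\<^bsub>S\<^esub> \<alpha>) = map1 F g \<lhd>\<^bsub>T\<^esub> map2 F \<alpha>"
    and map2_rwhisk:
      "\<lbrakk>f \<in> hom1 S x y; g \<in> hom1 S y z; \<beta> \<in> hom2 S g g'\<rbrakk>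
        \<Longrightarrow> map2 F (\<beta> \<rhd>\<^bsub>S\<^esub> f) = map2 F \<beta> \<rhd>\<^bsub>T\<^esub> map1 F f"

definition sesquicat_isomorphic ::
  "('o, 'm, 't) sesquicat \<Rightarrow> ('o2, 'm2, 't2) sesquicat \<Rightarrow> bool" where
  "sesquicat_isomorphic S T \<longleftrightarrow>
    (\<exists>F G. sesquifunctor S T F \<and> sesquifunctor T S G \<and>
      (\<forall>x\<in>Cell0 S. map0 G (map0 F x) = x) \<and> (\<forall>x\<in>Cell0 T. map0 F (map0 G x) = x) \<and>
      (\<forall>f\<in>Cell1 S. map1 G (map1 F f) = f) \<and> (\<forall>f\<in>Cell1 T. map1 F (map1 G f) = f) \<and>
      (\<forall>\<alpha>\<in>Cell2 S. map2 G (map2 F \<alpha>) = \<alpha>) \<and> (\<forall>\<alpha>\<in>Cell2 T. map2 F (map2 G \<alpha>) = \<alpha>))"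

definition two_trivial_fibration ::
  "('o, 'm, 't) sesquicat \<Rightarrow> ('o2, 'm2, 't2) sesquicat \<Rightarrow> ('o, 'm, 't, 'o2, 'm2, 't2) cellmap \<Rightarrow> bool"
  where
  "two_trivial_fibration S T F \<longleftrightarrow>
    two_category S \<and> two_category T \<and> sesquifunctor S T F \<and>
    map0 F ` Cell0 S = Cell0 T \<and>
    (\<forall>x\<in>Cell0 S. \<forall>y\<in>Cell0 S.
      map1 F ` hom1 S x y = hom1 T (map0 F x) (map0 F y) \<and>
      (\<forall>f\<in>hom1 S x y. \<forall>g\<in>hom1 S x y.
        bij_betw (map2 F) (hom2 S f g) (hom2 T (map1 F f) (map1 F g))))"


section \<open>The Gray tensor product\<close>

text \<open>
  The (pseudo) Gray tensor product \<open>A \<otimes> B\<close> is the 2-category generated by 1-cells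
  \<open>f \<otimes> y\<close>, \<open>x \<otimes> g\<close>, 2-cells \<open>\<alpha> \<otimes> y\<close>, \<open>x \<otimes> \<beta>\<close>, and invertible 2-cells
  \<open>f \<otimes> g : (x' \<otimes> g)(f \<otimes> y) \<Rightarrow> (f \<otimes> y')(x \<otimes> g)\<close> for \<open>f : x \<rightarrow> x'\<close> and \<open>g : y \<rightarrow> y'\<close>, subject to:
  \<open>- \<otimes> y\<close> and \<open>x \<otimes> -\<close> are 2-functors, and \<open>f \<otimes> g\<close> is functorial in \<open>f\<close> and in \<open>g\<close> and natural
  with respect to 2-cells in either variable. Accordingly a 2-functor \<open>A \<otimes> B \<rightarrow> C\<close> is
  the following data: \<open>P y\<close> is the image of \<open>- \<otimes> y\<close>, \<open>Q x\<close> the image of \<open>x \<otimes> -\<close>, and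
  \<open>\<Gamma> f g\<close> the image of \<open>f \<otimes> g\<close>.
\<close>

locale gray_tensor_functor =
  A: two_category A + B: two_category B + C: two_category C
  for A :: "('o, 'm, 't) sesquicat" and B :: "('o2, 'm2, 't2) sesquicat"
    and C :: "('o3, 'm3, 't3) sesquicat" (structure) +
  fixes P :: "'o2 \<Rightarrow> ('o, 'm, 't, 'o3, 'm3, 't3) cellmap"
    and Q :: "'o \<Rightarrow> ('o2, 'm2, 't2, 'o3, 'm3, 't3) cellmap"
    and \<Gamma> :: "'m \<Rightarrow> 'm2 \<Rightarrow> 't3"
  assumes P_functor: "y \<in> Cell0 B \<Longrightarrow> sesquifunctor A C (P y)"
    and Q_functor: "x \<in> Cell0 A \<Longrightarrow> sesquifunctor B C (Q x)"
    and P_Q_agree: "\<lbrakk>x \<in> Cell0 A; y \<in> Cell0 B\<rbrakk> \<Longrightarrow> map0 (P y) x = map0 (Q x) y"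
    and \<Gamma>_hom:
      "\<lbrakk>f \<in> hom1 A x x'; g \<in> hom1 B y y'\<rbrakk>
        \<Longrightarrow> \<Gamma> f g \<in> hom2 C (map1 (Q x') g \<star> map1 (P y) f) (map1 (P y') f \<star> map1 (Q x) g)"
    and \<Gamma>_invertible:
      "\<lbrakk>f \<in> hom1 A x x'; g \<in> hom1 B y y'\<rbrakk>
        \<Longrightarrow> \<exists>\<Delta> \<in> hom2 C (map1 (P y') f \<star> map1 (Q x) g) (map1 (Q x') g \<star> map1 (P y) f).
              \<Delta> \<cdot> \<Gamma> f g = id2 C (map1 (Q x') g \<star> map1 (P y) f) \<and>
              \<Gamma> f g \<cdot> \<Delta> = id2 C (map1 (P y') f \<star> map1 (Q x) g)"
    and \<Gamma>_id_left:
      "\<lbrakk>x \<in> Cell0 A; g \<in> hom1 B y y'\<rbrakk> \<Longrightarrow> \<Gamma> (id1 A x) g = id2 C (map1 (Q x) g)"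
    and \<Gamma>_id_right:
      "\<lbrakk>f \<in> hom1 A x x'; y \<in> Cell0 B\<rbrakk> \<Longrightarrow> \<Gamma> f (id1 B y) = id2 C (map1 (P y) f)"
    and \<Gamma>_comp_left:
      "\<lbrakk>f \<in> hom1 A x x'; f' \<in> hom1 A x' x''; g \<in> hom1 B y y'\<rbrakk>
        \<Longrightarrow> \<Gamma> (f' \<star>\<^bsub>A\<^esub> f) g = (map1 (P y') f' \<lhd> \<Gamma> f g) \<cdot> (\<Gamma> f' g \<rhd> map1 (P y) f)"
    and \<Gamma>_comp_right:
      "\<lbrakk>f \<in> hom1 A x x'; g \<in> hom1 B y y'; g' \<in> hom1 B y' y''\<rbrakk>
        \<Longrightarrow> \<Gamma> f (g' \<star>\<^bsub>B\<^esub> g) = (\<Gamma> f g' \<rhd> map1 (Q x) g) \<cdot> (map1 (Q x') g' \<lhd> \<Gamma> f g)"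
    and \<Gamma>_natural_left:
      "\<lbrakk>f \<in> hom1 A x x'; \<alpha> \<in> hom2 A f f'; g \<in> hom1 B y y'\<rbrakk>
        \<Longrightarrow> \<Gamma> f' g \<cdot> (map1 (Q x') g \<lhd> map2 (P y) \<alpha>) = (map2 (P y') \<alpha> \<rhd> map1 (Q x) g) \<cdot> \<Gamma> f g"
    and \<Gamma>_natural_right:
      "\<lbrakk>f \<in> hom1 A x x'; g \<in> hom1 B y y'; \<beta> \<in> hom2 B g g'\<rbrakk>
        \<Longrightarrow> \<Gamma> f g' \<cdot> (map2 (Q x') \<beta> \<rhd> map1 (P y) f) = (map1 (P y') f \<lhd> map2 (Q x) \<beta>) \<cdot> \<Gamma> f g"


section \<open>Gray-categories\<close>

text \<open>
  The operations inherited from \<^typ>\<open>('o, 'm, 't) sesquicat\<close> are the composition of 1-cells,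
  the composition of 2-cells along 1-cells, and the whiskering of 2-cells by 1-cells. Then
  \<open>comp3\<close> composes 3-cells along 2-cells; \<open>lwhisk23\<close> and \<open>rwhisk23\<close> whisker 3-cells by
  2-cells (along a 1-cell); \<open>lwhisk13\<close> and \<open>rwhisk13\<close> whisker 3-cells by 1-cells
  (along a 0-cell); \<open>interchanger \<beta> \<alpha>\<close> is the 3-cell comparing the two horizontal
  composites of \<open>\<alpha> : f \<Rightarrow> f' : x \<rightarrow> y\<close> and \<open>\<beta> : g \<Rightarrow> g' : y \<rightarrow> z\<close>.
\<close>

record ('o, 'm, 't, 'r) gray = "('o, 'm, 't) sesquicat" +
  Cell3 :: "'r set"
  src3 :: "'r \<Rightarrow> 't"
  tgt3 :: "'r \<Rightarrow> 't"
  id3 :: "'t \<Rightarrow> 'r"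
  comp3 :: "'r \<Rightarrow> 'r \<Rightarrow> 'r"
  lwhisk23 :: "'t \<Rightarrow> 'r \<Rightarrow> 'r"
  rwhisk23 :: "'r \<Rightarrow> 't \<Rightarrow> 'r"
  lwhisk13 :: "'m \<Rightarrow> 'r \<Rightarrow> 'r"
  rwhisk13 :: "'r \<Rightarrow> 'm \<Rightarrow> 'r"
  interchanger :: "'t \<Rightarrow> 't \<Rightarrow> 'r"

definition hom_2cat :: "('o, 'm, 't, 'r) gray \<Rightarrow> 'o \<Rightarrow> 'o \<Rightarrow> ('m, 't, 'r) sesquicat" where
  "hom_2cat \<A> x y =
    \<lparr>Cell0 = hom1 \<A> x y,
     Cell1 = {\<alpha> \<in> Cell2 \<A>. src2 \<A> \<alpha> \<in> hom1 \<A> x y},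
     Cell2 = {\<Phi> \<in> Cell3 \<A>. src2 \<A> (src3 \<A> \<Phi>) \<in> hom1 \<A> x y},
     src1 = src2 \<A>, tgt1 = tgt2 \<A>, id1 = id2 \<A>, comp1 = comp2 \<A>,
     src2 = src3 \<A>, tgt2 = tgt3 \<A>, id2 = id3 \<A>, comp2 = comp3 \<A>,
     lwhisk = lwhisk23 \<A>, rwhisk = rwhisk23 \<A>\<rparr>"

text \<open>
  A category enriched in 2-categories with the Gray tensor product. The composition
  2-functors \<open>\<A>(y,z) \<otimes> \<A>(x,y) \<rightarrow> \<A>(x,z)\<close> are given by \<open>g \<otimes> f \<mapsto> g \<star> f\<close> on objects, by whiskering
  on the generators \<open>\<beta> \<otimes> f\<close>, \<open>g \<otimes> \<alpha>\<close> (and the corresponding 3-cells), and by the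
  interchanger on \<open>\<beta> \<otimes> \<alpha>\<close>. The unit and associativity laws are equations between 2-functors
  out of \<open>\<A>(x,y)\<close> and out of \<open>\<A>(z,w) \<otimes> \<A>(y,z) \<otimes> \<A>(x,y)\<close>; they are stated on generators.
\<close>

locale gray_category =
  fixes \<A> :: "('o, 'm, 't, 'r) gray" (structure)
  assumes src1_closed: "f \<in> Cell1 \<A> \<Longrightarrow> src1 \<A> f \<in> Cell0 \<A>"
    and tgt1_closed: "f \<in> Cell1 \<A> \<Longrightarrow> tgt1 \<A> f \<in> Cell0 \<A>"
    and src2_closed: "\<alpha> \<in> Cell2 \<A> \<Longrightarrow> src2 \<A> \<alpha> \<in> Cell1 \<A>"
    and src3_closed: "\<Phi> \<in> Cell3 \<A> \<Longrightarrow> src3 \<A> \<Phi> \<in> Cell2 \<A>"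
    and hom_two_category:
      "\<lbrakk>x \<in> Cell0 \<A>; y \<in> Cell0 \<A>\<rbrakk> \<Longrightarrow> two_category (hom_2cat \<A> x y)"
    and unit_hom: "x \<in> Cell0 \<A> \<Longrightarrow> id1 \<A> x \<in> hom1 \<A> x x"
    and composition:
      "\<lbrakk>x \<in> Cell0 \<A>; y \<in> Cell0 \<A>; z \<in> Cell0 \<A>\<rbrakk> \<Longrightarrow>
        gray_tensor_functor (hom_2cat \<A> y z) (hom_2cat \<A> x y) (hom_2cat \<A> x z)
          (\<lambda>f. \<lparr>map0 = \<lambda>g. g \<star> f, map1 = \<lambda>\<beta>. \<beta> \<rhd> f, map2 = \<lambda>\<Psi>. rwhisk13 \<A> \<Psi> f\<rparr>)
          (\<lambda>g. \<lparr>map0 = \<lambda>f. g \<star> f, map1 = \<lambda>\<alpha>. g \<lhd> \<alpha>, map2 = \<lambda>\<Phi>. lwhisk13 \<A> g \<Phi>\<rparr>)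
          (interchanger \<A>)"
    and unit_right:
      "f \<in> Cell0 (hom_2cat \<A> x y) \<Longrightarrow> f \<star> id1 \<A> x = f"
      "\<alpha> \<in> Cell1 (hom_2cat \<A> x y) \<Longrightarrow> \<alpha> \<rhd> id1 \<A> x = \<alpha>"
      "\<Phi> \<in> Cell2 (hom_2cat \<A> x y) \<Longrightarrow> rwhisk13 \<A> \<Phi> (id1 \<A> x) = \<Phi>"
    and unit_left:
      "f \<in> Cell0 (hom_2cat \<A> x y) \<Longrightarrow> id1 \<A> y \<star> f = f"
      "\<alpha> \<in> Cell1 (hom_2cat \<A> x y) \<Longrightarrow> id1 \<A> y \<lhd> \<alpha> = \<alpha>"
      "\<Phi> \<in> Cell2 (hom_2cat \<A> x y) \<Longrightarrow> lwhisk13 \<A> (id1 \<A> y) \<Phi> = \<Phi>"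
    and assoc_0:
      "\<lbrakk>f \<in> hom1 \<A> x y; g \<in> hom1 \<A> y z; h \<in> hom1 \<A> z w\<rbrakk> \<Longrightarrow> (h \<star> g) \<star> f = h \<star> (g \<star> f)"
    and assoc_1:
      "\<lbrakk>\<alpha> \<in> Cell1 (hom_2cat \<A> x y); g \<in> hom1 \<A> y z; h \<in> hom1 \<A> z w\<rbrakk>
        \<Longrightarrow> (h \<star> g) \<lhd> \<alpha> = h \<lhd> (g \<lhd> \<alpha>)"
      "\<lbrakk>f \<in> hom1 \<A> x y; \<beta> \<in> Cell1 (hom_2cat \<A> y z); h \<in> hom1 \<A> z w\<rbrakk>
        \<Longrightarrow> (h \<lhd> \<beta>) \<rhd> f = h \<lhd> (\<beta> \<rhd> f)"
      "\<lbrakk>f \<in> hom1 \<A> x y; g \<in> hom1 \<A> y z; \<gamma> \<in> Cell1 (hom_2cat \<A> z w)\<rbrakk>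
        \<Longrightarrow> (\<gamma> \<rhd> g) \<rhd> f = \<gamma> \<rhd> (g \<star> f)"
    and assoc_2:
      "\<lbrakk>\<Phi> \<in> Cell2 (hom_2cat \<A> x y); g \<in> hom1 \<A> y z; h \<in> hom1 \<A> z w\<rbrakk>
        \<Longrightarrow> lwhisk13 \<A> (h \<star> g) \<Phi> = lwhisk13 \<A> h (lwhisk13 \<A> g \<Phi>)"
      "\<lbrakk>f \<in> hom1 \<A> x y; \<Psi> \<in> Cell2 (hom_2cat \<A> y z); h \<in> hom1 \<A> z w\<rbrakk>
        \<Longrightarrow> rwhisk13 \<A> (lwhisk13 \<A> h \<Psi>) f = lwhisk13 \<A> h (rwhisk13 \<A> \<Psi> f)"
      "\<lbrakk>f \<in> hom1 \<A> x y; g \<in> hom1 \<A> y z; X \<in> Cell2 (hom_2cat \<A> z w)\<rbrakk>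
        \<Longrightarrow> rwhisk13 \<A> (rwhisk13 \<A> X g) f = rwhisk13 \<A> X (g \<star> f)"
    and assoc_interchanger:
      "\<lbrakk>\<alpha> \<in> Cell1 (hom_2cat \<A> x y); \<beta> \<in> Cell1 (hom_2cat \<A> y z); h \<in> hom1 \<A> z w\<rbrakk>
        \<Longrightarrow> interchanger \<A> (h \<lhd> \<beta>) \<alpha> = lwhisk13 \<A> h (interchanger \<A> \<beta> \<alpha>)"
      "\<lbrakk>\<alpha> \<in> Cell1 (hom_2cat \<A> x y); g \<in> hom1 \<A> y z; \<gamma> \<in> Cell1 (hom_2cat \<A> z w)\<rbrakk>
        \<Longrightarrow> interchanger \<A> (\<gamma> \<rhd> g) \<alpha> = interchanger \<A> \<gamma> (g \<lhd> \<alpha>)"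
      "\<lbrakk>f \<in> hom1 \<A> x y; \<beta> \<in> Cell1 (hom_2cat \<A> y z); \<gamma> \<in> Cell1 (hom_2cat \<A> z w)\<rbrakk>
        \<Longrightarrow> rwhisk13 \<A> (interchanger \<A> \<gamma> \<beta>) f = interchanger \<A> \<gamma> (\<beta> \<rhd> f)"

definition underlying_sesquicat :: "('o, 'm, 't, 'r) gray \<Rightarrow> ('o, 'm, 't) sesquicat" where
  "underlying_sesquicat \<A> = sesquicat.truncate \<A>"

record ('o, 'm, 't, 'o2, 'm2, 't2, 'r, 'r2) graymap =
  "('o, 'm, 't, 'o2, 'm2, 't2) cellmap" +
  map3 :: "'r \<Rightarrow> 'r2"

definition hom_map ::
  "('o, 'm, 't, 'o2, 'm2, 't2, 'r, 'r2) graymap \<Rightarrow> ('m, 't, 'r, 'm2, 't2, 'r2) cellmap" where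
  "hom_map F = \<lparr>map0 = map1 F, map1 = map2 F, map2 = map3 F\<rparr>"

text \<open>
  Preservation of composition is an equation between 2-functors out of \<open>\<A>(y,z) \<otimes> \<A>(x,y)\<close>,
  again stated on generators.
\<close>

locale gray_functor =
  A: gray_category \<A> + B: gray_category \<B>
  for \<A> :: "('o, 'm, 't, 'r) gray" and \<B> :: "('o2, 'm2, 't2, 'r2) gray" +
  fixes F :: "('o, 'm, 't, 'o2, 'm2, 't2, 'r, 'r2) graymap"
  assumes map0_closed: "x \<in> Cell0 \<A> \<Longrightarrow> map0 F x \<in> Cell0 \<B>"
    and hom_functor:
      "\<lbrakk>x \<in> Cell0 \<A>; y \<in> Cell0 \<A>\<rbrakk> \<Longrightarrow>
        sesquifunctor (hom_2cat \<A> x y) (hom_2cat \<B> (map0 F x) (map0 F y)) (hom_map F)"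
    and map_unit: "x \<in> Cell0 \<A> \<Longrightarrow> map1 F (id1 \<A> x) = id1 \<B> (map0 F x)"
    and map_comp1:
      "\<lbrakk>f \<in> hom1 \<A> x y; g \<in> hom1 \<A> y z\<rbrakk> \<Longrightarrow> map1 F (g \<star>\<^bsub>\<A>\<^esub> f) = map1 F g \<star>\<^bsub>\<B>\<^esub> map1 F f"
    and map_rwhisk:
      "\<lbrakk>f \<in> hom1 \<A> x y; \<beta> \<in> Cell1 (hom_2cat \<A> y z)\<rbrakk>
        \<Longrightarrow> map2 F (\<beta> \<rhd>\<^bsub>\<A>\<^esub> f) = map2 F \<beta> \<rhd>\<^bsub>\<B>\<^esub> map1 F f"
    and map_lwhisk:
      "\<lbrakk>\<alpha> \<in> Cell1 (hom_2cat \<A> x y); g \<in> hom1 \<A> y z\<rbrakk>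
        \<Longrightarrow> map2 F (g \<lhd>\<^bsub>\<A>\<^esub> \<alpha>) = map1 F g \<lhd>\<^bsub>\<B>\<^esub> map2 F \<alpha>"
    and map_rwhisk13:
      "\<lbrakk>f \<in> hom1 \<A> x y; \<Psi> \<in> Cell2 (hom_2cat \<A> y z)\<rbrakk>
        \<Longrightarrow> map3 F (rwhisk13 \<A> \<Psi> f) = rwhisk13 \<B> (map3 F \<Psi>) (map1 F f)"
    and map_lwhisk13:
      "\<lbrakk>\<Phi> \<in> Cell2 (hom_2cat \<A> x y); g \<in> hom1 \<A> y z\<rbrakk>
        \<Longrightarrow> map3 F (lwhisk13 \<A> g \<Phi>) = lwhisk13 \<B> (map1 F g) (map3 F \<Phi>)"
    and map_interchanger:
      "\<lbrakk>\<alpha> \<in> Cell1 (hom_2cat \<A> x y); \<beta> \<in> Cell1 (hom_2cat \<A> y z)\<rbrakk>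
        \<Longrightarrow> map3 F (interchanger \<A> \<beta> \<alpha>) = interchanger \<B> (map2 F \<beta>) (map2 F \<alpha>)"

definition gray_trivial_fibration ::
  "('o, 'm, 't, 'r) gray \<Rightarrow> ('o2, 'm2, 't2, 'r2) gray \<Rightarrow>
    ('o, 'm, 't, 'o2, 'm2, 't2, 'r, 'r2) graymap \<Rightarrow> bool" where
  "gray_trivial_fibration \<A> \<B> F \<longleftrightarrow>
    gray_functor \<A> \<B> F \<and>
    map0 F ` Cell0 \<A> = Cell0 \<B> \<and>
    (\<forall>x\<in>Cell0 \<A>. \<forall>y\<in>Cell0 \<A>.
      two_trivial_fibration (hom_2cat \<A> x y) (hom_2cat \<B> (map0 F x) (map0 F y)) (hom_map F))"

definition graymap_comp ::
  "('o2, 'm2, 't2, 'o3, 'm3, 't3, 'r2, 'r3) graymap \<Rightarrow>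
    ('o, 'm, 't, 'o2, 'm2, 't2, 'r, 'r2) graymap \<Rightarrow>
    ('o, 'm, 't, 'o3, 'm3, 't3, 'r, 'r3) graymap" where
  "graymap_comp G F =
    \<lparr>map0 = map0 G \<circ> map0 F, map1 = map1 G \<circ> map1 F, map2 = map2 G \<circ> map2 F,
     map3 = map3 G \<circ> map3 F\<rparr>"

text \<open>Equality of Gray-functors with domain \<open>\<A>\<close>: the values off the carriers are irrelevant.\<close>

definition graymap_eq_on ::
  "('o, 'm, 't, 'r) gray \<Rightarrow> ('o, 'm, 't, 'o2, 'm2, 't2, 'r, 'r2) graymap \<Rightarrow>
    ('o, 'm, 't, 'o2, 'm2, 't2, 'r, 'r2) graymap \<Rightarrow> bool" where
  "graymap_eq_on \<A> F G \<longleftrightarrow>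
    (\<forall>x\<in>Cell0 \<A>. map0 F x = map0 G x) \<and> (\<forall>f\<in>Cell1 \<A>. map1 F f = map1 G f) \<and>
    (\<forall>\<alpha>\<in>Cell2 \<A>. map2 F \<alpha> = map2 G \<alpha>) \<and> (\<forall>\<Phi>\<in>Cell3 \<A>. map3 F \<Phi> = map3 G \<Phi>)"

text \<open>
  The type \<open>'u\<close> plays the role of the universe of small sets: the trivial fibrations tested
  against are those between Gray-categories whose cells are drawn from \<open>'u\<close>.
\<close>

definition llp_trivial_fibrations ::
  "'u itself \<Rightarrow> ('o, 'm, 't, 'r) gray \<Rightarrow> ('o2, 'm2, 't2, 'r2) gray \<Rightarrow>
    ('o, 'm, 't, 'o2, 'm2, 't2, 'r, 'r2) graymap \<Rightarrow> bool" where
  "llp_trivial_fibrations U \<A> \<B> i \<longleftrightarrow>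
    (\<forall>(\<X> :: ('u, 'u, 'u, 'u) gray) (\<Y> :: ('u, 'u, 'u, 'u) gray) p u v.
      gray_trivial_fibration \<X> \<Y> p \<and> gray_functor \<A> \<X> u \<and> gray_functor \<B> \<Y> v \<and>
      graymap_eq_on \<A> (graymap_comp p u) (graymap_comp v i) \<longrightarrow>
      (\<exists>d. gray_functor \<B> \<X> d \<and>
        graymap_eq_on \<A> (graymap_comp d i) u \<and> graymap_eq_on \<B> (graymap_comp p d) v))"

definition initial_gray :: "('o, 'm, 't, 'r) gray" where
  "initial_gray = undefined\<lparr>Cell0 := {}, Cell1 := {}, Cell2 := {}, Cell3 := {}\<rparr>"

definition initial_map :: "('o, 'm, 't, 'o2, 'm2, 't2, 'r, 'r2) graymap" where
  "initial_map = undefined"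

definition cofibrant :: "'u itself \<Rightarrow> ('o, 'm, 't, 'r) gray \<Rightarrow> bool" where
  "cofibrant U \<A> \<longleftrightarrow>
    gray_category \<A> \<and>
    llp_trivial_fibrations U (initial_gray :: (unit, unit, unit, unit) gray) \<A> initial_map"


section \<open>Computads and free sesquicategories\<close>

text \<open>
  A path \<open>(u, p, v)\<close> from \<open>u\<close> to \<open>v\<close> lists its edges \<open>p\<close> in the order of traversal, so the list
  \<open>[f\<^sub>1, \<dots>, f\<^sub>n]\<close> stands for the path written \<open>f\<^sub>n \<dots> f\<^sub>1\<close>.
\<close>

type_synonym ('v, 'e) path = "'v \<times> 'e list \<times> 'v"

definition paths :: "('v, 'e) pre_digraph \<Rightarrow> ('v, 'e) path set" where
  "paths G = {(u, p, v). pre_digraph.awalk G u p v}"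

fun path_src :: "('v, 'e) path \<Rightarrow> 'v" where "path_src (u, p, v) = u"
fun path_tgt :: "('v, 'e) path \<Rightarrow> 'v" where "path_tgt (u, p, v) = v"
fun path_edges :: "('v, 'e) path \<Rightarrow> 'e list" where "path_edges (u, p, v) = p"

definition path_id :: "'v \<Rightarrow> ('v, 'e) path" where
  "path_id v = (v, [], v)"

definition path_comp :: "('v, 'e) path \<Rightarrow> ('v, 'e) path \<Rightarrow> ('v, 'e) path" where
  "path_comp q p = (path_src p, path_edges p @ path_edges q, path_tgt q)"

definition path_map :: "('v \<Rightarrow> 'v2) \<Rightarrow> ('e \<Rightarrow> 'e2) \<Rightarrow> ('v, 'e) path \<Rightarrow> ('v2, 'e2) path" where
  "path_map a b p = (a (path_src p), map b (path_edges p), a (path_tgt p))"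

record ('v, 'e, 'c) computad =
  graph :: "('v, 'e) pre_digraph"
  gens :: "'c set"
  dom2 :: "'c \<Rightarrow> ('v, 'e) path"
  cod2 :: "'c \<Rightarrow> ('v, 'e) path"

locale computad =
  fixes G :: "('v, 'e, 'c) computad"
  assumes wf_graph: "wf_digraph (graph G)"
    and dom2_path: "c \<in> gens G \<Longrightarrow> dom2 G c \<in> paths (graph G)"
    and cod2_path: "c \<in> gens G \<Longrightarrow> cod2 G c \<in> paths (graph G)"
    and globular_src: "c \<in> gens G \<Longrightarrow> path_src (dom2 G c) = path_src (cod2 G c)"
    and globular_tgt: "c \<in> gens G \<Longrightarrow> path_tgt (dom2 G c) = path_tgt (cod2 G c)"

locale computad_morphism =
  G: computad G + H: computad H
  for G :: "('v, 'e, 'c) computad" and H :: "('v2, 'e2, 'c2) computad" +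
  fixes \<phi> :: "('v, 'e, 'c, 'v2, 'e2, 'c2) cellmap"
  assumes map_verts: "x \<in> verts (graph G) \<Longrightarrow> map0 \<phi> x \<in> verts (graph H)"
    and map_arcs: "e \<in> arcs (graph G) \<Longrightarrow> map1 \<phi> e \<in> arcs (graph H)"
    and map_tail: "e \<in> arcs (graph G) \<Longrightarrow> tail (graph H) (map1 \<phi> e) = map0 \<phi> (tail (graph G) e)"
    and map_head: "e \<in> arcs (graph G) \<Longrightarrow> head (graph H) (map1 \<phi> e) = map0 \<phi> (head (graph G) e)"
    and map_gens: "c \<in> gens G \<Longrightarrow> map2 \<phi> c \<in> gens H"
    and map_dom2: "c \<in> gens G \<Longrightarrow> dom2 H (map2 \<phi> c) = path_map (map0 \<phi>) (map1 \<phi>) (dom2 G c)"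
    and map_cod2: "c \<in> gens G \<Longrightarrow> cod2 H (map2 \<phi> c) = path_map (map0 \<phi>) (map1 \<phi>) (cod2 G c)"

text \<open>
  The forgetful functor from sesquicategories to computads. The paths at either end are part of
  a 2-cell of the computad, since a 1-cell is in general the composite of many paths.
\<close>

definition path_composite :: "('o, 'm, 't) sesquicat \<Rightarrow> ('o, 'm) path \<Rightarrow> 'm" where
  "path_composite S p = foldl (\<lambda>g f. f \<star>\<^bsub>S\<^esub> g) (id1 S (path_src p)) (path_edges p)"

definition underlying_graph :: "('o, 'm, 't) sesquicat \<Rightarrow> ('o, 'm) pre_digraph" where
  "underlying_graph S = \<lparr>verts = Cell0 S, arcs = Cell1 S, tail = src1 S, head = tgt1 S\<rparr>"

definition underlying_computad ::
  "('o, 'm, 't) sesquicat \<Rightarrow> ('o, 'm, ('o, 'm) path \<times> 't \<times> ('o, 'm) path) computad" where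
  "underlying_computad S =
    \<lparr>graph = underlying_graph S,
     gens = {(p, \<alpha>, q). p \<in> paths (underlying_graph S) \<and> q \<in> paths (underlying_graph S) \<and>
       path_src p = path_src q \<and> path_tgt p = path_tgt q \<and>
       \<alpha> \<in> hom2 S (path_composite S p) (path_composite S q)},
     dom2 = \<lambda>(p, \<alpha>, q). p, cod2 = \<lambda>(p, \<alpha>, q). q\<rparr>"

definition underlying_computad_map ::
  "('o, 'm, 't, 'o2, 'm2, 't2) cellmap \<Rightarrow>
    ('o, 'm, ('o, 'm) path \<times> 't \<times> ('o, 'm) path,
     'o2, 'm2, ('o2, 'm2) path \<times> 't2 \<times> ('o2, 'm2) path) cellmap" where
  "underlying_computad_map F =
    \<lparr>map0 = map0 F, map1 = map1 F,
     map2 = \<lambda>(p, \<alpha>, q). (path_map (map0 F) (map1 F) p, map2 F \<alpha>, path_map (map0 F) (map1 F) q)\<rparr>"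

text \<open>
  The free sesquicategory \<open>HG\<close> on a computad \<open>G\<close>. In the absence of middle-four interchange the
  2-cells are the formal composites of whiskered generators: each hom-category is free on the
  graph whose vertices are the paths in \<open>G\<close> and whose edges are triples \<open>(l, c, r)\<close> standing for
  \<open>l \<lhd> c \<rhd> r\<close>. That this is the value at \<open>G\<close> of the left adjoint to the forgetful functor is
  proved in \<open>free_sesquicat_universal\<close> below.
\<close>

type_synonym ('v, 'e, 'c) whisk = "('v, 'e) path \<times> 'c \<times> ('v, 'e) path"

definition whisker_graph ::
  "('v, 'e, 'c) computad \<Rightarrow> (('v, 'e) path, ('v, 'e, 'c) whisk) pre_digraph" where
  "whisker_graph G =
    \<lparr>verts = paths (graph G),
     arcs = {(l, c, r). l \<in> paths (graph G) \<and> c \<in> gens G \<and> r \<in> paths (graph G) \<and>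
       path_src l = path_tgt (dom2 G c) \<and> path_tgt r = path_src (dom2 G c)},
     tail = \<lambda>(l, c, r). path_comp l (path_comp (dom2 G c) r),
     head = \<lambda>(l, c, r). path_comp l (path_comp (cod2 G c) r)\<rparr>"

definition free_sesquicat ::
  "('v, 'e, 'c) computad \<Rightarrow>
    ('v, ('v, 'e) path, (('v, 'e) path, ('v, 'e, 'c) whisk) path) sesquicat" where
  "free_sesquicat G =
    \<lparr>Cell0 = verts (graph G),
     Cell1 = paths (graph G),
     Cell2 = paths (whisker_graph G),
     src1 = path_src, tgt1 = path_tgt, id1 = path_id, comp1 = path_comp,
     src2 = path_src, tgt2 = path_tgt, id2 = path_id, comp2 = path_comp,
     lwhisk = \<lambda>g. path_map (path_comp g) (\<lambda>(l, c, r). (path_comp g l, c, r)),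
     rwhisk = \<lambda>\<beta> f. path_map (\<lambda>g. path_comp g f) (\<lambda>(l, c, r). (l, c, path_comp r f)) \<beta>\<rparr>"

definition free_unit ::
  "('v, 'e, 'c) computad \<Rightarrow>
    ('v, 'e, 'c, 'v, ('v, 'e) path,
     ('v, ('v, 'e) path) path \<times> (('v, 'e) path, ('v, 'e, 'c) whisk) path \<times>
     ('v, ('v, 'e) path) path) cellmap" where
  "free_unit G =
    (let edge = \<lambda>e. (tail (graph G) e, [e], head (graph G) e) in
    \<lparr>map0 = \<lambda>x. x,
     map1 = edge,
     map2 = \<lambda>c. (path_map (\<lambda>x. x) edge (dom2 G c),
       (dom2 G c,
        [(path_id (path_tgt (dom2 G c)), c, path_id (path_src (dom2 G c)))],
        cod2 G c),
       path_map (\<lambda>x. x) edge (cod2 G c))\<rparr>)"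

definition cellmap_eq_on ::
  "('o, 'm, 't) sesquicat \<Rightarrow> ('o, 'm, 't, 'o2, 'm2, 't2) cellmap \<Rightarrow>
    ('o, 'm, 't, 'o2, 'm2, 't2) cellmap \<Rightarrow> bool" where
  "cellmap_eq_on S F G \<longleftrightarrow>
    (\<forall>x\<in>Cell0 S. map0 F x = map0 G x) \<and> (\<forall>f\<in>Cell1 S. map1 F f = map1 G f) \<and>
    (\<forall>\<alpha>\<in>Cell2 S. map2 F \<alpha> = map2 G \<alpha>)"

text \<open>The equation \<open>V F \<circ> \<eta> = \<phi>\<close> of computad morphisms out of \<open>G\<close>.\<close>

definition extends_along_unit ::
  "('v, 'e, 'c) computad \<Rightarrow>
    ('v, ('v, 'e) path, (('v, 'e) path, ('v, 'e, 'c) whisk) path, 'o, 'm, 't) cellmap \<Rightarrow>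
    ('v, 'e, 'c, 'o, 'm, ('o, 'm) path \<times> 't \<times> ('o, 'm) path) cellmap \<Rightarrow> bool" where
  "extends_along_unit G F \<phi> \<longleftrightarrow>
    (\<forall>x\<in>verts (graph G). map0 (underlying_computad_map F) (map0 (free_unit G) x) = map0 \<phi> x) \<and>
    (\<forall>e\<in>arcs (graph G). map1 (underlying_computad_map F) (map1 (free_unit G) e) = map1 \<phi> e) \<and>
    (\<forall>c\<in>gens G. map2 (underlying_computad_map F) (map2 (free_unit G) c) = map2 \<phi> c)"


subsection \<open>Paths\<close>

lemma mem_paths_iff [simp]: "(u, p, v) \<in> paths G \<longleftrightarrow> pre_digraph.awalk G u p v"
  by (simp add: paths_def)

lemma path_comp_triple [simp]: "path_comp (v', q, w) (u, p, v) = (u, p @ q, w)"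
  by (simp add: path_comp_def)

lemma path_comp_assoc: "path_comp (path_comp r q) p = path_comp r (path_comp q p)"
  by (cases p; cases q; cases r) simp

lemma path_src_comp [simp]: "path_src (path_comp q p) = path_src p"
  and path_tgt_comp [simp]: "path_tgt (path_comp q p) = path_tgt q"
  by (simp_all add: path_comp_def)

lemma path_src_id [simp]: "path_src (path_id x) = x"
  and path_tgt_id [simp]: "path_tgt (path_id x) = x"
  by (simp_all add: path_id_def)

lemma path_comp_id_right: "path_src p = x \<Longrightarrow> path_comp p (path_id x) = p"
  by (cases p) (simp add: path_id_def)

lemma path_comp_id_left: "path_tgt p = x \<Longrightarrow> path_comp (path_id x) p = p"
  by (cases p) (simp add: path_id_def)

lemma path_map_triple [simp]: "path_map a b (u, p, v) = (a u, map b p, a v)"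
  by (simp add: path_map_def)

lemma path_map_comp: "path_map a b (path_comp q p) = path_comp (path_map a b q) (path_map a b p)"
  by (cases p; cases q) simp

context wf_digraph
begin

lemma path_src_in_verts: "p \<in> paths G \<Longrightarrow> path_src p \<in> verts G"
  and path_tgt_in_verts: "p \<in> paths G \<Longrightarrow> path_tgt p \<in> verts G"
  by (cases p; auto)+

lemma path_id_in_paths: "x \<in> verts G \<Longrightarrow> path_id x \<in> paths G"
  by (simp add: path_id_def awalk_Nil_iff)

lemma path_comp_in_paths:
  "\<lbrakk>p \<in> paths G; q \<in> paths G; path_tgt p = path_src q\<rbrakk> \<Longrightarrow> path_comp q p \<in> paths G"
  by (cases p; cases q) (auto intro: awalk_appendI)

lemma awalk_snoc_iff:
  "awalk u (p @ [e]) v \<longleftrightarrow> awalk u p (tail G e) \<and> e \<in> arcs G \<and> head G e = v"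
  by (auto simp: awalk_append_iff awalk_Cons_iff awalk_Nil_iff)

end

text \<open>A graph morphism to the underlying graph of a category extends uniquely along paths.\<close>

locale path_extension = wf_digraph G
  for G :: "('v, 'e) pre_digraph" +
  fixes ob :: "'o set" and hom :: "'o \<Rightarrow> 'o \<Rightarrow> 'm set" and idt :: "'o \<Rightarrow> 'm"
    and cmp :: "'m \<Rightarrow> 'm \<Rightarrow> 'm" and a :: "'v \<Rightarrow> 'o" and b :: "'e \<Rightarrow> 'm"
  assumes idt_hom: "x \<in> ob \<Longrightarrow> idt x \<in> hom x x"
    and cmp_hom: "\<lbrakk>f \<in> hom x y; g \<in> hom y z\<rbrakk> \<Longrightarrow> cmp g f \<in> hom x z"
    and cmp_idt_right: "f \<in> hom x y \<Longrightarrow> cmp f (idt x) = f"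
    and cmp_idt_left: "f \<in> hom x y \<Longrightarrow> cmp (idt y) f = f"
    and cmp_assoc: "\<lbrakk>f \<in> hom x y; g \<in> hom y z; h \<in> hom z w\<rbrakk> \<Longrightarrow> cmp (cmp h g) f = cmp h (cmp g f)"
    and a_ob: "v \<in> verts G \<Longrightarrow> a v \<in> ob"
    and b_hom: "e \<in> arcs G \<Longrightarrow> b e \<in> hom (a (tail G e)) (a (head G e))"
begin

definition ext :: "('v, 'e) path \<Rightarrow> 'm" where
  "ext p = foldl (\<lambda>g e. cmp (b e) g) (idt (a (path_src p))) (path_edges p)"

lemma ext_Nil [simp]: "ext (u, [], v) = idt (a u)"
  by (simp add: ext_def)

lemma ext_snoc: "ext (u, p @ [e], v) = cmp (b e) (ext (u, p, v'))"
  by (simp add: ext_def)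

lemma ext_walk_hom: "awalk u p v \<Longrightarrow> ext (u, p, v) \<in> hom (a u) (a v)"
proof (induction p arbitrary: v rule: rev_induct)
  case Nil
  then show ?case by (auto simp: awalk_Nil_iff intro: idt_hom a_ob)
next
  case (snoc e p)
  then have "awalk u p (tail G e)" "e \<in> arcs G" "v = head G e" by (auto simp: awalk_snoc_iff)
  then show ?case
    using cmp_hom[OF snoc.IH b_hom] by (simp add: ext_snoc[where v' = "tail G e"])
qed

lemma ext_hom: "p \<in> paths G \<Longrightarrow> ext p \<in> hom (a (path_src p)) (a (path_tgt p))"
  by (cases p) (simp add: ext_walk_hom)

lemma ext_walk_append:
  "\<lbrakk>awalk u p v; awalk v q w\<rbrakk> \<Longrightarrow> ext (u, p @ q, w) = cmp (ext (v, q, w)) (ext (u, p, v))"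
proof (induction q arbitrary: w rule: rev_induct)
  case Nil
  have "ext (u, p, w) = ext (u, p, v)" by (simp add: ext_def)
  then show ?case using Nil ext_walk_hom[of u p v] by (auto simp: cmp_idt_left)
next
  case (snoc e q)
  let ?t = "tail G e"
  have *: "awalk v q ?t" "e \<in> arcs G" "head G e = w" using snoc.prems by (auto simp: awalk_snoc_iff)
  have "ext (u, (p @ q) @ [e], w) = cmp (b e) (ext (u, p @ q, ?t))"
    by (rule ext_snoc)
  also have "\<dots> = cmp (b e) (cmp (ext (v, q, ?t)) (ext (u, p, v)))" using snoc * by simp
  also have "\<dots> = cmp (cmp (b e) (ext (v, q, ?t))) (ext (u, p, v))"
    using cmp_assoc[OF ext_walk_hom[OF snoc.prems(1)] ext_walk_hom[OF *(1)] b_hom[OF *(2)]] by simp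
  also have "cmp (b e) (ext (v, q, ?t)) = ext (v, q @ [e], w)" by (rule ext_snoc[symmetric])
  finally show ?case by simp
qed

lemma ext_comp:
  "\<lbrakk>p \<in> paths G; q \<in> paths G; path_tgt p = path_src q\<rbrakk> \<Longrightarrow> ext (path_comp q p) = cmp (ext q) (ext p)"
  by (cases p; cases q) (auto intro: ext_walk_append)

lemma ext_arc: "e \<in> arcs G \<Longrightarrow> ext (tail G e, [e], v) = b e"
  using ext_snoc[of "tail G e" "[]" e v "tail G e"] b_hom[of e] by (simp add: cmp_idt_right)

lemma ext_unique:
  assumes "\<And>v. v \<in> verts G \<Longrightarrow> F (v, [], v) = idt (a v)"
    and "\<And>e. e \<in> arcs G \<Longrightarrow> F (tail G e, [e], head G e) = b e"
    and "\<And>p q. \<lbrakk>p \<in> paths G; q \<in> paths G; path_tgt p = path_src q\<rbrakk>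
      \<Longrightarrow> F (path_comp q p) = cmp (F q) (F p)"
    and "p \<in> paths G"
  shows "F p = ext p"
proof -
  have "awalk u p v \<Longrightarrow> F (u, p, v) = ext (u, p, v)" for u p v
  proof (induction p arbitrary: v rule: rev_induct)
    case Nil
    then show ?case using assms(1) by (auto simp: awalk_Nil_iff)
  next
    case (snoc e p)
    then have *: "awalk u p (tail G e)" "e \<in> arcs G" "v = head G e" by (auto simp: awalk_snoc_iff)
    have "F (u, p @ [e], v) = cmp (F (tail G e, [e], v)) (F (u, p, tail G e))"
      using assms(3)[of "(u, p, tail G e)" "(tail G e, [e], v)"] *
      by (simp add: awalk_Cons_iff awalk_Nil_iff)
    also have "\<dots> = cmp (b e) (ext (u, p, tail G e))" using snoc * assms(2) by simp
    also have "\<dots> = ext (u, p @ [e], v)" by (rule ext_snoc[symmetric])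
    finally show ?case .
  qed
  then show ?thesis using assms(4) by (cases p) auto
qed

end


subsection \<open>The underlying computad and its functoriality\<close>

lemma hom1_iff: "f \<in> hom1 S x y \<longleftrightarrow> f \<in> Cell1 S \<and> src1 S f = x \<and> tgt1 S f = y"
  by (simp add: hom1_def)

lemma hom2_iff: "\<alpha> \<in> hom2 S f g \<longleftrightarrow> \<alpha> \<in> Cell2 S \<and> src2 S \<alpha> = f \<and> tgt2 S \<alpha> = g"
  by (simp add: hom2_def)

context sesquicategory
begin

lemma wf_underlying_graph: "wf_digraph (underlying_graph S)"
  by unfold_locales (auto simp: underlying_graph_def src1_closed tgt1_closed)

lemma path_extension_1:
  assumes "wf_digraph G" and "\<And>v. v \<in> verts G \<Longrightarrow> a v \<in> Cell0 S"
    and "\<And>e. e \<in> arcs G \<Longrightarrow> b e \<in> hom1 S (a (tail G e)) (a (head G e))"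
  shows "path_extension G (Cell0 S) (hom1 S) (id1 S) (comp1 S) a b"
proof -
  interpret wf_digraph G by fact
  show ?thesis
    by unfold_locales
      (use assms in \<open>auto intro: id1_hom comp1_hom comp1_id_right comp1_id_left comp1_assoc\<close>)
qed

lemma path_extension_2:
  assumes "wf_digraph G" and "\<And>v. v \<in> verts G \<Longrightarrow> a v \<in> Cell1 S"
    and "\<And>e. e \<in> arcs G \<Longrightarrow> b e \<in> hom2 S (a (tail G e)) (a (head G e))"
  shows "path_extension G (Cell1 S) (hom2 S) (id2 S) (comp2 S) a b"
proof -
  interpret wf_digraph G by fact
  show ?thesis
    by unfold_locales
      (use assms in \<open>auto intro: id2_hom comp2_hom comp2_id_right comp2_id_left comp2_assoc\<close>)
qed

lemma underlying_path_extension: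
  "path_extension (underlying_graph S) (Cell0 S) (hom1 S) (id1 S) (comp1 S) (\<lambda>x. x) (\<lambda>f. f)"
  by (rule path_extension_1[OF wf_underlying_graph]) (auto simp: underlying_graph_def hom1_iff)

lemma path_composite_eq_ext:
  "path_composite S = path_extension.ext (id1 S) (comp1 S) (\<lambda>x. x) (\<lambda>f. f)"
  by (simp add: fun_eq_iff path_composite_def path_extension.ext_def[OF underlying_path_extension])

lemma path_composite_hom:
  "p \<in> paths (underlying_graph S) \<Longrightarrow> path_composite S p \<in> hom1 S (path_src p) (path_tgt p)"
  unfolding path_composite_eq_ext by (rule path_extension.ext_hom[OF underlying_path_extension])

lemma computad_underlying: "computad (underlying_computad S)"
  by unfold_locales (auto simp: underlying_computad_def wf_underlying_graph wf_digraph.wellformed[OF wf_underlying_graph])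

end

lemma path_map_in_paths:
  assumes "wf_digraph G" "wf_digraph H"
    and "\<And>v. v \<in> verts G \<Longrightarrow> a v \<in> verts H"
    and "\<And>e. e \<in> arcs G \<Longrightarrow> b e \<in> arcs H \<and> tail H (b e) = a (tail G e) \<and> head H (b e) = a (head G e)"
    and "p \<in> paths G"
  shows "path_map a b p \<in> paths H"
proof -
  interpret G: wf_digraph G by fact
  interpret H: wf_digraph H by fact
  have "G.awalk u p v \<Longrightarrow> H.awalk (a u) (map b p) (a v)" for u p v
    by (induction p arbitrary: v rule: rev_induct)
      (use assms in \<open>auto simp: G.awalk_snoc_iff H.awalk_snoc_iff G.awalk_Nil_iff H.awalk_Nil_iff
        simp del: G.awalk_append_iff H.awalk_append_iff\<close>)
  then show ?thesis using assms(5) by (cases p) auto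
qed

lemma (in sesquifunctor) path_composite_map:
  assumes "p \<in> paths (underlying_graph S)"
  shows "path_composite T (path_map (map0 F) (map1 F) p) = map1 F (path_composite S p)"
proof -
  interpret E: path_extension "underlying_graph S" "Cell0 T" "hom1 T" "id1 T" "comp1 T" "map0 F" "map1 F"
    by (rule T.path_extension_1[OF S.wf_underlying_graph])
      (auto simp: underlying_graph_def hom1_iff map0_closed intro!: map1_hom[unfolded hom1_iff])
  interpret D: path_extension "underlying_graph S" "Cell0 S" "hom1 S" "id1 S" "comp1 S" "\<lambda>x. x" "\<lambda>f. f"
    by (rule S.underlying_path_extension)
  have "map1 F (path_composite S p) = E.ext p"
  proof (rule E.ext_unique[OF _ _ _ assms])
    show "map1 F (path_composite S (v, [], v)) = id1 T (map0 F v)" if "v \<in> verts (underlying_graph S)" for v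
      using that by (simp add: path_composite_def map1_id1 underlying_graph_def)
  next
    fix e assume "e \<in> arcs (underlying_graph S)"
    then show "map1 F (path_composite S (tail (underlying_graph S) e, [e], head (underlying_graph S) e)) = map1 F e"
      using D.ext_arc[of e] by (simp add: S.path_composite_eq_ext)
  next
    fix p q assume *: "p \<in> paths (underlying_graph S)" "q \<in> paths (underlying_graph S)" "path_tgt p = path_src q"
    show "map1 F (path_composite S (path_comp q p))
      = comp1 T (map1 F (path_composite S q)) (map1 F (path_composite S p))"
      using D.ext_comp[OF *] D.ext_hom[OF *(1)] D.ext_hom[OF *(2)] *(3)
      by (simp add: S.path_composite_eq_ext map1_comp1)
  qed
  moreover have "path_composite T (path_map (map0 F) (map1 F) p) = E.ext p"
    by (simp add: path_composite_def E.ext_def path_map_def foldl_map)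
  ultimately show ?thesis by simp
qed

lemma (in sesquifunctor) computad_morphism_underlying:
  "computad_morphism (underlying_computad S) (underlying_computad T) (underlying_computad_map F)"
proof -
  interpret VS: computad "underlying_computad S" by (rule S.computad_underlying)
  interpret VT: computad "underlying_computad T" by (rule T.computad_underlying)
  have arc: "map1 F e \<in> Cell1 T \<and> src1 T (map1 F e) = map0 F (src1 S e) \<and> tgt1 T (map1 F e) = map0 F (tgt1 S e)"
    if "e \<in> Cell1 S" for e
    using map1_hom[of e "src1 S e" "tgt1 S e"] that by (simp add: hom1_iff)
  have pth: "path_map (map0 F) (map1 F) p \<in> paths (underlying_graph T)"
    if "p \<in> paths (underlying_graph S)" for p
    by (rule path_map_in_paths[OF S.wf_underlying_graph T.wf_underlying_graph _ _ that])
      (auto simp: underlying_graph_def map0_closed arc)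
  have ends: "path_src (path_map a b p) = a (path_src p)" "path_tgt (path_map a b p) = a (path_tgt p)"
    for a b and p :: "('o, 'm) path"
    by (simp_all add: path_map_def)
  show ?thesis
  proof (unfold_locales, goal_cases)
    case (5 c)
    obtain p \<alpha> q where c: "c = (p, \<alpha>, q)" by (cases c)
    with 5 have *: "p \<in> paths (underlying_graph S)" "q \<in> paths (underlying_graph S)"
        "path_src p = path_src q" "path_tgt p = path_tgt q"
        "\<alpha> \<in> hom2 S (path_composite S p) (path_composite S q)"
      by (simp_all add: underlying_computad_def del: mem_paths_iff)
    then show ?case
      using map2_hom[OF *(5)] pth
      by (simp add: c underlying_computad_def underlying_computad_map_def ends path_composite_map
          del: mem_paths_iff)
  qed (auto simp: underlying_computad_def underlying_computad_map_def underlying_graph_def map0_closed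
      arc)
qed


subsection \<open>The free sesquicategory\<close>

context computad
begin

sublocale graph: wf_digraph "graph G"
  by (rule wf_graph)

lemma whisker_arc_iff:
  "(l, c, r) \<in> arcs (whisker_graph G) \<longleftrightarrow>
    l \<in> paths (graph G) \<and> c \<in> gens G \<and> r \<in> paths (graph G) \<and>
    path_src l = path_tgt (dom2 G c) \<and> path_tgt r = path_src (dom2 G c)"
  by (simp add: whisker_graph_def)

lemma whisker_graph_simps [simp]:
  "verts (whisker_graph G) = paths (graph G)"
  "tail (whisker_graph G) (l, c, r) = path_comp l (path_comp (dom2 G c) r)"
  "head (whisker_graph G) (l, c, r) = path_comp l (path_comp (cod2 G c) r)"
  by (simp_all add: whisker_graph_def)

sublocale whisker: wf_digraph "whisker_graph G"
  by unfold_locales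
    (auto simp: whisker_arc_iff globular_src globular_tgt intro!: graph.path_comp_in_paths dom2_path
      cod2_path)

lemma whisker_arc_globular:
  assumes "w \<in> arcs (whisker_graph G)"
  shows "path_src (tail (whisker_graph G) w) = path_src (head (whisker_graph G) w)"
    and "path_tgt (tail (whisker_graph G) w) = path_tgt (head (whisker_graph G) w)"
  by (cases w; simp)+

lemma whisker_walk_globular:
  "whisker.awalk p ws q \<Longrightarrow> path_src p = path_src q \<and> path_tgt p = path_tgt q"
proof (induction ws arbitrary: q rule: rev_induct)
  case Nil
  then show ?case by (simp add: whisker.awalk_Nil_iff)
next
  case (snoc w ws)
  then have *: "whisker.awalk p ws (tail (whisker_graph G) w)"
      "w \<in> arcs (whisker_graph G)" "q = head (whisker_graph G) w"
    unfolding whisker.awalk_snoc_iff by simp_all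
  then show ?case using snoc.IH[OF *(1)] whisker_arc_globular[OF *(2)] by simp
qed

lemma whisker_walk_left:
  assumes "whisker.awalk p ws q" "g \<in> paths (graph G)" "path_src g = path_tgt p"
  shows "whisker.awalk (path_comp g p) (map (\<lambda>(l, c, r). (path_comp g l, c, r)) ws) (path_comp g q)"
  using assms(1)
proof (induction ws arbitrary: q rule: rev_induct)
  case Nil
  then show ?case using assms by (auto simp: whisker.awalk_Nil_iff intro: graph.path_comp_in_paths)
next
  case (snoc w ws)
  obtain l c r where w: "w = (l, c, r)" by (cases w)
  from snoc.prems have *: "whisker.awalk p ws (tail (whisker_graph G) w)"
      "w \<in> arcs (whisker_graph G)" "q = head (whisker_graph G) w"
    by (auto simp: whisker.awalk_snoc_iff)
  have "path_tgt l = path_src g"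
    using whisker_walk_globular[OF *(1)] assms(3) w by simp
  then have "(path_comp g l, c, r) \<in> arcs (whisker_graph G)"
    using * assms(2) w by (auto simp: whisker_arc_iff intro: graph.path_comp_in_paths)
  then show ?case
    using snoc.IH[OF *(1)] * w
    by (simp add: whisker.awalk_snoc_iff path_comp_assoc del: whisker.awalk_append_iff)
qed

lemma whisker_walk_right:
  assumes "whisker.awalk p ws q" "f \<in> paths (graph G)" "path_tgt f = path_src p"
  shows "whisker.awalk (path_comp p f) (map (\<lambda>(l, c, r). (l, c, path_comp r f)) ws) (path_comp q f)"
  using assms(1)
proof (induction ws arbitrary: q rule: rev_induct)
  case Nil
  then show ?case using assms by (auto simp: whisker.awalk_Nil_iff intro: graph.path_comp_in_paths)
next
  case (snoc w ws)
  obtain l c r where w: "w = (l, c, r)" by (cases w)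
  from snoc.prems have *: "whisker.awalk p ws (tail (whisker_graph G) w)"
      "w \<in> arcs (whisker_graph G)" "q = head (whisker_graph G) w"
    by (auto simp: whisker.awalk_snoc_iff)
  have "path_src r = path_tgt f"
    using whisker_walk_globular[OF *(1)] assms(3) w by simp
  then have "(l, c, path_comp r f) \<in> arcs (whisker_graph G)"
    using * assms(2) w by (auto simp: whisker_arc_iff intro: graph.path_comp_in_paths)
  then show ?case
    using snoc.IH[OF *(1)] * w
    by (simp add: whisker.awalk_snoc_iff path_comp_assoc del: whisker.awalk_append_iff)
qed

lemma whisker_walk_left_id:
  assumes "whisker.awalk p ws q"
  shows "map (\<lambda>(l, c, r). (path_comp (path_id (path_tgt p)) l, c, r)) ws = ws"
  using assms
proof (induction ws arbitrary: q rule: rev_induct)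
  case (snoc w ws)
  obtain l c r where w: "w = (l, c, r)" by (cases w)
  from snoc.prems have *: "whisker.awalk p ws (tail (whisker_graph G) w)"
    by (auto simp: whisker.awalk_snoc_iff)
  then show ?case
    using snoc.IH[OF *] whisker_walk_globular[OF *] w by (simp add: path_comp_id_left)
qed simp

lemma whisker_walk_right_id:
  assumes "whisker.awalk p ws q"
  shows "map (\<lambda>(l, c, r). (l, c, path_comp r (path_id (path_src p)))) ws = ws"
  using assms
proof (induction ws arbitrary: q rule: rev_induct)
  case (snoc w ws)
  obtain l c r where w: "w = (l, c, r)" by (cases w)
  from snoc.prems have *: "whisker.awalk p ws (tail (whisker_graph G) w)"
    by (auto simp: whisker.awalk_snoc_iff)
  then show ?case
    using snoc.IH[OF *] whisker_walk_globular[OF *] w by (simp add: path_comp_id_right)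
qed simp

lemma free_simps [simp]:
  "Cell0 (free_sesquicat G) = verts (graph G)"
  "Cell1 (free_sesquicat G) = paths (graph G)"
  "Cell2 (free_sesquicat G) = paths (whisker_graph G)"
  "src1 (free_sesquicat G) = path_src" "tgt1 (free_sesquicat G) = path_tgt"
  "id1 (free_sesquicat G) = path_id" "comp1 (free_sesquicat G) = path_comp"
  "src2 (free_sesquicat G) = path_src" "tgt2 (free_sesquicat G) = path_tgt"
  "id2 (free_sesquicat G) = path_id" "comp2 (free_sesquicat G) = path_comp"
  "lwhisk (free_sesquicat G) g \<alpha> = path_map (path_comp g) (\<lambda>(l, c, r). (path_comp g l, c, r)) \<alpha>"
  "rwhisk (free_sesquicat G) \<beta> f =
    path_map (\<lambda>g. path_comp g f) (\<lambda>(l, c, r). (l, c, path_comp r f)) \<beta>"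
  by (simp_all add: free_sesquicat_def)

theorem sesquicategory_free: "sesquicategory (free_sesquicat G)"
proof (unfold_locales, goal_cases)
  case 1 then show ?case by (simp add: graph.path_src_in_verts)
next
  case 2 then show ?case by (simp add: graph.path_tgt_in_verts)
next
  case 3 then show ?case by (simp add: hom1_iff graph.path_id_in_paths)
next
  case 4 then show ?case by (auto simp: hom1_iff intro: graph.path_comp_in_paths)
next
  case 5 then show ?case by (auto simp: hom1_iff path_comp_id_right)
next
  case 6 then show ?case by (auto simp: hom1_iff path_comp_id_left)
next
  case 7 then show ?case by (simp add: path_comp_assoc)
next
  case 8 then show ?case using whisker.path_src_in_verts by simp
next
  case 9 then show ?case using whisker.path_tgt_in_verts by simp
next
  case (10 \<alpha>) then show ?case by (cases \<alpha>) (auto dest: whisker_walk_globular)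
next
  case (11 \<alpha>) then show ?case by (cases \<alpha>) (auto dest: whisker_walk_globular)
next
  case 12 then show ?case using whisker.path_id_in_paths by (simp add: hom2_iff)
next
  case 13 then show ?case by (auto simp: hom2_iff intro: whisker.path_comp_in_paths)
next
  case 14 then show ?case by (auto simp: hom2_iff path_comp_id_right)
next
  case 15 then show ?case by (auto simp: hom2_iff path_comp_id_left)
next
  case 16 then show ?case by (simp add: path_comp_assoc)
next
  case (17 f x y \<alpha> f' g z) then show ?case
    using whisker_walk_left[of f "path_edges \<alpha>" f' g] by (cases \<alpha>) (auto simp: hom1_iff hom2_iff)
next
  case 18 then show ?case by (simp add: path_id_def)
next
  case 19 then show ?case by (simp add: path_map_comp)
next
  case (20 f x y \<alpha> f') then show ?case
    using whisker_walk_left_id[of f "path_edges \<alpha>" f'] by (cases \<alpha>)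
      (auto simp: hom1_iff hom2_iff path_comp_id_left dest: whisker_walk_globular)
next
  case (21 f x y \<alpha> f' g z h w) then show ?case
    by (cases \<alpha>) (auto simp: path_comp_assoc)
next
  case (22 f x y g z \<beta> g') then show ?case
    using whisker_walk_right[of g "path_edges \<beta>" g' f] by (cases \<beta>) (auto simp: hom1_iff hom2_iff)
next
  case 23 then show ?case by (simp add: path_id_def)
next
  case 24 then show ?case by (simp add: path_map_comp)
next
  case (25 g y z \<beta> g') then show ?case
    using whisker_walk_right_id[of g "path_edges \<beta>" g'] by (cases \<beta>)
      (auto simp: hom1_iff hom2_iff path_comp_id_right dest: whisker_walk_globular)
next
  case (26 f x y g z h w \<gamma> h') then show ?case
    by (cases \<gamma>) (auto simp: path_comp_assoc)
next
  case (27 f x y g z \<beta> g' h w) then show ?case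
    by (cases \<beta>) (auto simp: path_comp_assoc)
qed

sublocale free: sesquicategory "free_sesquicat G"
  by (rule sesquicategory_free)

abbreviation edge :: "'e \<Rightarrow> ('v, 'e) path" where
  "edge e \<equiv> (tail (graph G) e, [e], head (graph G) e)"

abbreviation whiskered :: "('v, 'e, 'c) whisk \<Rightarrow> (('v, 'e) path, ('v, 'e, 'c) whisk) path" where
  "whiskered w \<equiv> (tail (whisker_graph G) w, [w], head (whisker_graph G) w)"

lemma unit_cell:
  assumes "c \<in> gens G"
  defines "w \<equiv> (path_id (path_tgt (dom2 G c)), c, path_id (path_src (dom2 G c)))"
  shows "w \<in> arcs (whisker_graph G)"
    and "tail (whisker_graph G) w = dom2 G c" and "head (whisker_graph G) w = cod2 G c"
  using assms graph.path_src_in_verts[OF dom2_path] graph.path_tgt_in_verts[OF dom2_path]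
  by (auto simp: whisker_arc_iff graph.path_id_in_paths path_comp_id_left path_comp_id_right
      globular_src globular_tgt)

lemma free_unit_simps [simp]:
  "map0 (free_unit G) = (\<lambda>x. x)"
  "map1 (free_unit G) = edge"
  "map2 (free_unit G) c = (path_map (\<lambda>x. x) edge (dom2 G c),
     (dom2 G c, [(path_id (path_tgt (dom2 G c)), c, path_id (path_src (dom2 G c)))], cod2 G c),
     path_map (\<lambda>x. x) edge (cod2 G c))"
  by (simp_all add: free_unit_def Let_def)

lemma whiskered_eq:
  assumes "(l, c, r) \<in> arcs (whisker_graph G)"
  shows "whiskered (l, c, r) = l \<lhd>\<^bsub>free_sesquicat G\<^esub>
    ((dom2 G c, [(path_id (path_tgt (dom2 G c)), c, path_id (path_src (dom2 G c)))], cod2 G c)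
      \<rhd>\<^bsub>free_sesquicat G\<^esub> r)"
  using assms by (auto simp: whisker_arc_iff path_comp_id_left path_comp_id_right)

lemma path_composite_edges:
  assumes "p \<in> paths (graph G)"
  shows "path_map (\<lambda>x. x) edge p \<in> paths (underlying_graph (free_sesquicat G))"
    and "path_composite (free_sesquicat G) (path_map (\<lambda>x. x) edge p) = p"
proof -
  have edge: "edge e \<in> hom1 (free_sesquicat G) (tail (graph G) e) (head (graph G) e)"
    if "e \<in> arcs (graph G)" for e
    using that by (simp add: hom1_iff graph.awalk_Cons_iff graph.awalk_Nil_iff)
  show "path_map (\<lambda>x. x) edge p \<in> paths (underlying_graph (free_sesquicat G))"
    by (rule path_map_in_paths[OF wf_graph free.wf_underlying_graph _ _ assms])
      (use edge in \<open>auto simp: underlying_graph_def hom1_iff\<close>)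
  interpret E: path_extension "graph G" "verts (graph G)" "hom1 (free_sesquicat G)"
      path_id path_comp "\<lambda>x. x" edge
    using free.path_extension_1[OF wf_graph, of "\<lambda>x. x" edge] edge by simp
  have "p = E.ext p"
    by (rule E.ext_unique[where F = "\<lambda>p. p", OF _ _ _ assms]) (simp_all add: path_id_def)
  moreover have "path_composite (free_sesquicat G) (path_map (\<lambda>x. x) edge p) = E.ext p"
    by (simp add: path_composite_def E.ext_def path_map_def foldl_map)
  ultimately show "path_composite (free_sesquicat G) (path_map (\<lambda>x. x) edge p) = p" by simp
qed

theorem computad_morphism_free_unit:
  "computad_morphism G (underlying_computad (free_sesquicat G)) (free_unit G)"
proof -
  interpret V: computad "underlying_computad (free_sesquicat G)"
    by (rule free.computad_underlying)
  have ends: "path_src (path_map (\<lambda>x. x) b p) = path_src p" "path_tgt (path_map (\<lambda>x. x) b p) = path_tgt p"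
    for b :: "'e \<Rightarrow> ('v, 'e) path" and p :: "('v, 'e) path"
    by (simp_all add: path_map_def)
  show ?thesis
  proof (unfold_locales, goal_cases)
    case (5 c)
    then show ?case
      using unit_cell[OF 5]
      by (auto simp: underlying_computad_def path_composite_edges dom2_path cod2_path ends globular_src
          globular_tgt hom2_iff whisker.awalk_Cons_iff whisker.awalk_Nil_iff)
  qed (auto simp: underlying_computad_def underlying_graph_def graph.awalk_Cons_iff graph.awalk_Nil_iff)
qed

end

theorem free_sesquicat_universal:
  assumes "sesquicategory S" and "computad_morphism G (underlying_computad S) \<phi>"
  shows "\<exists>F. sesquifunctor (free_sesquicat G) S F \<and> extends_along_unit G F \<phi> \<and>
    (\<forall>F'. sesquifunctor (free_sesquicat G) S F' \<and> extends_along_unit G F' \<phi> \<longrightarrow>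
      cellmap_eq_on (free_sesquicat G) F' F)"
proof -
  interpret S: sesquicategory S by fact
  interpret G: computad G by (rule computad_morphism.axioms(1)[OF assms(2)])
  interpret phi: computad_morphism G "underlying_computad S" \<phi> by fact
  let ?H = "free_sesquicat G" and ?W = "whisker_graph G"
  have phi0: "map0 \<phi> x \<in> Cell0 S" if "x \<in> verts (graph G)" for x
    using phi.map_verts[OF that] by (simp add: underlying_computad_def underlying_graph_def)
  have phi1: "map1 \<phi> e \<in> hom1 S (map0 \<phi> (tail (graph G) e)) (map0 \<phi> (head (graph G) e))"
    if "e \<in> arcs (graph G)" for e
    using phi.map_arcs[OF that] phi.map_tail[OF that] phi.map_head[OF that]
    by (simp add: underlying_computad_def underlying_graph_def hom1_iff)
  interpret E: path_extension "graph G" "Cell0 S" "hom1 S" "id1 S" "comp1 S" "map0 \<phi>" "map1 \<phi>"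
    by (rule S.path_extension_1[OF G.wf_graph phi0 phi1])
  define \<alpha> where "\<alpha> c = fst (snd (map2 \<phi> c))" for c
  have composite: "path_composite S (path_map (map0 \<phi>) (map1 \<phi>) p) = E.ext p" for p
    by (simp add: path_composite_def E.ext_def path_map_def foldl_map)
  have phi2: "map2 \<phi> c =
      (path_map (map0 \<phi>) (map1 \<phi>) (dom2 G c), \<alpha> c, path_map (map0 \<phi>) (map1 \<phi>) (cod2 G c))"
    and \<alpha>_hom: "\<alpha> c \<in> hom2 S (E.ext (dom2 G c)) (E.ext (cod2 G c))" if "c \<in> gens G" for c
    using phi.map_gens[OF that] phi.map_dom2[OF that] phi.map_cod2[OF that]
    by (auto simp: underlying_computad_def \<alpha>_def composite)
  have ext1: "E.ext p \<in> hom1 S (map0 \<phi> (path_src p)) (map0 \<phi> (path_tgt p))" if "p \<in> paths (graph G)" for p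
    by (rule E.ext_hom[OF that])
  define \<omega> where "\<omega> = (\<lambda>(l, c, r). E.ext l \<lhd>\<^bsub>S\<^esub> (\<alpha> c \<rhd>\<^bsub>S\<^esub> E.ext r))"
  have \<omega>_hom: "\<omega> w \<in> hom2 S (E.ext (tail ?W w)) (E.ext (head ?W w))" if "w \<in> arcs ?W" for w
  proof -
    obtain l c r where w: "w = (l, c, r)" by (cases w)
    with that have *: "l \<in> paths (graph G)" "c \<in> gens G" "r \<in> paths (graph G)"
        "path_src l = path_tgt (dom2 G c)" "path_tgt r = path_src (dom2 G c)"
      by (auto simp: G.whisker_arc_iff)
    note d = G.dom2_path[OF *(2)] and k = G.cod2_path[OF *(2)]
      and gl = G.globular_src[OF *(2)] G.globular_tgt[OF *(2)]
    have r: "\<alpha> c \<rhd>\<^bsub>S\<^esub> E.ext r \<in> hom2 S (E.ext (path_comp (dom2 G c) r)) (E.ext (path_comp (cod2 G c) r))"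
      using S.rwhisk_hom[OF ext1[OF *(3)] _ \<alpha>_hom[OF *(2)]] ext1[OF d] * d k gl
      by (simp add: E.ext_comp)
    have dr: "path_comp (dom2 G c) r \<in> paths (graph G)" and kr: "path_comp (cod2 G c) r \<in> paths (graph G)"
      using * d k gl by (auto intro: G.graph.path_comp_in_paths)
    show ?thesis
      using S.lwhisk_hom[OF ext1[OF dr] r, of "E.ext l"] ext1[OF *(1)] * dr kr gl w
      by (simp add: \<omega>_def E.ext_comp[of "path_comp _ _"])
  qed
  interpret E2: path_extension ?W "Cell1 S" "hom2 S" "id2 S" "comp2 S" E.ext \<omega>
    by (rule S.path_extension_2[OF G.whisker.wf_digraph _ \<omega>_hom]) (use ext1 in \<open>auto simp: hom1_iff\<close>)
  have lw: "E2.ext (path_comp g p, map (\<lambda>(l, c, r). (path_comp g l, c, r)) ws, path_comp g q)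
      = E.ext g \<lhd>\<^bsub>S\<^esub> E2.ext (p, ws, q)"
    if g: "g \<in> paths (graph G)" "path_src g = path_tgt p" and ws: "G.whisker.awalk p ws q" for g p ws q
    using ws
  proof (induction ws arbitrary: q rule: rev_induct)
    case Nil
    then show ?case using g ext1[of p] ext1[of g]
      by (auto simp: E.ext_comp G.whisker.awalk_Nil_iff intro!: S.lwhisk_id2[symmetric])
  next
    case (snoc w ws)
    let ?m = "\<lambda>(l, c, r). (path_comp g l, c, r)"
    obtain l c r where w: "w = (l, c, r)" by (cases w)
    from snoc.prems have *: "G.whisker.awalk p ws (tail ?W w)" "w \<in> arcs ?W" "q = head ?W w"
      by (auto simp: G.whisker.awalk_snoc_iff)
    have l: "l \<in> paths (graph G)" "path_tgt l = path_src g" "path_src l = path_tgt (dom2 G c)"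
      and c: "c \<in> gens G" and r: "r \<in> paths (graph G)" "path_tgt r = path_src (dom2 G c)"
      using * G.whisker_walk_globular[OF *(1)] g w by (auto simp: G.whisker_arc_iff)
    have p: "p \<in> paths (graph G)"
      using * G.whisker.awalk_hd_in_verts by auto
    have t: "tail ?W w \<in> paths (graph G)"
      using G.whisker.tail_in_verts[OF *(2)] by simp
    have cr: "\<alpha> c \<rhd>\<^bsub>S\<^esub> E.ext r \<in> hom2 S (E.ext (dom2 G c) \<star>\<^bsub>S\<^esub> E.ext r) (E.ext (cod2 G c) \<star>\<^bsub>S\<^esub> E.ext r)"
      using S.rwhisk_hom[OF ext1[OF r(1)] _ \<alpha>_hom[OF c]] ext1[OF G.dom2_path[OF c]] r by simp
    have dr: "E.ext (dom2 G c) \<star>\<^bsub>S\<^esub> E.ext r \<in> hom1 S (map0 \<phi> (path_src r)) (map0 \<phi> (path_src l))"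
      using S.comp1_hom[OF ext1[OF r(1)]] ext1[OF G.dom2_path[OF c]] r l by simp
    have \<omega>: "\<omega> (?m w) = E.ext g \<lhd>\<^bsub>S\<^esub> \<omega> w"
      using S.lwhisk_comp1[OF dr cr ext1[OF l(1)]] ext1[OF g(1)] l g w
      by (simp add: \<omega>_def E.ext_comp)
    have "E2.ext (path_comp g p, map ?m (ws @ [w]), path_comp g q)
        = \<omega> (?m w) \<cdot>\<^bsub>S\<^esub> E2.ext (path_comp g p, map ?m ws, path_comp g (tail ?W w))"
      by (simp add: E2.ext_def)
    also have "\<dots> = (E.ext g \<lhd>\<^bsub>S\<^esub> \<omega> w) \<cdot>\<^bsub>S\<^esub> (E.ext g \<lhd>\<^bsub>S\<^esub> E2.ext (p, ws, tail ?W w))"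
      using snoc.IH[OF *(1)] \<omega> by simp
    also have "\<dots> = E.ext g \<lhd>\<^bsub>S\<^esub> (\<omega> w \<cdot>\<^bsub>S\<^esub> E2.ext (p, ws, tail ?W w))"
      using S.lwhisk_comp2[OF ext1[OF p] E2.ext_walk_hom[OF *(1)] \<omega>_hom[OF *(2)]] ext1[OF g(1)] g by simp
    also have "\<omega> w \<cdot>\<^bsub>S\<^esub> E2.ext (p, ws, tail ?W w) = E2.ext (p, ws @ [w], q)"
      by (rule E2.ext_snoc[symmetric])
    finally show ?case .
  qed
  have rw: "E2.ext (path_comp p f, map (\<lambda>(l, c, r). (l, c, path_comp r f)) ws, path_comp q f)
      = E2.ext (p, ws, q) \<rhd>\<^bsub>S\<^esub> E.ext f"
    if f: "f \<in> paths (graph G)" "path_tgt f = path_src p" and ws: "G.whisker.awalk p ws q" for f p ws q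
    using ws
  proof (induction ws arbitrary: q rule: rev_induct)
    case Nil
    then show ?case using f ext1[of p] ext1[of f]
      by (auto simp: E.ext_comp G.whisker.awalk_Nil_iff intro!: S.rwhisk_id2[symmetric])
  next
    case (snoc w ws)
    let ?m = "\<lambda>(l, c, r). (l, c, path_comp r f)"
    obtain l c r where w: "w = (l, c, r)" by (cases w)
    from snoc.prems have *: "G.whisker.awalk p ws (tail ?W w)" "w \<in> arcs ?W" "q = head ?W w"
      by (auto simp: G.whisker.awalk_snoc_iff)
    have l: "l \<in> paths (graph G)" "path_src l = path_tgt (dom2 G c)"
      and c: "c \<in> gens G"
      and r: "r \<in> paths (graph G)" "path_src r = path_tgt f" "path_tgt r = path_src (dom2 G c)"
      using * G.whisker_walk_globular[OF *(1)] f w by (auto simp: G.whisker_arc_iff)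
    have p: "p \<in> paths (graph G)"
      using * G.whisker.awalk_hd_in_verts by auto
    have d: "E.ext (dom2 G c) \<in> hom1 S (map0 \<phi> (path_tgt r)) (map0 \<phi> (path_src l))"
      using ext1[OF G.dom2_path[OF c]] r l by simp
    have cr: "\<alpha> c \<rhd>\<^bsub>S\<^esub> E.ext r \<in> hom2 S (E.ext (dom2 G c) \<star>\<^bsub>S\<^esub> E.ext r) (E.ext (cod2 G c) \<star>\<^bsub>S\<^esub> E.ext r)"
      by (rule S.rwhisk_hom[OF ext1[OF r(1)] d \<alpha>_hom[OF c]])
    have dr: "E.ext (dom2 G c) \<star>\<^bsub>S\<^esub> E.ext r \<in> hom1 S (map0 \<phi> (path_src r)) (map0 \<phi> (path_src l))"
      by (rule S.comp1_hom[OF ext1[OF r(1)] d])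
    have f1: "E.ext f \<in> hom1 S (map0 \<phi> (path_src f)) (map0 \<phi> (path_src r))"
      using ext1[OF f(1)] r by simp
    have \<omega>: "\<omega> (?m w) = \<omega> w \<rhd>\<^bsub>S\<^esub> E.ext f"
      using S.whisk_whisk[OF f1 dr cr ext1[OF l(1)]]
        S.rwhisk_comp1[OF f1 ext1[OF r(1)] d \<alpha>_hom[OF c]] r f w
      by (simp add: \<omega>_def E.ext_comp)
    have fp: "E.ext f \<in> hom1 S (map0 \<phi> (path_src f)) (map0 \<phi> (path_src p))"
      using ext1[OF f(1)] f by simp
    have "E2.ext (path_comp p f, map ?m (ws @ [w]), path_comp q f)
        = \<omega> (?m w) \<cdot>\<^bsub>S\<^esub> E2.ext (path_comp p f, map ?m ws, path_comp (tail ?W w) f)"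
      by (simp add: E2.ext_def)
    also have "\<dots> = (\<omega> w \<rhd>\<^bsub>S\<^esub> E.ext f) \<cdot>\<^bsub>S\<^esub> (E2.ext (p, ws, tail ?W w) \<rhd>\<^bsub>S\<^esub> E.ext f)"
      using snoc.IH[OF *(1)] \<omega> by simp
    also have "\<dots> = (\<omega> w \<cdot>\<^bsub>S\<^esub> E2.ext (p, ws, tail ?W w)) \<rhd>\<^bsub>S\<^esub> E.ext f"
      using S.rwhisk_comp2[OF fp ext1[OF p] E2.ext_walk_hom[OF *(1)] \<omega>_hom[OF *(2)]] by simp
    also have "\<omega> w \<cdot>\<^bsub>S\<^esub> E2.ext (p, ws, tail ?W w) = E2.ext (p, ws @ [w], q)"
      by (rule E2.ext_snoc[symmetric])
    finally show ?case .
  qed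
  define F where "F = \<lparr>map0 = map0 \<phi>, map1 = E.ext, map2 = E2.ext\<rparr>"
  have F [simp]: "map0 F = map0 \<phi>" "map1 F = E.ext" "map2 F = E2.ext" by (simp_all add: F_def)
  have "sesquifunctor ?H S F"
  proof (unfold_locales, goal_cases)
    case 1 then show ?case by (simp add: phi0)
  next
    case 2 then show ?case using ext1 by (auto simp: hom1_iff)
  next
    case 3 then show ?case using E2.ext_hom by (auto simp: hom2_iff)
  next
    case 4 then show ?case by (simp add: path_id_def)
  next
    case 5 then show ?case by (auto simp: hom1_iff E.ext_comp)
  next
    case 6 then show ?case by (simp add: path_id_def)
  next
    case 7 then show ?case by (auto simp: hom2_iff E2.ext_comp)
  next
    case (8 f x y \<alpha> f' g z) then show ?case
      using lw[of g f "path_edges \<alpha>" f'] by (cases \<alpha>) (auto simp: hom1_iff hom2_iff)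
  next
    case (9 f x y g z \<beta> g') then show ?case
      using rw[of f g "path_edges \<beta>" g'] by (cases \<beta>) (auto simp: hom1_iff hom2_iff)
  qed
  moreover have edges: "path_map (map0 \<phi>) f (path_map (\<lambda>x. x) G.edge p) = path_map (map0 \<phi>) (map1 \<phi>) p"
    if "p \<in> paths (graph G)" "\<And>e. e \<in> arcs (graph G) \<Longrightarrow> f (G.edge e) = map1 \<phi> e" for p f
    using that by (cases p) (auto simp: G.graph.awalk_def)
  have "extends_along_unit G F \<phi>"
  proof -
    have "E2.ext (dom2 G c, [(path_id (path_tgt (dom2 G c)), c, path_id (path_src (dom2 G c)))], cod2 G c) = \<alpha> c"
      if "c \<in> gens G" for c
    proof -
      note d = ext1[OF G.dom2_path[OF that]]
      have "\<alpha> c \<rhd>\<^bsub>S\<^esub> id1 S (map0 \<phi> (path_src (dom2 G c))) = \<alpha> c"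
        using S.rwhisk_id1[OF d \<alpha>_hom[OF that]] by simp
      moreover have "id1 S (map0 \<phi> (path_tgt (dom2 G c))) \<lhd>\<^bsub>S\<^esub> \<alpha> c = \<alpha> c"
        using S.lwhisk_id1[OF d \<alpha>_hom[OF that]] by simp
      ultimately show ?thesis
        using E2.ext_arc[OF G.unit_cell(1)[OF that]] G.unit_cell(2)[OF that]
        by (simp add: \<omega>_def path_id_def)
    qed
    then show ?thesis
      by (auto simp: extends_along_unit_def underlying_computad_map_def E.ext_arc phi2 edges
          G.dom2_path G.cod2_path)
  qed
  moreover have "cellmap_eq_on ?H F' F"
    if F': "sesquifunctor ?H S F'" and ex: "extends_along_unit G F' \<phi>" for F'
  proof -
    interpret F': sesquifunctor ?H S F' by (rule F')
    have e0: "map0 F' x = map0 \<phi> x" if "x \<in> verts (graph G)" for x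
      using ex that by (auto simp: extends_along_unit_def underlying_computad_map_def)
    have e1: "map1 F' (G.edge e) = map1 \<phi> e" if "e \<in> arcs (graph G)" for e
      using ex that by (auto simp: extends_along_unit_def underlying_computad_map_def)
    have e2: "map2 F' (dom2 G c, [(path_id (path_tgt (dom2 G c)), c, path_id (path_src (dom2 G c)))], cod2 G c) = \<alpha> c"
      if "c \<in> gens G" for c
    proof -
      have "map2 (underlying_computad_map F') (map2 (free_unit G) c) = map2 \<phi> c"
        using ex that by (simp add: extends_along_unit_def)
      then have "fst (snd (map2 (underlying_computad_map F') (map2 (free_unit G) c))) = \<alpha> c"
        by (simp add: \<alpha>_def)
      then show ?thesis by (simp add: underlying_computad_map_def)
    qed
    have m1: "map1 F' p = E.ext p" if "p \<in> paths (graph G)" for p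
    proof (rule E.ext_unique[OF _ _ _ that])
      show "map1 F' (v, [], v) = id1 S (map0 \<phi> v)" if "v \<in> verts (graph G)" for v
        using F'.map1_id1[of v] that by (simp add: path_id_def e0)
      show "map1 F' (path_comp q p) = map1 F' q \<star>\<^bsub>S\<^esub> map1 F' p"
        if "p \<in> paths (graph G)" "q \<in> paths (graph G)" "path_tgt p = path_src q" for p q
        using F'.map1_comp1[of p "path_src p" "path_tgt p" q "path_tgt q"] that by (simp add: hom1_iff)
    qed (rule e1)
    have m2: "map2 F' p = E2.ext p" if "p \<in> paths ?W" for p
    proof (rule E2.ext_unique[OF _ _ _ that])
      show "map2 F' (v, [], v) = id2 S (E.ext v)" if "v \<in> verts ?W" for v
        using F'.map2_id2[of v] that by (simp add: path_id_def m1)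
      show "map2 F' (path_comp q p) = map2 F' q \<cdot>\<^bsub>S\<^esub> map2 F' p"
        if "p \<in> paths ?W" "q \<in> paths ?W" "path_tgt p = path_src q" for p q
        using F'.map2_comp2[of p "path_src p" "path_tgt p" q "path_tgt q"] that by (simp add: hom2_iff)
      show "map2 F' (G.whiskered w) = \<omega> w" if w: "w \<in> arcs ?W" for w
      proof -
        obtain l c r where lcr: "w = (l, c, r)" by (cases w)
        with w have *: "l \<in> paths (graph G)" "c \<in> gens G" "r \<in> paths (graph G)"
            "path_src l = path_tgt (dom2 G c)" "path_tgt r = path_src (dom2 G c)"
          by (auto simp: G.whisker_arc_iff)
        let ?c = "(dom2 G c, [(path_id (path_tgt (dom2 G c)), c, path_id (path_src (dom2 G c)))], cod2 G c)"
        have c: "?c \<in> hom2 ?H (dom2 G c) (cod2 G c)"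
          using G.whisker.arc_implies_awalk[OF G.unit_cell(1)[OF *(2)]] G.unit_cell[OF *(2)]
          by (simp add: hom2_iff)
        have r: "r \<in> hom1 ?H (path_src r) (path_src (dom2 G c))"
          and d: "dom2 G c \<in> hom1 ?H (path_src (dom2 G c)) (path_src l)"
          and l: "l \<in> hom1 ?H (path_src l) (path_tgt l)"
          using * G.dom2_path by (auto simp: hom1_iff)
        have "map2 F' (G.whiskered w) = map1 F' l \<lhd>\<^bsub>S\<^esub> (map2 F' ?c \<rhd>\<^bsub>S\<^esub> map1 F' r)"
          unfolding lcr G.whiskered_eq[OF w[unfolded lcr]]
          using F'.map2_lwhisk[OF G.free.comp1_hom[OF r d] G.free.rwhisk_hom[OF r d c] l]
            F'.map2_rwhisk[OF r d c] by (simp only:)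
        then show ?thesis using * by (simp add: \<omega>_def lcr m1 e2)
      qed
    qed
    show ?thesis using e0 m1 m2 by (simp add: cellmap_eq_on_def)
  qed
  ultimately show ?thesis by blast
qed


subsection \<open>The underlying sesquicategory of a Gray-category\<close>

lemma hom_2cat_simps [simp]:
  "Cell0 (hom_2cat \<A> x y) = hom1 \<A> x y"
  "src1 (hom_2cat \<A> x y) = src2 \<A>" "tgt1 (hom_2cat \<A> x y) = tgt2 \<A>"
  "id1 (hom_2cat \<A> x y) = id2 \<A>" "comp1 (hom_2cat \<A> x y) = comp2 \<A>"
  "src2 (hom_2cat \<A> x y) = src3 \<A>" "tgt2 (hom_2cat \<A> x y) = tgt3 \<A>"
  "id2 (hom_2cat \<A> x y) = id3 \<A>" "comp2 (hom_2cat \<A> x y) = comp3 \<A>"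
  "lwhisk (hom_2cat \<A> x y) = lwhisk23 \<A>" "rwhisk (hom_2cat \<A> x y) = rwhisk23 \<A>"
  by (simp_all add: hom_2cat_def)

lemma Cell1_hom_2cat: "\<alpha> \<in> Cell1 (hom_2cat \<A> x y) \<longleftrightarrow> \<alpha> \<in> Cell2 \<A> \<and> src2 \<A> \<alpha> \<in> hom1 \<A> x y"
  by (simp add: hom_2cat_def)

lemma hom1_hom_2cat: "f \<in> hom1 \<A> x y \<Longrightarrow> hom1 (hom_2cat \<A> x y) f g = hom2 \<A> f g"
  by (auto simp: hom1_iff hom2_iff Cell1_hom_2cat)

lemma underlying_simps [simp]:
  "Cell0 (underlying_sesquicat \<A>) = Cell0 \<A>" "Cell1 (underlying_sesquicat \<A>) = Cell1 \<A>"
  "Cell2 (underlying_sesquicat \<A>) = Cell2 \<A>"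
  "src1 (underlying_sesquicat \<A>) = src1 \<A>" "tgt1 (underlying_sesquicat \<A>) = tgt1 \<A>"
  "id1 (underlying_sesquicat \<A>) = id1 \<A>" "comp1 (underlying_sesquicat \<A>) = comp1 \<A>"
  "src2 (underlying_sesquicat \<A>) = src2 \<A>" "tgt2 (underlying_sesquicat \<A>) = tgt2 \<A>"
  "id2 (underlying_sesquicat \<A>) = id2 \<A>" "comp2 (underlying_sesquicat \<A>) = comp2 \<A>"
  "lwhisk (underlying_sesquicat \<A>) = lwhisk \<A>" "rwhisk (underlying_sesquicat \<A>) = rwhisk \<A>"
  by (simp_all add: underlying_sesquicat_def sesquicat.truncate_def)

lemma hom_underlying [simp]:
  "hom1 (underlying_sesquicat \<A>) = hom1 \<A>" "hom2 (underlying_sesquicat \<A>) = hom2 \<A>"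
  by (simp_all add: fun_eq_iff hom1_def hom2_def)

context gray_category
begin

lemma ends_closed: "f \<in> hom1 \<A> x y \<Longrightarrow> x \<in> Cell0 \<A> \<and> y \<in> Cell0 \<A>"
  using src1_closed tgt1_closed by (auto simp: hom1_iff)

lemma hom_sesquicategory: "f \<in> hom1 \<A> x y \<Longrightarrow> sesquicategory (hom_2cat \<A> x y)"
  using hom_two_category ends_closed by (blast intro: two_category.axioms(1))

lemma hom2_parallel:
  assumes "f \<in> hom1 \<A> x y" "\<alpha> \<in> hom2 \<A> f g"
  shows "g \<in> hom1 \<A> x y"
  using sesquicategory.tgt1_closed[OF hom_sesquicategory[OF assms(1)], of \<alpha>] assms
  by (auto simp: Cell1_hom_2cat hom2_iff)

lemma hom2_Cell1:
  assumes "f \<in> hom1 \<A> x y" "\<alpha> \<in> hom2 \<A> f g"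
  shows "\<alpha> \<in> Cell1 (hom_2cat \<A> x y)"
  using assms by (simp add: Cell1_hom_2cat hom2_iff)

lemma rwhisk_functor:
  assumes "f \<in> hom1 \<A> x y" "g \<in> hom1 \<A> y z"
  shows "sesquifunctor (hom_2cat \<A> y z) (hom_2cat \<A> x z)
    \<lparr>map0 = \<lambda>g. g \<star> f, map1 = \<lambda>\<beta>. \<beta> \<rhd> f, map2 = \<lambda>\<Psi>. rwhisk13 \<A> \<Psi> f\<rparr>"
  using gray_tensor_functor.P_functor[OF composition, of x y z f] assms ends_closed by auto

lemma lwhisk_functor:
  assumes "f \<in> hom1 \<A> x y" "g \<in> hom1 \<A> y z"
  shows "sesquifunctor (hom_2cat \<A> x y) (hom_2cat \<A> x z)
    \<lparr>map0 = \<lambda>f. g \<star> f, map1 = \<lambda>\<alpha>. g \<lhd> \<alpha>, map2 = \<lambda>\<Phi>. lwhisk13 \<A> g \<Phi>\<rparr>"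
  using gray_tensor_functor.Q_functor[OF composition, of x y z g] assms ends_closed by auto

lemma comp_closed: "\<lbrakk>f \<in> hom1 \<A> x y; g \<in> hom1 \<A> y z\<rbrakk> \<Longrightarrow> g \<star> f \<in> hom1 \<A> x z"
  using sesquifunctor.map0_closed[OF rwhisk_functor, of f x y g z g] by simp

theorem sesquicategory_underlying: "sesquicategory (underlying_sesquicat \<A>)"
proof (unfold_locales, unfold underlying_simps hom_underlying, goal_cases)
  case 1 then show ?case by (rule src1_closed)
next
  case 2 then show ?case by (rule tgt1_closed)
next
  case 3 then show ?case by (rule unit_hom)
next
  case 4 then show ?case by (rule comp_closed)
next
  case 5 then show ?case using unit_right(1) by simp
next
  case 6 then show ?case using unit_left(1) by simp
next
  case 7 then show ?case by (rule assoc_0)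
next
  case 8 then show ?case by (rule src2_closed)
next
  case (9 \<alpha>) then show ?case
    using hom2_parallel[of "src2 \<A> \<alpha>" _ _ \<alpha> "tgt2 \<A> \<alpha>"] src2_closed by (simp add: hom1_iff hom2_iff)
next
  case (10 \<alpha>) then show ?case
    using hom2_parallel[of "src2 \<A> \<alpha>" _ _ \<alpha> "tgt2 \<A> \<alpha>"] src2_closed by (simp add: hom1_iff hom2_iff)
next
  case (11 \<alpha>) then show ?case
    using hom2_parallel[of "src2 \<A> \<alpha>" _ _ \<alpha> "tgt2 \<A> \<alpha>"] src2_closed by (simp add: hom1_iff hom2_iff)
next
  case (12 f)
  then have f: "f \<in> hom1 \<A> (src1 \<A> f) (tgt1 \<A> f)" by (simp add: hom1_iff)
  show ?case using sesquicategory.id1_hom[OF hom_sesquicategory[OF f], of f] f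
    by (simp add: hom1_hom_2cat)
next
  case (13 \<alpha> f g \<beta> h)
  then have f: "f \<in> hom1 \<A> (src1 \<A> f) (tgt1 \<A> f)"
    using src2_closed by (auto simp: hom1_iff hom2_iff)
  show ?case using sesquicategory.comp1_hom[OF hom_sesquicategory[OF f], of \<alpha> f g \<beta> h] f 13
    hom2_parallel[OF f 13(1)] by (simp add: hom1_hom_2cat)
next
  case (14 \<alpha> f g)
  then have f: "f \<in> hom1 \<A> (src1 \<A> f) (tgt1 \<A> f)"
    using src2_closed by (auto simp: hom1_iff hom2_iff)
  show ?case using sesquicategory.comp1_id_right[OF hom_sesquicategory[OF f], of \<alpha> f g] f 14
    by (simp add: hom1_hom_2cat)
next
  case (15 \<alpha> f g)
  then have f: "f \<in> hom1 \<A> (src1 \<A> f) (tgt1 \<A> f)"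
    using src2_closed by (auto simp: hom1_iff hom2_iff)
  show ?case using sesquicategory.comp1_id_left[OF hom_sesquicategory[OF f], of \<alpha> f g] f 15
    by (simp add: hom1_hom_2cat)
next
  case (16 \<alpha> f g \<beta> h \<gamma> k)
  then have f: "f \<in> hom1 \<A> (src1 \<A> f) (tgt1 \<A> f)"
    using src2_closed by (auto simp: hom1_iff hom2_iff)
  note g = hom2_parallel[OF f 16(1)]
  show ?case
    using sesquicategory.comp1_assoc[OF hom_sesquicategory[OF f], of \<alpha> f g \<beta> h \<gamma> k] f 16 g
      hom2_parallel[OF g 16(2)]
    by (simp add: hom1_hom_2cat)
next
  case (17 f x y \<alpha> f' g z)
  then show ?case
    using sesquifunctor.map1_hom[OF lwhisk_functor[OF 17(1,3)], of \<alpha> f f'] comp_closed[OF 17(1,3)]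
    by (simp add: hom1_hom_2cat)
next
  case (18 f x y g z)
  then show ?case using sesquifunctor.map1_id1[OF lwhisk_functor[OF 18(1,2)], of f] by simp
next
  case (19 f x y \<alpha> f' \<alpha>' f'' g z)
  then show ?case
    using sesquifunctor.map1_comp1[OF lwhisk_functor[OF 19(1,4)], of \<alpha> f f' \<alpha>' f'']
      hom2_parallel[OF 19(1,2)]
    by (simp add: hom1_hom_2cat)
next
  case (20 f x y \<alpha> f')
  then show ?case using unit_left(2) hom2_Cell1 by blast
next
  case (21 f x y \<alpha> f' g z h w)
  then show ?case using assoc_1(1) hom2_Cell1 by blast
next
  case (22 f x y g z \<beta> g')
  then show ?case
    using sesquifunctor.map1_hom[OF rwhisk_functor[OF 22(1,2)], of \<beta> g g'] comp_closed[OF 22(1,2)]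
    by (simp add: hom1_hom_2cat)
next
  case (23 f x y g z)
  then show ?case using sesquifunctor.map1_id1[OF rwhisk_functor[OF 23(1,2)], of g] by simp
next
  case (24 f x y g z \<beta> g' \<beta>' g'')
  then show ?case
    using sesquifunctor.map1_comp1[OF rwhisk_functor[OF 24(1,2)], of \<beta> g g' \<beta>' g'']
      hom2_parallel[OF 24(2,3)]
    by (simp add: hom1_hom_2cat)
next
  case (25 g y z \<beta> g')
  then show ?case using unit_right(2) hom2_Cell1 by blast
next
  case (26 f x y g z h w \<gamma> h')
  then show ?case using assoc_1(3)[of f x y g z \<gamma> w] hom2_Cell1 by metis
next
  case (27 f x y g z \<beta> g' h w)
  then show ?case using assoc_1(2) hom2_Cell1 by blast
qed

end


subsection \<open>The initial Gray-category\<close>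

lemma initial_gray_cells [simp]:
  "Cell0 initial_gray = {}" "Cell1 initial_gray = {}" "Cell2 initial_gray = {}" "Cell3 initial_gray = {}"
  by (simp_all add: initial_gray_def)

lemma gray_category_initial: "gray_category initial_gray"
  by unfold_locales (simp_all add: hom_2cat_def hom1_def)

lemma gray_functor_initial:
  assumes "gray_category \<A>"
  shows "gray_functor initial_gray \<A> F"
  by (intro gray_functor.intro gray_functor_axioms.intro gray_category_initial assms)
    (simp_all add: hom_2cat_def hom1_def)

lemma graymap_eq_on_initial: "graymap_eq_on initial_gray F G"
  by (simp add: graymap_eq_on_def)

text \<open>
  The computad is sought with cells in the cell types of \<open>S\<close>. This is no restriction: the unit
  embeds the cells of \<open>G\<close> in those of \<open>HG\<close>.
\<close>

definition free_on_computad :: "('o, 'm, 't) sesquicat \<Rightarrow> bool" where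
  "free_on_computad S \<longleftrightarrow>
    (\<exists>G :: ('o, 'm, 't) computad. computad G \<and> sesquicat_isomorphic S (free_sesquicat G))"

end

theory Submission
  imports Defs
begin

text \<open>
  A trivial fibration \<open>p : X \<rightarrow> Y\<close> is bijective on the 3-cells between two given parallel 2-cells.
  A Gray-functor into \<open>X\<close> is therefore the same thing as a Gray-functor into \<open>Y\<close> together with a
  lift of its underlying sesquifunctor (\<open>gray_functor_lift\<close>), and lifting against \<open>p\<close> is a question
  about sesquicategories: a sesquifunctor has to be lifted through one that is surjective on objects
  and full on 1-cells and on 2-cells.

  If the underlying sesquicategory is \<open>HG\<close>, such a lift can be chosen on the vertices, then on the
  edges, then on the generating 2-cells of \<open>G\<close>, and it extends by freeness
  (\<open>lift_through_full_functor\<close>).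

  Conversely, let \<open>A\<close> be cofibrant with underlying sesquicategory \<open>S\<close>. The counit \<open>HVS \<rightarrow> S\<close> is
  surjective on objects and full on 1-cells and 2-cells, so pulling back the 3-cells of \<open>A\<close> along it
  makes \<open>HVS\<close> into a Gray-category with a trivial fibration to \<open>A\<close> (locale \<open>gray_pullback\<close>). Since
  \<open>A\<close> is cofibrant this trivial fibration has a section, and \<open>S\<close> is a retract of a free
  sesquicategory. Isomorphic copies of \<open>A\<close> and \<open>HVS\<close> with cells in the universe are needed to apply
  the lifting property.

  What remains is that a retract \<open>S\<close> of a free sesquicategory \<open>HG\<close> is free
  (\<open>free_sesquicat_retract.free_on_computad\<close>). In a path category any two factorizations of a path
  are comparable. This property passes to a retract: compare after the section, and apply the
  retraction to the comparison path. As the section also provides a length function, a retract of a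
  path category is free on its indecomposable arrows (\<open>bij_betw_paths_if_edges_are_atoms\<close>). This
  applies to the 1-cells of \<open>S\<close> and to its 2-cells under vertical composition. It then has to be
  shown that the indecomposable 2-cells are themselves freely whiskered from generators, that is,
  each is \<open>l \<lhd> (c \<rhd> r)\<close> for unique \<open>l\<close>, \<open>c\<close>, \<open>r\<close> such that \<open>c\<close> cannot be written with a nontrivial
  whisker (\<open>ex_primitive\<close>, \<open>primitive_unique\<close>). Existence is by induction on the length of the source
  1-cell. For uniqueness one reads off the whiskers from the edges of the walk in \<open>HG\<close>: the left
  whiskers of two decompositions have comparable images, and if they differed then the retraction of
  the comparison path would be a nontrivial whisker of one of the two generators.
\<close>

section \<open>Retracts of path categories\<close>

lemma path_comp_cancel_left:
  "\<lbrakk>path_comp q p = path_comp q p'; path_tgt p = path_src q; path_tgt p' = path_src q\<rbrakk> \<Longrightarrow> p = p'"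
  by (cases p; cases p'; cases q) auto

lemma path_comp_cancel_right:
  "\<lbrakk>path_comp q p = path_comp q' p; path_src q = path_tgt p; path_src q' = path_tgt p\<rbrakk> \<Longrightarrow> q = q'"
  by (cases p; cases q; cases q') auto

lemma (in wf_digraph) awalk_suffix: "\<lbrakk>awalk u (p @ q) w; awalk u p v\<rbrakk> \<Longrightarrow> awalk v q w"
  by auto

lemma (in wf_digraph) awalk_splitE:
  assumes "awalk u (p @ q) w"
  obtains v where "awalk u p v" "awalk v q w"
  using assms by (auto simp: awalk_append_iff)

lemma (in wf_digraph) awalk_end_unique: "\<lbrakk>awalk u p v; awalk u p w\<rbrakk> \<Longrightarrow> v = w"
  using awalk_ends by blast

text \<open>
  Levi's lemma: of two prefixes of the same list one is a prefix of the other.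
\<close>

lemma (in wf_digraph) path_levi:
  assumes "p \<in> paths G" "q \<in> paths G" "p' \<in> paths G" "q' \<in> paths G"
    and "path_tgt p = path_src q" "path_tgt p' = path_src q'"
    and "path_comp q p = path_comp q' p'"
  obtains (left) h where "h \<in> paths G" "path_src h = path_tgt p" "path_tgt h = path_tgt p'"
      "p' = path_comp h p" "q = path_comp q' h"
    | (right) h where "h \<in> paths G" "path_src h = path_tgt p'" "path_tgt h = path_tgt p"
      "p = path_comp h p'" "q' = path_comp q h"
proof -
  obtain u a m where p: "p = (u, a, m)" by (cases p)
  obtain b w where q: "q = (m, b, w)" using assms(5) p by (cases q) auto
  obtain a' m' where p': "p' = (u, a', m')" using assms(7) p q by (cases p'; cases q') auto
  obtain b' where q': "q' = (m', b', w)" using assms(6,7) p q p' by (cases q') auto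
  have walks: "awalk u a m" "awalk u a' m'" using assms p p' by simp_all
  have "a @ b = a' @ b'" using assms(7) p q p' q' by simp
  then consider us where "a = a' @ us" "us @ b = b'" | us where "a @ us = a'" "b = us @ b'"
    by (auto simp: append_eq_append_conv2)
  then show ?thesis
  proof cases
    case 1
    then have "awalk m' us m" using walks awalk_suffix by blast
    then show ?thesis using right[of "(m', us, m)"] 1 p q p' q' by simp
  next
    case 2
    then have "awalk m us m'" using walks awalk_suffix by blast
    then show ?thesis using left[of "(m, us, m')"] 2 p q p' q' by simp
  qed
qed

text \<open>
  A category with section \<open>s\<close> into the path category of \<open>W\<close> and retraction \<open>r\<close>. The operations are
  kept as separate parameters because the locale is used both for the 1-cells of a sesquicategory
  and for its 2-cells under vertical composition.
\<close>

locale path_category_retract = W: wf_digraph W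
  for W :: "('v, 'e) pre_digraph" +
  fixes ob :: "'o set" and M :: "'m set" and src tgt :: "'m \<Rightarrow> 'o" and idt :: "'o \<Rightarrow> 'm"
    and cmp :: "'m \<Rightarrow> 'm \<Rightarrow> 'm"
    and s0 :: "'o \<Rightarrow> 'v" and s :: "'m \<Rightarrow> ('v, 'e) path"
    and r0 :: "'v \<Rightarrow> 'o" and r :: "('v, 'e) path \<Rightarrow> 'm"
  assumes src_ob: "f \<in> M \<Longrightarrow> src f \<in> ob" and tgt_ob: "f \<in> M \<Longrightarrow> tgt f \<in> ob"
    and idt_in: "x \<in> ob \<Longrightarrow> idt x \<in> M \<and> src (idt x) = x \<and> tgt (idt x) = x"
    and cmp_in: "\<lbrakk>f \<in> M; g \<in> M; tgt f = src g\<rbrakk>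
      \<Longrightarrow> cmp g f \<in> M \<and> src (cmp g f) = src f \<and> tgt (cmp g f) = tgt g"
    and idt_right: "f \<in> M \<Longrightarrow> cmp f (idt (src f)) = f"
    and idt_left: "f \<in> M \<Longrightarrow> cmp (idt (tgt f)) f = f"
    and s_in: "f \<in> M \<Longrightarrow> s f \<in> paths W \<and> path_src (s f) = s0 (src f) \<and> path_tgt (s f) = s0 (tgt f)"
    and s_idt: "x \<in> ob \<Longrightarrow> s (idt x) = path_id (s0 x)"
    and s_cmp: "\<lbrakk>f \<in> M; g \<in> M; tgt f = src g\<rbrakk> \<Longrightarrow> s (cmp g f) = path_comp (s g) (s f)"
    and r_in: "p \<in> paths W \<Longrightarrow> r p \<in> M \<and> src (r p) = r0 (path_src p) \<and> tgt (r p) = r0 (path_tgt p)"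
    and r_idt: "v \<in> verts W \<Longrightarrow> r (path_id v) = idt (r0 v)"
    and r_cmp: "\<lbrakk>p \<in> paths W; q \<in> paths W; path_tgt p = path_src q\<rbrakk>
      \<Longrightarrow> r (path_comp q p) = cmp (r q) (r p)"
    and r_s: "f \<in> M \<Longrightarrow> r (s f) = f" and r0_s0: "x \<in> ob \<Longrightarrow> r0 (s0 x) = x"
begin

definition len :: "'m \<Rightarrow> nat" where
  "len f = length (path_edges (s f))"

definition atom :: "'m \<Rightarrow> bool" where
  "atom f \<longleftrightarrow> f \<in> M \<and> f \<noteq> idt (src f) \<and>
    (\<forall>g\<in>M. \<forall>h\<in>M. tgt h = src g \<longrightarrow> f = cmp g h \<longrightarrow> g = idt (src g) \<or> h = idt (src h))"

lemma atom_in: "atom f \<Longrightarrow> f \<in> M" and atom_not_idt: "atom f \<Longrightarrow> f \<noteq> idt (src f)"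
  by (simp_all add: atom_def)

lemma atom_cmpD:
  "\<lbrakk>atom f; f = cmp g h; g \<in> M; h \<in> M; tgt h = src g\<rbrakk> \<Longrightarrow> g = idt (src g) \<or> h = idt (src h)"
  unfolding atom_def by blast

lemma r_empty: "\<lbrakk>p \<in> paths W; path_edges p = []\<rbrakk> \<Longrightarrow> r p = idt (r0 (path_src p))"
  using r_idt by (cases p) (auto simp: path_id_def W.awalk_Nil_iff)

text \<open>
  The section reflects identities, since \<open>r\<close> sends an empty path to an identity. With additivity
  this makes \<open>len\<close> a measure for splitting arrows into nontrivial factors.
\<close>

lemma len_eq_0_iff: "f \<in> M \<Longrightarrow> len f = 0 \<longleftrightarrow> f = idt (src f)"
proof
  assume f: "f \<in> M" "len f = 0"
  then have "r (s f) = idt (r0 (path_src (s f)))" using s_in[of f] by (intro r_empty) (auto simp: len_def)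
  then show "f = idt (src f)" using f(1) s_in r_s r0_s0 src_ob by simp
next
  assume "f \<in> M" "f = idt (src f)"
  then have "s f = path_id (s0 (src f))" using s_idt[of "src f"] src_ob[of f] by simp
  then show "len f = 0" by (simp add: len_def path_id_def)
qed

lemma len_cmp: "\<lbrakk>f \<in> M; g \<in> M; tgt f = src g\<rbrakk> \<Longrightarrow> len (cmp g f) = len g + len f"
  by (simp add: len_def s_cmp path_comp_def)

text \<open>
  The comparison path lives in \<open>W\<close> and is in general not in the image of \<open>s\<close>; applying \<open>r\<close> to it
  suffices, because \<open>r\<close> fixes the four given arrows.
\<close>

lemma levi:
  assumes "f \<in> M" "g \<in> M" "f' \<in> M" "g' \<in> M" "tgt f = src g" "tgt f' = src g'"
    and "cmp g f = cmp g' f'"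
  obtains (left) h where "h \<in> M" "src h = tgt f" "tgt h = tgt f'" "f' = cmp h f" "g = cmp g' h"
    | (right) h where "h \<in> M" "src h = tgt f'" "tgt h = tgt f" "f = cmp h f'" "g' = cmp g h"
proof -
  have "path_comp (s g) (s f) = path_comp (s g') (s f')"
    using assms s_cmp[of f g] s_cmp[of f' g'] by simp
  note * = this s_in[OF assms(1)] s_in[OF assms(2)] s_in[OF assms(3)] s_in[OF assms(4)] assms
  show ?thesis
  proof (rule W.path_levi[of "s f" "s g" "s f'" "s g'"], goal_cases)
    case (8 h)
    show ?case
    proof (rule left[of "r h"])
      show "f' = cmp (r h) f"
        using r_cmp[of "s f" h] 8 * r_s[OF assms(1)] r_s[OF assms(3)] by metis
      show "g = cmp g' (r h)"
        using r_cmp[of h "s g'"] 8 * r_s[OF assms(2)] r_s[OF assms(4)] by metis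
    qed (use 8 * r_in[of h] r0_s0[OF tgt_ob[OF assms(1)]] r0_s0[OF tgt_ob[OF assms(3)]] in auto)
  next
    case (9 h)
    show ?case
    proof (rule right[of "r h"])
      show "f = cmp (r h) f'"
        using r_cmp[of "s f'" h] 9 * r_s[OF assms(1)] r_s[OF assms(3)] by metis
      show "g' = cmp g (r h)"
        using r_cmp[of h "s g"] 9 * r_s[OF assms(2)] r_s[OF assms(4)] by metis
    qed (use 9 * r_in[of h] r0_s0[OF tgt_ob[OF assms(1)]] r0_s0[OF tgt_ob[OF assms(3)]] in auto)
  qed (use * in auto)
qed

text \<open>
  Freeness on the atoms. Injectivity: by Levi's lemma two equal composites of atoms end in the same
  atom, which can be cancelled. Surjectivity: induction on \<open>len\<close>. The graph \<open>K\<close> is arbitrary, with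
  edges in bijection with the atoms, because for 2-cells it will be the whisker graph of a computad
  and not literally the graph of atoms.
\<close>

theorem bij_betw_paths_if_edges_are_atoms:
  assumes "wf_digraph K"
    and k: "bij_betw k (verts K) ob"
    and ends: "\<And>p. p \<in> paths K \<Longrightarrow> \<Phi> p \<in> M \<and> src (\<Phi> p) = k (path_src p) \<and> tgt (\<Phi> p) = k (path_tgt p)"
    and id: "\<And>v. v \<in> verts K \<Longrightarrow> \<Phi> (path_id v) = idt (k v)"
    and comp: "\<And>p q. \<lbrakk>p \<in> paths K; q \<in> paths K; path_tgt p = path_src q\<rbrakk>
      \<Longrightarrow> \<Phi> (path_comp q p) = cmp (\<Phi> q) (\<Phi> p)"
    and edges: "bij_betw (\<lambda>e. \<Phi> (tail K e, [e], head K e)) (arcs K) {f. atom f}"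
  shows "bij_betw \<Phi> (paths K) M"
proof -
  interpret K: wf_digraph K by fact
  have edge_path: "(tail K e, [e], head K e) \<in> paths K" if "e \<in> arcs K" for e
    using K.arc_implies_awalk[OF that] by simp
  have \<Phi>_snoc: "\<Phi> (u, p @ [e], v) = cmp (\<Phi> (tail K e, [e], head K e)) (\<Phi> (u, p, tail K e))"
    if "K.awalk u (p @ [e]) v" for u p e v
    using comp[of "(u, p, tail K e)" "(tail K e, [e], head K e)"] edge_path[of e] that
    by (auto simp: K.awalk_snoc_iff simp del: K.awalk_append_iff)
  have atoms: "atom (\<Phi> (tail K e, [e], head K e))" if "e \<in> arcs K" for e
    using that bij_betwE[OF edges] by blast
  have no_id_snoc: False if p: "K.awalk u (p @ [e]) v" and "\<Phi> (u, p @ [e], v) = \<Phi> (x, [], x)"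
    and "x \<in> verts K" for u p e v x
  proof -
    have e: "e \<in> arcs K" and p': "(u, p, tail K e) \<in> paths K" 
      using p by (auto simp: K.awalk_snoc_iff simp del: K.awalk_append_iff)
    let ?e = "\<Phi> (tail K e, [e], head K e)"
    have "len (\<Phi> (x, [], x)) = 0"
      using ends[of "(x, [], x)"] id[of x] \<open>x \<in> verts K\<close> len_eq_0_iff[of "\<Phi> (x, [], x)"]
      by (simp add: path_id_def K.awalk_Nil_iff)
    then have "len (cmp ?e (\<Phi> (u, p, tail K e))) = 0" using \<Phi>_snoc[OF p] that by simp
    then have "len ?e = 0"
      using len_cmp[of "\<Phi> (u, p, tail K e)" ?e] ends[OF p'] ends[OF edge_path[OF e]] by simp
    then show False using atoms[OF e] len_eq_0_iff[of ?e] by (auto simp: atom_def)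
  qed
  have inj: "\<lbrakk>K.awalk u p v; K.awalk u q v'; \<Phi> (u, p, v) = \<Phi> (u, q, v')\<rbrakk> \<Longrightarrow> p = q"
    for u p v q v'
  proof (induction p arbitrary: q v v' rule: rev_induct)
    case Nil
    then show ?case using no_id_snoc[of u _ _ v' u] by (cases q rule: rev_exhaust) (auto simp: K.awalk_Nil_iff)
  next
    case (snoc e p)
    show ?case
    proof (cases q rule: rev_exhaust)
      case Nil
      then show ?thesis using snoc.prems no_id_snoc[of u p e v u] by (auto simp: K.awalk_Nil_iff)
    next
      case (snoc q' e')
      have p: "(u, p, tail K e) \<in> paths K" "e \<in> arcs K" and q: "(u, q', tail K e') \<in> paths K" "e' \<in> arcs K"
        using snoc.prems snoc by (auto simp: K.awalk_snoc_iff simp del: K.awalk_append_iff)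
      let ?e = "\<Phi> (tail K e, [e], head K e)" and ?e' = "\<Phi> (tail K e', [e'], head K e')"
      let ?p = "\<Phi> (u, p, tail K e)" and ?q = "\<Phi> (u, q', tail K e')"
      note facts = ends[OF p(1)] ends[OF q(1)] ends[OF edge_path[OF p(2)]] ends[OF edge_path[OF q(2)]]
        atoms[OF p(2)] atoms[OF q(2)]
      have eq: "cmp ?e ?p = cmp ?e' ?q"
        using snoc.prems snoc \<Phi>_snoc by metis
      have same: "?e = ?e' \<and> ?p = ?q"
      proof (rule levi[of ?p ?e ?q ?e'], goal_cases)
        case (8 h)
        then have "h = idt (src h)"
          using facts atom_cmpD[of "?e" "?e'" h] atom_not_idt[of "?e'"] by auto
        then show ?thesis using 8 facts idt_right[of ?e'] idt_left[of ?p] by (metis path_src.simps path_tgt.simps)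
      next
        case (9 h)
        then have "h = idt (src h)"
          using facts atom_cmpD[of "?e'" "?e" h] atom_not_idt[of "?e"] by auto
        then show ?thesis using 9 facts idt_right[of ?e] idt_left[of ?q] by (metis path_src.simps path_tgt.simps)
      qed (use facts eq in auto)
      then have "e = e'" using edges p q by (auto simp: bij_betw_def inj_on_def)
      then show ?thesis using snoc.IH[of "tail K e" q' "tail K e'"] p q same snoc by auto
    qed
  qed
  have "inj_on \<Phi> (paths K)"
  proof (rule inj_onI)
    fix x y assume *: "x \<in> paths K" "y \<in> paths K" "\<Phi> x = \<Phi> y"
    obtain u p v where x: "x = (u, p, v)" by (cases x)
    obtain u' q v' where y: "y = (u', q, v')" by (cases y)
    have "k u = k u'" "k v = k v'" using ends[OF *(1)] ends[OF *(2)] * x y by auto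
    then have "u = u'" "v = v'"
      using k * x y K.awalk_hd_in_verts K.awalk_last_in_verts by (auto simp: bij_betw_def inj_on_def)
    then show "x = y" using inj * x y by auto
  qed
  moreover have "f \<in> \<Phi> ` paths K" if "f \<in> M" for f
    using that
  proof (induction "len f" arbitrary: f rule: less_induct)
    case less
    consider "f = idt (src f)" | "atom f" | "f \<noteq> idt (src f)" "\<not> atom f" by blast
    then show ?case
    proof cases
      case 1
      then obtain v where v: "v \<in> verts K" "k v = src f"
        using k src_ob[OF less.prems] by (auto simp: bij_betw_def image_iff)
      then have "f = \<Phi> (path_id v)" using id 1 by simp
      then show ?thesis using K.path_id_in_paths[OF v(1)] by blast
    next
      case 2
      then obtain e where "e \<in> arcs K" "f = \<Phi> (tail K e, [e], head K e)"
        using edges by (auto simp: bij_betw_def image_iff)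
      then show ?thesis using edge_path by blast
    next
      case 3
      then obtain g h where gh: "g \<in> M" "h \<in> M" "tgt h = src g" "f = cmp g h" "len g \<noteq> 0" "len h \<noteq> 0"
        using less.prems len_eq_0_iff by (auto simp: atom_def)
      then obtain p q where pq: "p \<in> paths K" "q \<in> paths K" "h = \<Phi> p" "g = \<Phi> q"
        using less.hyps[of g] less.hyps[of h] len_cmp[of h g] by auto
      have "k (path_tgt p) = k (path_src q)" using gh pq ends by metis
      then have "path_tgt p = path_src q"
        using k pq K.path_src_in_verts K.path_tgt_in_verts by (auto simp: bij_betw_def inj_on_def)
      then have "f = \<Phi> (path_comp q p)" "path_comp q p \<in> paths K"
        using comp pq gh K.path_comp_in_paths by auto
      then show ?thesis by blast
    qed
  qed
  ultimately show ?thesis using ends by (auto simp: bij_betw_def)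
qed

end

section \<open>Sesquifunctors and two-sided whiskering\<close>

definition cellmap_comp where
  "cellmap_comp G F = \<lparr>map0 = map0 G \<circ> map0 F, map1 = map1 G \<circ> map1 F, map2 = map2 G \<circ> map2 F\<rparr>"

lemma cellmap_comp_simps [simp]:
  "map0 (cellmap_comp G F) x = map0 G (map0 F x)" "map1 (cellmap_comp G F) f = map1 G (map1 F f)"
  "map2 (cellmap_comp G F) \<alpha> = map2 G (map2 F \<alpha>)"
  by (simp_all add: cellmap_comp_def)

lemma (in sesquicategory) hom2_hom1:
  assumes "f \<in> hom1 S x y" "\<alpha> \<in> hom2 S f g"
  shows "g \<in> hom1 S x y"
  using assms globular_src[of \<alpha>] globular_tgt[of \<alpha>] tgt2_closed[of \<alpha>] by (auto simp: hom1_iff hom2_iff)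

lemma sesquifunctor_comp:
  assumes "sesquifunctor S T F" "sesquifunctor T U G"
  shows "sesquifunctor S U (cellmap_comp G F)"
proof -
  interpret F: sesquifunctor S T F by fact
  interpret G: sesquifunctor T U G by fact
  show ?thesis
  proof (unfold_locales, unfold cellmap_comp_simps, goal_cases)
    case 1 then show ?case by (intro G.map0_closed F.map0_closed)
  next
    case 2 then show ?case by (intro G.map1_hom F.map1_hom)
  next
    case 3 then show ?case by (intro G.map2_hom F.map2_hom)
  next
    case 4 then show ?case by (simp add: F.map1_id1 G.map1_id1 F.map0_closed)
  next
    case 5 then show ?case using F.map1_comp1 G.map1_comp1 F.map1_hom by metis
  next
    case (6 f)
    then have "map1 F f \<in> Cell1 T" using F.map1_hom[of f] by (auto simp: hom1_iff)
    then show ?case by (simp add: 6 F.map2_id2 G.map2_id2)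
  next
    case 7 then show ?case using F.map2_comp2 G.map2_comp2 F.map2_hom by metis
  next
    case 8 then show ?case using F.map2_lwhisk G.map2_lwhisk F.map2_hom F.map1_hom by metis
  next
    case 9 then show ?case using F.map2_rwhisk G.map2_rwhisk F.map2_hom F.map1_hom by metis
  qed
qed

lemma (in sesquifunctor) map1_closed:
  "f \<in> Cell1 S \<Longrightarrow> map1 F f \<in> Cell1 T \<and> src1 T (map1 F f) = map0 F (src1 S f) \<and> tgt1 T (map1 F f) = map0 F (tgt1 S f)"
  using map1_hom[of f "src1 S f" "tgt1 S f"] by (simp add: hom1_iff)

lemma (in sesquifunctor) map2_closed:
  "\<alpha> \<in> Cell2 S \<Longrightarrow> map2 F \<alpha> \<in> Cell2 T \<and> src2 T (map2 F \<alpha>) = map1 F (src2 S \<alpha>) \<and> tgt2 T (map2 F \<alpha>) = map1 F (tgt2 S \<alpha>)"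
  using map2_hom[of \<alpha> "src2 S \<alpha>" "tgt2 S \<alpha>"] by (simp add: hom2_iff)

lemma (in sesquifunctor) isomorphic_if_bij:
  assumes b0: "bij_betw (map0 F) (Cell0 S) (Cell0 T)"
    and b1: "bij_betw (map1 F) (Cell1 S) (Cell1 T)"
    and b2: "bij_betw (map2 F) (Cell2 S) (Cell2 T)"
  shows "sesquicat_isomorphic T S"
proof -
  define G where "G = \<lparr>map0 = inv_into (Cell0 S) (map0 F), map1 = inv_into (Cell1 S) (map1 F),
    map2 = inv_into (Cell2 S) (map2 F)\<rparr>"
  have FG: "\<And>x. x \<in> Cell0 T \<Longrightarrow> map0 G x \<in> Cell0 S \<and> map0 F (map0 G x) = x"
    "\<And>f. f \<in> Cell1 T \<Longrightarrow> map1 G f \<in> Cell1 S \<and> map1 F (map1 G f) = f"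
    "\<And>\<alpha>. \<alpha> \<in> Cell2 T \<Longrightarrow> map2 G \<alpha> \<in> Cell2 S \<and> map2 F (map2 G \<alpha>) = \<alpha>"
    using assms by (auto simp: G_def bij_betw_def f_inv_into_f inv_into_into)
  have GF: "\<And>x. x \<in> Cell0 S \<Longrightarrow> map0 G (map0 F x) = x"
    "\<And>f. f \<in> Cell1 S \<Longrightarrow> map1 G (map1 F f) = f"
    "\<And>\<alpha>. \<alpha> \<in> Cell2 S \<Longrightarrow> map2 G (map2 F \<alpha>) = \<alpha>"
    using assms by (auto simp: G_def bij_betw_def)
  have G1: "map1 G f \<in> hom1 S (map0 G x) (map0 G y)" if "f \<in> hom1 T x y" for f x y
    using that FG(2)[of f] map1_closed[of "map1 G f"] GF(1) S.src1_closed S.tgt1_closed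
    by (auto simp: hom1_iff)
  have G2: "map2 G \<alpha> \<in> hom2 S (map1 G f) (map1 G g)" if "\<alpha> \<in> hom2 T f g" for \<alpha> f g
    using that FG(3)[of \<alpha>] map2_closed[of "map2 G \<alpha>"] GF(2) S.src2_closed S.tgt2_closed
    by (auto simp: hom2_iff)
  have FG1: "\<And>f x y. f \<in> hom1 T x y \<Longrightarrow> map1 F (map1 G f) = f"
    and FG2: "\<And>\<alpha> f g. \<alpha> \<in> hom2 T f g \<Longrightarrow> map2 F (map2 G \<alpha>) = \<alpha>"
    using FG by (auto simp: hom1_iff hom2_iff)
  have GF1: "\<And>f x y. f \<in> hom1 S x y \<Longrightarrow> map1 G (map1 F f) = f"
    and GF2: "\<And>\<alpha> f g. \<alpha> \<in> hom2 S f g \<Longrightarrow> map2 G (map2 F \<alpha>) = \<alpha>"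
    using GF by (auto simp: hom1_iff hom2_iff)
  have "sesquifunctor T S G"
  proof (unfold_locales, goal_cases)
    case 1 then show ?case using FG(1) by blast
  next
    case 2 then show ?case by (rule G1)
  next
    case 3 then show ?case by (rule G2)
  next
    case (4 x)
    then show ?case using map1_id1[of "map0 G x"] FG(1)[of x] GF1[OF S.id1_hom] by metis
  next
    case (5 f x y g z)
    then show ?case
      using map1_comp1[OF G1[OF 5(1)] G1[OF 5(2)]] GF1[OF S.comp1_hom[OF G1[OF 5(1)] G1[OF 5(2)]]]
        FG1[OF 5(1)] FG1[OF 5(2)] by simp
  next
    case (6 f)
    then show ?case using map2_id2[of "map1 G f"] FG(2)[of f] GF2[OF S.id2_hom] by metis
  next
    case (7 \<alpha> f g \<beta> h)
    then show ?case
      using map2_comp2[OF G2[OF 7(1)] G2[OF 7(2)]] GF2[OF S.comp2_hom[OF G2[OF 7(1)] G2[OF 7(2)]]]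
        FG2[OF 7(1)] FG2[OF 7(2)] by simp
  next
    case (8 f x y \<alpha> f' g z)
    then show ?case
      using map2_lwhisk[OF G1[OF 8(1)] G2[OF 8(2)] G1[OF 8(3)]]
        GF2[OF S.lwhisk_hom[OF G1[OF 8(1)] G2[OF 8(2)] G1[OF 8(3)]]] FG1[OF 8(3)] FG2[OF 8(2)]
      by simp
  next
    case (9 f x y g z \<beta> g')
    then show ?case
      using map2_rwhisk[OF G1[OF 9(1)] G1[OF 9(2)] G2[OF 9(3)]]
        GF2[OF S.rwhisk_hom[OF G1[OF 9(1)] G1[OF 9(2)] G2[OF 9(3)]]] FG1[OF 9(1)] FG2[OF 9(3)]
      by simp
  qed
  then show ?thesis
    unfolding sesquicat_isomorphic_def using sesquifunctor_axioms FG GF by blast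
qed

text \<open>
  Whiskering on both sides at once. Every arc of a whisker graph carries two whiskers, so this is
  the operation by which atoms arise from generators.
\<close>

definition bwhisk where "bwhisk S l \<alpha> r = l \<lhd>\<^bsub>S\<^esub> (\<alpha> \<rhd>\<^bsub>S\<^esub> r)"

definition whiskerable where
  "whiskerable S l \<alpha> r \<longleftrightarrow> l \<in> Cell1 S \<and> \<alpha> \<in> Cell2 S \<and> r \<in> Cell1 S \<and>
    src1 S l = tgt1 S (src2 S \<alpha>) \<and> tgt1 S r = src1 S (src2 S \<alpha>)"

context sesquicategory
begin

lemma whiskerable_homs:
  assumes "whiskerable S l \<alpha> r"
  shows "r \<in> hom1 S (src1 S r) (tgt1 S r)" "src2 S \<alpha> \<in> hom1 S (tgt1 S r) (src1 S l)"
    "\<alpha> \<in> hom2 S (src2 S \<alpha>) (tgt2 S \<alpha>)" "l \<in> hom1 S (src1 S l) (tgt1 S l)"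
    "src2 S \<alpha> \<star> r \<in> hom1 S (src1 S r) (src1 S l)"
    "\<alpha> \<rhd> r \<in> hom2 S (src2 S \<alpha> \<star> r) (tgt2 S \<alpha> \<star> r)"
proof -
  show *: "r \<in> hom1 S (src1 S r) (tgt1 S r)" "src2 S \<alpha> \<in> hom1 S (tgt1 S r) (src1 S l)"
    "\<alpha> \<in> hom2 S (src2 S \<alpha>) (tgt2 S \<alpha>)" "l \<in> hom1 S (src1 S l) (tgt1 S l)"
    using assms src2_closed by (auto simp: whiskerable_def hom1_iff hom2_iff)
  show "src2 S \<alpha> \<star> r \<in> hom1 S (src1 S r) (src1 S l)" using comp1_hom * by blast
  show "\<alpha> \<rhd> r \<in> hom2 S (src2 S \<alpha> \<star> r) (tgt2 S \<alpha> \<star> r)" using rwhisk_hom * by blast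
qed

lemma bwhisk_hom:
  assumes "whiskerable S l \<alpha> r"
  shows "bwhisk S l \<alpha> r \<in> hom2 S (l \<star> (src2 S \<alpha> \<star> r)) (l \<star> (tgt2 S \<alpha> \<star> r))"
  unfolding bwhisk_def using lwhisk_hom whiskerable_homs[OF assms] by blast

lemma bwhisk_comp2:
  assumes "whiskerable S l \<alpha> r" "\<beta> \<in> Cell2 S" "src2 S \<beta> = tgt2 S \<alpha>"
  shows "bwhisk S l (\<beta> \<cdot> \<alpha>) r = bwhisk S l \<beta> r \<cdot> bwhisk S l \<alpha> r"
proof -
  note w = whiskerable_homs[OF assms(1)]
  have \<beta>: "\<beta> \<in> hom2 S (tgt2 S \<alpha>) (tgt2 S \<beta>)" using assms by (simp add: hom2_iff)
  note t = hom2_hom1[OF w(2,3)]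
  show ?thesis unfolding bwhisk_def rwhisk_comp2[OF w(1,2,3) \<beta>]
    using lwhisk_comp2[OF w(5,6) rwhisk_hom[OF w(1) t \<beta>] w(4)] by simp
qed

lemma bwhisk_bwhisk:
  assumes "whiskerable S l \<alpha> r" "l' \<in> Cell1 S" "r' \<in> Cell1 S" "src1 S l' = tgt1 S l" "tgt1 S r' = src1 S r"
  shows "bwhisk S l' (bwhisk S l \<alpha> r) r' = bwhisk S (l' \<star> l) \<alpha> (r \<star> r')"
    and "whiskerable S (l' \<star> l) \<alpha> (r \<star> r')"
proof -
  note w = whiskerable_homs[OF assms(1)]
  have l': "l' \<in> hom1 S (tgt1 S l) (tgt1 S l')" and r': "r' \<in> hom1 S (src1 S r') (src1 S r)"
    using assms by (auto simp: hom1_iff)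
  have "bwhisk S l' (bwhisk S l \<alpha> r) r' = l' \<lhd> (l \<lhd> ((\<alpha> \<rhd> r) \<rhd> r'))"
    unfolding bwhisk_def using whisk_whisk[OF r' w(5,6,4)] by simp
  also have "(\<alpha> \<rhd> r) \<rhd> r' = \<alpha> \<rhd> (r \<star> r')" using rwhisk_comp1[OF r' w(1,2,3)] by simp
  also have "l' \<lhd> (l \<lhd> (\<alpha> \<rhd> (r \<star> r'))) = (l' \<star> l) \<lhd> (\<alpha> \<rhd> (r \<star> r'))"
    using lwhisk_comp1[OF _ rwhisk_hom[OF comp1_hom[OF r' w(1)] w(2,3)] w(4) l'] 
      comp1_hom[OF comp1_hom[OF r' w(1)] w(2)] by simp
  finally show "bwhisk S l' (bwhisk S l \<alpha> r) r' = bwhisk S (l' \<star> l) \<alpha> (r \<star> r')"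
    by (simp add: bwhisk_def)
  show "whiskerable S (l' \<star> l) \<alpha> (r \<star> r')"
    using assms comp1_hom[OF w(4) l'] comp1_hom[OF r' w(1)] by (auto simp: whiskerable_def hom1_iff)
qed

lemma bwhisk_id1:
  assumes "\<alpha> \<in> Cell2 S"
  defines "l \<equiv> id1 S (tgt1 S (src2 S \<alpha>))" and "r \<equiv> id1 S (src1 S (src2 S \<alpha>))"
  shows "bwhisk S l \<alpha> r = \<alpha>" and "whiskerable S l \<alpha> r"
proof -
  let ?f = "src2 S \<alpha>"
  have f: "?f \<in> hom1 S (src1 S ?f) (tgt1 S ?f)" and \<alpha>: "\<alpha> \<in> hom2 S ?f (tgt2 S \<alpha>)"
    using assms src2_closed by (auto simp: hom1_iff hom2_iff)
  show "bwhisk S l \<alpha> r = \<alpha>"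
    using rwhisk_id1[OF f \<alpha>] lwhisk_id1[OF f \<alpha>] by (simp add: bwhisk_def l_def r_def)
  show "whiskerable S l \<alpha> r"
    using f assms(1) id1_hom src1_closed tgt1_closed by (auto simp: whiskerable_def hom1_iff l_def r_def)
qed

end

lemma (in sesquifunctor) map2_bwhisk:
  assumes "whiskerable S l \<alpha> r"
  shows "map2 F (bwhisk S l \<alpha> r) = bwhisk T (map1 F l) (map2 F \<alpha>) (map1 F r)"
    and "whiskerable T (map1 F l) (map2 F \<alpha>) (map1 F r)"
proof -
  note w = S.whiskerable_homs[OF assms]
  show "map2 F (bwhisk S l \<alpha> r) = bwhisk T (map1 F l) (map2 F \<alpha>) (map1 F r)"
    unfolding bwhisk_def map2_lwhisk[OF w(5,6,4)] map2_rwhisk[OF w(1,2,3)] ..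
  show "whiskerable T (map1 F l) (map2 F \<alpha>) (map1 F r)"
    using assms map1_closed map2_closed S.src2_closed by (auto simp: whiskerable_def)
qed

abbreviation whisk_edge where
  "whisk_edge l r \<equiv> \<lambda>(a, c, b). (path_comp l a, c, path_comp b r)"

context computad
begin

lemma bwhisk_free:
  "bwhisk (free_sesquicat G) l x r =
    (path_comp l (path_comp (path_src x) r), map (whisk_edge l r) (path_edges x),
      path_comp l (path_comp (path_tgt x) r))"
  by (cases x) (auto simp: bwhisk_def)

lemma whisker_walk_arc:
  assumes "whisker.awalk p ws q" "(a, c, b) \<in> set ws"
  shows "a \<in> paths (graph G)" "c \<in> gens G" "b \<in> paths (graph G)" "path_tgt a = path_tgt p"
    "path_src b = path_src p"
proof -
  obtain us vs where ws: "ws = us @ (a, c, b) # vs" using assms(2) by (meson split_list)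
  obtain v where "whisker.awalk p us v" "whisker.awalk v ((a, c, b) # vs) q"
    using assms(1) whisker.awalk_splitE unfolding ws by blast
  then show "a \<in> paths (graph G)" "c \<in> gens G" "b \<in> paths (graph G)" "path_tgt a = path_tgt p"
    "path_src b = path_src p"
    using whisker_walk_globular[of p us v]
    by (auto simp: whisker.awalk_Cons_iff whisker_arc_iff)
qed

text \<open>
  A walk can be divided by \<open>h\<close> as soon as the left whiskers of its arcs can: the intermediate
  vertices are ends of arcs and are therefore divisible as well. The start of the walk is treated
  separately because a walk may be empty.
\<close>

lemma whisker_walk_divide_left:
  assumes "whisker.awalk (path_comp h u) ws q" "u \<in> paths (graph G)" "path_tgt u = path_src h"
    and "\<And>a c b. (a, c, b) \<in> set ws \<Longrightarrow>
      \<exists>a'\<in>paths (graph G). path_tgt a' = path_src h \<and> a = path_comp h a'"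
  shows "\<exists>ws' v. whisker.awalk u ws' v \<and> q = path_comp h v \<and>
    ws = map (\<lambda>(a, c, b). (path_comp h a, c, b)) ws'"
  using assms
proof (induction ws arbitrary: u)
  case Nil
  then show ?case by (intro exI[of _ "[]"] exI[of _ u]) (simp add: whisker.awalk_Nil_iff)
next
  case (Cons w ws)
  obtain a c b where w: "w = (a, c, b)" by (cases w)
  then obtain a' where a': "a' \<in> paths (graph G)" "path_tgt a' = path_src h" "a = path_comp h a'"
    using Cons.prems(4)[of a c b] by (metis list.set_intros(1))
  have walk: "w \<in> arcs (whisker_graph G)" "path_comp h u = path_comp a (path_comp (dom2 G c) b)"
      "whisker.awalk (path_comp a (path_comp (cod2 G c) b)) ws q"
    using Cons.prems(1) w by (auto simp: whisker.awalk_Cons_iff)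
  have w': "(a', c, b) \<in> arcs (whisker_graph G)"
    using walk(1) a' w by (auto simp: whisker_arc_iff)
  have u: "u = path_comp a' (path_comp (dom2 G c) b)"
    by (rule path_comp_cancel_left[of h]) (use walk(2) a' Cons.prems in \<open>simp_all add: path_comp_assoc\<close>)
  let ?u = "path_comp a' (path_comp (cod2 G c) b)"
  have "?u \<in> paths (graph G)"
    using whisker.head_in_verts[OF w'] by simp
  then have "\<exists>ws' v. whisker.awalk ?u ws' v \<and> q = path_comp h v \<and> ws = map (\<lambda>(a, c, b). (path_comp h a, c, b)) ws'"
  proof (rule Cons.IH[rotated])
    show "\<exists>a'\<in>paths (graph G). path_tgt a' = path_src h \<and> a = path_comp h a'"
      if "(a, c, b) \<in> set ws" for a c b
      by (rule Cons.prems(4)[of a c b]) (use that in simp)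
  qed (use walk(3) a' in \<open>simp_all add: path_comp_assoc\<close>)
  then obtain ws' v where "whisker.awalk ?u ws' v" "q = path_comp h v"
      "ws = map (\<lambda>(a, c, b). (path_comp h a, c, b)) ws'"
    by blast
  then show ?case
    using w' u a' w by (intro exI[of _ "(a', c, b) # ws'"] exI[of _ v])
      (auto simp: whisker.awalk_Cons_iff)
qed

lemma whisker_walk_divide_right:
  assumes "whisker.awalk (path_comp u h) ws q" "u \<in> paths (graph G)" "path_src u = path_tgt h"
    and "\<And>a c b. (a, c, b) \<in> set ws \<Longrightarrow>
      \<exists>b'\<in>paths (graph G). path_src b' = path_tgt h \<and> b = path_comp b' h"
  shows "\<exists>ws' v. whisker.awalk u ws' v \<and> q = path_comp v h \<and>
    ws = map (\<lambda>(a, c, b). (a, c, path_comp b h)) ws'"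
  using assms
proof (induction ws arbitrary: u)
  case Nil
  then show ?case by (intro exI[of _ "[]"] exI[of _ u]) (simp add: whisker.awalk_Nil_iff)
next
  case (Cons w ws)
  obtain a c b where w: "w = (a, c, b)" by (cases w)
  then obtain b' where b': "b' \<in> paths (graph G)" "path_src b' = path_tgt h" "b = path_comp b' h"
    using Cons.prems(4)[of a c b] by (metis list.set_intros(1))
  have walk: "w \<in> arcs (whisker_graph G)" "path_comp u h = path_comp a (path_comp (dom2 G c) b)"
      "whisker.awalk (path_comp a (path_comp (cod2 G c) b)) ws q"
    using Cons.prems(1) w by (auto simp: whisker.awalk_Cons_iff)
  have w': "(a, c, b') \<in> arcs (whisker_graph G)"
    using walk(1) b' w by (auto simp: whisker_arc_iff)
  have u: "u = path_comp a (path_comp (dom2 G c) b')"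
    by (rule path_comp_cancel_right[of _ h]) (use walk(2) b' Cons.prems in \<open>simp_all add: path_comp_assoc\<close>)
  let ?u = "path_comp a (path_comp (cod2 G c) b')"
  have "?u \<in> paths (graph G)"
    using whisker.head_in_verts[OF w'] by simp
  then have "\<exists>ws' v. whisker.awalk ?u ws' v \<and> q = path_comp v h \<and> ws = map (\<lambda>(a, c, b). (a, c, path_comp b h)) ws'"
  proof (rule Cons.IH[rotated])
    show "\<exists>b'\<in>paths (graph G). path_src b' = path_tgt h \<and> b = path_comp b' h"
      if "(a, c, b) \<in> set ws" for a c b
      by (rule Cons.prems(4)[of a c b]) (use that in simp)
  qed (use walk(3) b' in \<open>simp_all add: path_comp_assoc\<close>)
  then obtain ws' v where "whisker.awalk ?u ws' v" "q = path_comp v h"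
      "ws = map (\<lambda>(a, c, b). (a, c, path_comp b h)) ws'"
    by blast
  then show ?case
    using w' u b' w by (intro exI[of _ "(a, c, b') # ws'"] exI[of _ v])
      (auto simp: whisker.awalk_Cons_iff)
qed

text \<open>
  For a nonempty walk the divisibility of the start follows from that of the first arc.
\<close>

lemma divide_left:
  assumes "x \<in> Cell2 (free_sesquicat G)" "path_edges x \<noteq> []"
    and "\<And>a c b. (a, c, b) \<in> set (path_edges x) \<Longrightarrow>
      \<exists>a'\<in>paths (graph G). path_tgt a' = path_src h \<and> a = path_comp h a'"
  obtains y where "y \<in> Cell2 (free_sesquicat G)" "path_tgt (path_src y) = path_src h"
    "x = h \<lhd>\<^bsub>free_sesquicat G\<^esub> y"
proof -
  obtain p a c b ws q where x: "x = (p, (a, c, b) # ws, q)"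
    using assms(2) by (cases x; cases "path_edges x") auto
  then obtain a' where a': "a' \<in> paths (graph G)" "path_tgt a' = path_src h" "a = path_comp h a'"
    using assms(3)[of a c b] by (metis list.set_intros(1) path_edges.simps)
  let ?u = "path_comp a' (path_comp (dom2 G c) b)"
  have walk: "whisker.awalk p ((a, c, b) # ws) q" using assms(1) x by simp
  then have arc: "(a, c, b) \<in> arcs (whisker_graph G)" and p: "p = path_comp h ?u"
    using a' by (auto simp: whisker.awalk_Cons_iff path_comp_assoc)
  then have "(a', c, b) \<in> arcs (whisker_graph G)" using a' by (auto simp: whisker_arc_iff)
  then have "?u \<in> paths (graph G)" using whisker.tail_in_verts by fastforce
  then have "\<exists>ws' v. whisker.awalk ?u ws' v \<and> q = path_comp h v \<and> (a, c, b) # ws = map (\<lambda>(a, c, b). (path_comp h a, c, b)) ws'"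
  proof (rule whisker_walk_divide_left[rotated])
    show "\<exists>a'\<in>paths (graph G). path_tgt a' = path_src h \<and> a1 = path_comp h a'"
      if "(a1, c1, b1) \<in> set ((a, c, b) # ws)" for a1 c1 b1
      by (rule assms(3)[of a1 c1 b1]) (use that x in simp)
  qed (use walk p a' in simp_all)
  then obtain ws' v where *: "whisker.awalk ?u ws' v" "q = path_comp h v"
      "(a, c, b) # ws = map (\<lambda>(a, c, b). (path_comp h a, c, b)) ws'"
    by (elim exE conjE)
  show ?thesis
    by (rule that[of "(?u, ws', v)"]) (use * p a' x in auto)
qed

lemma divide_right:
  assumes "x \<in> Cell2 (free_sesquicat G)" "path_edges x \<noteq> []"
    and "\<And>a c b. (a, c, b) \<in> set (path_edges x) \<Longrightarrow>
      \<exists>b'\<in>paths (graph G). path_src b' = path_tgt h \<and> b = path_comp b' h"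
  obtains y where "y \<in> Cell2 (free_sesquicat G)" "path_src (path_src y) = path_tgt h"
    "x = y \<rhd>\<^bsub>free_sesquicat G\<^esub> h"
proof -
  obtain p a c b ws q where x: "x = (p, (a, c, b) # ws, q)"
    using assms(2) by (cases x; cases "path_edges x") auto
  then obtain b' where b': "b' \<in> paths (graph G)" "path_src b' = path_tgt h" "b = path_comp b' h"
    using assms(3)[of a c b] by (metis list.set_intros(1) path_edges.simps)
  let ?u = "path_comp a (path_comp (dom2 G c) b')"
  have walk: "whisker.awalk p ((a, c, b) # ws) q" using assms(1) x by simp
  then have arc: "(a, c, b) \<in> arcs (whisker_graph G)" and p: "p = path_comp ?u h"
    using b' by (auto simp: whisker.awalk_Cons_iff path_comp_assoc)
  then have "(a, c, b') \<in> arcs (whisker_graph G)" using b' by (auto simp: whisker_arc_iff)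
  then have "?u \<in> paths (graph G)" using whisker.tail_in_verts by fastforce
  then have "\<exists>ws' v. whisker.awalk ?u ws' v \<and> q = path_comp v h \<and> (a, c, b) # ws = map (\<lambda>(a, c, b). (a, c, path_comp b h)) ws'"
  proof (rule whisker_walk_divide_right[rotated])
    show "\<exists>b'\<in>paths (graph G). path_src b' = path_tgt h \<and> b1 = path_comp b' h"
      if "(a1, c1, b1) \<in> set ((a, c, b) # ws)" for a1 c1 b1
      by (rule assms(3)[of a1 c1 b1]) (use that x in simp)
  qed (use walk p b' in simp_all)
  then obtain ws' v where *: "whisker.awalk ?u ws' v" "q = path_comp v h"
      "(a, c, b) # ws = map (\<lambda>(a, c, b). (a, c, path_comp b h)) ws'"
    by (elim exE conjE)
  show ?thesis
    by (rule that[of "(?u, ws', v)"]) (use * p b' x in auto)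
qed

end

section \<open>Retracts of free sesquicategories\<close>

text \<open>
  The equation along the unit prescribes a sesquifunctor on edges; functoriality determines it on
  paths.
\<close>

lemma free_extension_simps:
  assumes "computad G" "sesquifunctor (free_sesquicat G) S F" "extends_along_unit G F \<phi>"
  shows "x \<in> verts (graph G) \<Longrightarrow> map0 F x = map0 \<phi> x"
    and "p \<in> paths (graph G) \<Longrightarrow> map1 F p = path_composite S (path_map (map0 \<phi>) (map1 \<phi>) p)"
    and "c \<in> gens G \<Longrightarrow> map2 F (fst (snd (map2 (free_unit G) c))) = fst (snd (map2 \<phi> c))"
proof -
  interpret G: computad G by fact
  interpret F: sesquifunctor "free_sesquicat G" S F by fact
  show v: "map0 F x = map0 \<phi> x" if "x \<in> verts (graph G)" for x
    using assms(3) that by (auto simp: extends_along_unit_def underlying_computad_map_def)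
  show "map2 F (fst (snd (map2 (free_unit G) c))) = fst (snd (map2 \<phi> c))" if "c \<in> gens G"
  proof -
    have "map2 \<phi> c = map2 (underlying_computad_map F) (map2 (free_unit G) c)"
      using assms(3) that by (simp add: extends_along_unit_def)
    then show ?thesis by (simp add: underlying_computad_map_def)
  qed
  assume p: "p \<in> paths (graph G)"
  have e: "map1 F (G.edge e) = map1 \<phi> e" if "e \<in> arcs (graph G)" for e
    using assms(3) that by (auto simp: extends_along_unit_def underlying_computad_map_def)
  let ?p = "path_map (\<lambda>x. x) G.edge p"
  have "path_map (map0 F) (map1 F) ?p = path_map (map0 \<phi>) (map1 \<phi>) p"
    using p v e G.graph.path_src_in_verts[OF p] G.graph.path_tgt_in_verts[OF p]
    by (cases p) (auto simp: G.graph.awalk_def)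
  then show "map1 F p = path_composite S (path_map (map0 \<phi>) (map1 \<phi>) p)"
    using F.path_composite_map[OF G.path_composite_edges(1)[OF p]] G.path_composite_edges(2)[OF p] by simp
qed

locale free_sesquicat_retract =
  S: sesquicategory S + G: computad G +
  s: sesquifunctor S "free_sesquicat G" s + r: sesquifunctor "free_sesquicat G" S r
  for S :: "('o, 'm, 't) sesquicat" (structure) and G :: "('v, 'e, 'c) computad" and s r +
  assumes r_s_0: "x \<in> Cell0 S \<Longrightarrow> map0 r (map0 s x) = x"
    and r_s_1: "f \<in> Cell1 S \<Longrightarrow> map1 r (map1 s f) = f"
    and r_s_2: "\<alpha> \<in> Cell2 S \<Longrightarrow> map2 r (map2 s \<alpha>) = \<alpha>"
begin

sublocale C1: path_category_retract "graph G" "Cell0 S" "Cell1 S" "src1 S" "tgt1 S" "id1 S" "comp1 S"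
  "map0 s" "map1 s" "map0 r" "map1 r"
proof (unfold_locales, goal_cases)
  case 1 then show ?case by (rule S.src1_closed)
next
  case 2 then show ?case by (rule S.tgt1_closed)
next
  case (3 x) then show ?case using S.id1_hom[of x] by (simp add: hom1_iff)
next
  case (4 f g) then show ?case using S.comp1_hom[of f _ _ g] by (simp add: hom1_iff)
next
  case 5 then show ?case by (simp add: S.comp1_id_right hom1_iff)
next
  case 6 then show ?case by (simp add: S.comp1_id_left hom1_iff)
next
  case 7 then show ?case using s.map1_closed by simp
next
  case 8 then show ?case using s.map1_id1 by simp
next
  case (9 f g) then show ?case using s.map1_comp1[of f _ _ g] by (simp add: hom1_iff)
next
  case 10 then show ?case using r.map1_closed by simp
next
  case 11 then show ?case using r.map1_id1 by simp
next
  case (12 p q) then show ?case using r.map1_comp1[of p _ _ q] by (simp add: hom1_iff)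
qed (simp_all add: r_s_1 r_s_0)

sublocale C2: path_category_retract "whisker_graph G" "Cell1 S" "Cell2 S" "src2 S" "tgt2 S" "id2 S" "comp2 S"
  "map1 s" "map2 s" "map1 r" "map2 r"
proof (unfold_locales, goal_cases)
  case 1 then show ?case by (rule S.src2_closed)
next
  case 2 then show ?case by (rule S.tgt2_closed)
next
  case (3 x) then show ?case using S.id2_hom[of x] by (simp add: hom2_iff)
next
  case (4 f g) then show ?case using S.comp2_hom[of f _ _ g] by (simp add: hom2_iff)
next
  case 5 then show ?case by (simp add: S.comp2_id_right hom2_iff)
next
  case 6 then show ?case by (simp add: S.comp2_id_left hom2_iff)
next
  case 7 then show ?case using s.map2_closed by simp
next
  case 8 then show ?case using s.map2_id2 by simp
next
  case (9 f g) then show ?case using s.map2_comp2[of f _ _ g] by (simp add: hom2_iff)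
next
  case 10 then show ?case using r.map2_closed by simp
next
  case 11 then show ?case using r.map2_id2 by simp
next
  case (12 p q) then show ?case using r.map2_comp2[of p _ _ q] by (simp add: hom2_iff)
qed (simp_all add: r_s_2 r_s_1)

lemma len_bwhisk: "whiskerable S l \<alpha> r' \<Longrightarrow> C2.len (bwhisk S l \<alpha> r') = C2.len \<alpha>"
  by (simp add: C2.len_def s.map2_bwhisk(1) G.bwhisk_free)

lemma bwhisk_is_id2_iff:
  assumes "whiskerable S l \<alpha> r'"
  shows "bwhisk S l \<alpha> r' = id2 S (src2 S (bwhisk S l \<alpha> r')) \<longleftrightarrow> \<alpha> = id2 S (src2 S \<alpha>)"
proof -
  have "\<alpha> \<in> Cell2 S" "bwhisk S l \<alpha> r' \<in> Cell2 S"
    using S.bwhisk_hom[OF assms] assms by (simp_all add: whiskerable_def hom2_iff)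
  then show ?thesis using C2.len_eq_0_iff len_bwhisk[OF assms] by metis
qed

text \<open>
  Whiskering reflects factorizations. A factorization of the whiskered 2-cell cuts the walk of
  \<open>\<alpha>\<close> into two walks \<open>x\<close> and \<open>y\<close>. These need not lie in the image of \<open>s\<close>, but \<open>r\<close> fixes \<open>\<alpha>\<close>, the
  whiskers and both factors, so that \<open>r x\<close> and \<open>r y\<close> have the required properties.
\<close>

lemma bwhisk_factorization:
  assumes w: "whiskerable S l \<alpha> r'" and gh: "g \<in> Cell2 S" "h \<in> Cell2 S" "tgt2 S h = src2 S g"
    and eq: "bwhisk S l \<alpha> r' = g \<cdot> h"
  obtains \<beta> \<gamma> where "whiskerable S l \<beta> r'" "whiskerable S l \<gamma> r'" "tgt2 S \<beta> = src2 S \<gamma>"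
    "\<alpha> = \<gamma> \<cdot> \<beta>" "h = bwhisk S l \<beta> r'" "g = bwhisk S l \<gamma> r'"
proof -
  let ?H = "free_sesquicat G" and ?l = "map1 s l" and ?r = "map1 s r'"
  obtain u es z where \<alpha>: "map2 s \<alpha> = (u, es, z)" by (cases "map2 s \<alpha>")
  note sw = s.map2_bwhisk[OF w]
  have sgh: "path_comp (map2 s g) (map2 s h) = bwhisk ?H ?l (u, es, z) ?r"
    using s.map2_comp2[of h _ _ g] gh eq sw(1) \<alpha> by (simp add: hom2_iff)
  then have "map (whisk_edge ?l ?r) es = path_edges (map2 s h) @ path_edges (map2 s g)"
    by (simp add: G.bwhisk_free path_comp_def)
  then obtain es1 es2 where es: "es = es1 @ es2" "map (whisk_edge ?l ?r) es1 = path_edges (map2 s h)"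
      "map (whisk_edge ?l ?r) es2 = path_edges (map2 s g)"
    by (auto simp: map_eq_append_conv)
  have "map2 s \<alpha> \<in> paths (whisker_graph G)"
    using s.map2_closed[of \<alpha>] w by (simp add: whiskerable_def)
  then have "G.whisker.awalk u (es1 @ es2) z"
    unfolding \<alpha> es(1) mem_paths_iff .
  then obtain v where v: "G.whisker.awalk u es1 v" "G.whisker.awalk v es2 z"
    by (rule G.whisker.awalk_splitE)
  let ?x = "(u, es1, v)" and ?y = "(v, es2, z)"
  have wx: "whiskerable ?H ?l ?x ?r" and wy: "whiskerable ?H ?l ?y ?r"
    using sw(2) v \<alpha> G.whisker_walk_globular[OF v(1)] by (simp_all add: whiskerable_def)
  have sh: "map2 s h = bwhisk ?H ?l ?x ?r"
  proof -
    have "map2 s h \<in> paths (whisker_graph G)" "bwhisk ?H ?l ?x ?r \<in> paths (whisker_graph G)"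
      using s.map2_closed[OF gh(2)] G.free.bwhisk_hom[OF wx] by (simp_all add: hom2_iff)
    moreover have "path_src (map2 s h) = path_src (bwhisk ?H ?l ?x ?r)"
      using arg_cong[OF sgh, of path_src] by (simp add: G.bwhisk_free)
    ultimately show ?thesis
      using es(2) G.whisker.awalk_end_unique by (cases "map2 s h") (auto simp: G.bwhisk_free)
  qed
  have sg: "map2 s g = bwhisk ?H ?l ?y ?r"
  proof (rule path_comp_cancel_right[of _ "bwhisk ?H ?l ?x ?r"])
    show "path_comp (map2 s g) (bwhisk ?H ?l ?x ?r) = path_comp (bwhisk ?H ?l ?y ?r) (bwhisk ?H ?l ?x ?r)"
      using sgh sh es(1) by (simp add: G.bwhisk_free)
    have "path_tgt (map2 s h) = path_src (map2 s g)"
      using s.map2_closed[OF gh(1)] s.map2_closed[OF gh(2)] gh(3) by simp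
    then show "path_src (map2 s g) = path_tgt (bwhisk ?H ?l ?x ?r)" using sh by simp
  qed (simp add: G.bwhisk_free)
  have ll: "map1 r ?l = l" "map1 r ?r = r'" using w r_s_1 by (simp_all add: whiskerable_def)
  have "map2 r ?x \<in> Cell2 S" "map2 r ?y \<in> Cell2 S" "tgt2 S (map2 r ?x) = src2 S (map2 r ?y)"
    using r.map2_closed[of ?x] r.map2_closed[of ?y] v by simp_all
  moreover have "\<alpha> = map2 r ?y \<cdot> map2 r ?x"
    using C2.r_cmp[of ?x ?y] v \<alpha> es(1) r_s_2[of \<alpha>] w by (simp add: whiskerable_def)
  moreover have "h = bwhisk S l (map2 r ?x) r'" "g = bwhisk S l (map2 r ?y) r'"
    using arg_cong[OF sh, of "map2 r"] arg_cong[OF sg, of "map2 r"] r_s_2 gh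
      r.map2_bwhisk(1)[OF wx] r.map2_bwhisk(1)[OF wy] ll by simp_all
  ultimately show ?thesis
    using that r.map2_bwhisk(2)[OF wx] r.map2_bwhisk(2)[OF wy] ll by simp
qed

lemma atom_bwhisk_iff:
  assumes w: "whiskerable S l \<alpha> r'"
  shows "C2.atom (bwhisk S l \<alpha> r') \<longleftrightarrow> C2.atom \<alpha>"
proof
  assume \<alpha>: "C2.atom \<alpha>"
  show "C2.atom (bwhisk S l \<alpha> r')"
    unfolding C2.atom_def
  proof (intro conjI ballI impI)
    show "bwhisk S l \<alpha> r' \<in> Cell2 S" using S.bwhisk_hom[OF w] by (simp add: hom2_iff)
    show "bwhisk S l \<alpha> r' \<noteq> id2 S (src2 S (bwhisk S l \<alpha> r'))"
      using bwhisk_is_id2_iff[OF w] C2.atom_not_idt[OF \<alpha>] by simp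
    fix g h assume "g \<in> Cell2 S" "h \<in> Cell2 S" "tgt2 S h = src2 S g" "bwhisk S l \<alpha> r' = g \<cdot> h"
    then obtain \<beta> \<gamma> where "whiskerable S l \<beta> r'" "whiskerable S l \<gamma> r'" "tgt2 S \<beta> = src2 S \<gamma>"
      "\<alpha> = \<gamma> \<cdot> \<beta>" "h = bwhisk S l \<beta> r'" "g = bwhisk S l \<gamma> r'"
      by (rule bwhisk_factorization[OF w])
    then show "g = id2 S (src2 S g) \<or> h = id2 S (src2 S h)"
      using C2.atom_cmpD[OF \<alpha>, of \<gamma> \<beta>] bwhisk_is_id2_iff by (auto simp: whiskerable_def)
  qed
next
  assume *: "C2.atom (bwhisk S l \<alpha> r')"
  show "C2.atom \<alpha>"
    unfolding C2.atom_def
  proof (intro conjI ballI impI)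
    show "\<alpha> \<in> Cell2 S" using w by (simp add: whiskerable_def)
    show "\<alpha> \<noteq> id2 S (src2 S \<alpha>)"
      using bwhisk_is_id2_iff[OF w] C2.atom_not_idt[OF *] by simp
    fix g h assume gh: "g \<in> Cell2 S" "h \<in> Cell2 S" "tgt2 S h = src2 S g" "\<alpha> = g \<cdot> h"
    have wgh: "whiskerable S l h r'" "whiskerable S l g r'"
      using w gh C2.cmp_in[of h g] S.globular_src[of h] S.globular_tgt[of h] by (simp_all add: whiskerable_def)
    show "g = id2 S (src2 S g) \<or> h = id2 S (src2 S h)"
      using C2.atom_cmpD[OF *, of "bwhisk S l g r'" "bwhisk S l h r'"] S.bwhisk_comp2[OF wgh(1) gh(1)] gh
        S.bwhisk_hom[OF wgh(1)] S.bwhisk_hom[OF wgh(2)] bwhisk_is_id2_iff[OF wgh(1)] bwhisk_is_id2_iff[OF wgh(2)]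
      by (simp add: hom2_iff)
  qed
qed

text \<open>
  The generators of the computad: an atom for vertical composition can still be a whiskered
  generator, and this is excluded by the second condition.
\<close>

definition primitive :: "'t \<Rightarrow> bool" where
  "primitive c \<longleftrightarrow> C2.atom c \<and>
    (\<forall>l d r. whiskerable S l d r \<longrightarrow> c = bwhisk S l d r \<longrightarrow> l = id1 S (src1 S l) \<and> r = id1 S (src1 S r))"

lemma primitiveD:
  assumes "primitive c"
  shows "C2.atom c" "c \<in> Cell2 S"
    "\<lbrakk>whiskerable S l d r'; c = bwhisk S l d r'\<rbrakk> \<Longrightarrow> l = id1 S (src1 S l)"
    "\<lbrakk>whiskerable S l d r'; c = bwhisk S l d r'\<rbrakk> \<Longrightarrow> r' = id1 S (src1 S r')"
  using assms C2.atom_in unfolding primitive_def by blast+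

lemma primitive_walk_nonempty: "primitive c \<Longrightarrow> path_edges (map2 s c) \<noteq> []"
  using C2.len_eq_0_iff[of c] primitiveD(2)[of c] C2.atom_not_idt[of c] primitiveD(1)[of c]
  by (auto simp: C2.len_def)

text \<open>
  Removing a nontrivial whisker from an atom leaves an atom with a shorter source.
\<close>

lemma ex_primitive:
  "C2.atom \<alpha> \<Longrightarrow> \<exists>l c r. primitive c \<and> whiskerable S l c r \<and> \<alpha> = bwhisk S l c r"
proof (induction "C1.len (src2 S \<alpha>)" arbitrary: \<alpha> rule: less_induct)
  case less
  have \<alpha>: "\<alpha> \<in> Cell2 S" using less.prems by (rule C2.atom_in)
  show ?case
  proof (cases "primitive \<alpha>")
    case True
    then show ?thesis using S.bwhisk_id1[OF \<alpha>] by metis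
  next
    case False
    then obtain l d r' where d: "whiskerable S l d r'" "\<alpha> = bwhisk S l d r'"
      "l \<noteq> id1 S (src1 S l) \<or> r' \<noteq> id1 S (src1 S r')"
      using less.prems unfolding primitive_def by blast
    note w = S.whiskerable_homs[OF d(1)]
    have "C1.len (src2 S \<alpha>) = C1.len l + (C1.len (src2 S d) + C1.len r')"
      using S.bwhisk_hom[OF d(1)] w(1,2,4,5) d(2) by (simp add: hom1_iff hom2_iff C1.len_cmp)
    moreover have "C1.len l \<noteq> 0 \<or> C1.len r' \<noteq> 0"
      using d(1,3) C1.len_eq_0_iff by (auto simp: whiskerable_def)
    ultimately have "C1.len (src2 S d) < C1.len (src2 S \<alpha>)" by auto
    moreover have "C2.atom d" using less.prems d atom_bwhisk_iff by blast
    ultimately obtain l' c r'' where c: "primitive c" "whiskerable S l' c r''" "d = bwhisk S l' c r''"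
      using less.hyps by blast
    note w' = S.whiskerable_homs[OF c(2)]
    have "src1 S l = tgt1 S l'" "tgt1 S r' = src1 S r''"
      using d(1) S.bwhisk_hom[OF c(2)] c(3) w' S.comp1_hom[OF w'(5,4)]
      by (auto simp: whiskerable_def hom1_iff hom2_iff)
    then show ?thesis
      using c d S.bwhisk_bwhisk[OF c(2), of l r'] by (auto simp: whiskerable_def)
  qed
qed

lemma whisker_edge_composable:
  assumes "whiskerable S l c r'" "(a, d, b) \<in> set (path_edges (map2 s c))"
  shows "a \<in> paths (graph G)" "b \<in> paths (graph G)" "map1 s l \<in> paths (graph G)" "map1 s r' \<in> paths (graph G)"
    "path_tgt a = path_src (map1 s l)" "path_src b = path_tgt (map1 s r')"
proof -
  obtain u es z where c: "map2 s c = (u, es, z)" by (cases "map2 s c")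
  have sc: "map2 s c \<in> paths (whisker_graph G)" "path_src (map2 s c) = map1 s (src2 S c)"
    using s.map2_closed[of c] assms(1) by (simp_all add: whiskerable_def)
  then have "G.whisker.awalk u es z" unfolding c mem_paths_iff by simp
  then show "a \<in> paths (graph G)" "b \<in> paths (graph G)" "map1 s l \<in> paths (graph G)" "map1 s r' \<in> paths (graph G)"
    "path_tgt a = path_src (map1 s l)" "path_src b = path_tgt (map1 s r')"
    using G.whisker_walk_arc[of u es z a d b] assms c sc(2) s.map1_closed[of l] s.map1_closed[of r']
      s.map1_closed[of "src2 S c"] S.src2_closed[of c] by (auto simp: whiskerable_def)
qed

lemma bwhisk_edge_match:
  assumes "whiskerable S l c r'" "whiskerable S l' c' r''" "bwhisk S l c r' = bwhisk S l' c' r''"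
    and "(a, d, b) \<in> set (path_edges (map2 s c))"
  obtains a' b' where "(a', d, b') \<in> set (path_edges (map2 s c'))"
    "path_comp (map1 s l) a = path_comp (map1 s l') a'" "path_comp b (map1 s r') = path_comp b' (map1 s r'')"
proof -
  have "map (whisk_edge (map1 s l) (map1 s r')) (path_edges (map2 s c)) =
      map (whisk_edge (map1 s l') (map1 s r'')) (path_edges (map2 s c'))"
    using arg_cong[OF assms(3), of "map2 s"]
    by (simp add: s.map2_bwhisk(1)[OF assms(1)] s.map2_bwhisk(1)[OF assms(2)] G.bwhisk_free)
  from arg_cong[OF this, of set] have "whisk_edge (map1 s l) (map1 s r') (a, d, b)
      \<in> whisk_edge (map1 s l') (map1 s r'') ` set (path_edges (map2 s c'))"
    using imageI[OF assms(4), of "whisk_edge (map1 s l) (map1 s r')"] by (simp only: set_map)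
  then obtain e where e: "e \<in> set (path_edges (map2 s c'))"
      "whisk_edge (map1 s l) (map1 s r') (a, d, b) = whisk_edge (map1 s l') (map1 s r'') e"
    by (elim imageE)
  obtain a' d' b' where "e = (a', d', b')" by (cases e)
  then show ?thesis using that[of a' b'] e by simp
qed

text \<open>
  If the left whisker \<open>l'\<close> extends \<open>l\<close> by a path \<open>h\<close>, then \<open>h\<close> divides all arcs of the walk of \<open>c\<close>, by
  comparison with those of \<open>c'\<close>. Hence \<open>c = r h \<lhd> d\<close> for some \<open>d\<close>, and primitivity makes \<open>r h\<close>
  an identity although \<open>h\<close> may be nonempty.
\<close>

lemma left_whisker_maximal:
  assumes c: "primitive c" "whiskerable S l c r'" "whiskerable S l' c' r''"
    "bwhisk S l c r' = bwhisk S l' c' r''"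
    and h: "h \<in> paths (graph G)" "path_tgt h = path_src (map1 s l)" "map1 s l' = path_comp (map1 s l) h"
  shows "l' = l"
proof -
  let ?H = "free_sesquicat G"
  have sc: "map2 s c \<in> Cell2 ?H" using s.map2_closed primitiveD(2)[OF c(1)] by simp
  have ne: "path_edges (map2 s c) \<noteq> []"
    by (rule primitive_walk_nonempty[OF c(1)])
  have div: "\<exists>a'\<in>paths (graph G). path_tgt a' = path_src h \<and> a = path_comp h a'"
    if mem: "(a, d, b) \<in> set (path_edges (map2 s c))" for a d b
  proof -
    obtain a' b' where *: "(a', d, b') \<in> set (path_edges (map2 s c'))"
        "path_comp (map1 s l) a = path_comp (map1 s l') a'"
      using bwhisk_edge_match[OF c(2-4) mem] by metis
    note e = whisker_edge_composable[OF c(2) mem] and e' = whisker_edge_composable[OF c(3) *(1)]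
    have "a = path_comp h a'"
      by (rule path_comp_cancel_left[of "map1 s l"]) (use * e e' h in \<open>simp_all add: path_comp_assoc\<close>)
    then show ?thesis using e' h by auto
  qed
  obtain x where x: "x \<in> Cell2 ?H" "path_tgt (path_src x) = path_src h" "map2 s c = h \<lhd>\<^bsub>?H\<^esub> x"
    by (rule G.divide_left[OF sc ne div])
  let ?i = "id1 ?H (src1 ?H (src2 ?H x))"
  have i: "?i \<in> Cell1 ?H" "whiskerable ?H h x ?i" "x \<rhd>\<^bsub>?H\<^esub> ?i = x"
    using G.free.bwhisk_id1(2)[OF x(1)] x h G.free.rwhisk_id1[of "src2 ?H x" "src1 ?H (src2 ?H x)" _ x "tgt2 ?H x"]
      G.free.src2_closed[OF x(1)]
    by (simp_all add: whiskerable_def hom1_iff hom2_iff)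
  then have "c = bwhisk S (map1 r h) (map2 r x) (map1 r ?i)" "whiskerable S (map1 r h) (map2 r x) (map1 r ?i)"
    using r.map2_bwhisk[OF i(2)] x(3) r_s_2[OF primitiveD(2)[OF c(1)]] by (simp_all add: bwhisk_def)
  then have rh: "map1 r h = id1 S (src1 S (map1 r h))" using primitiveD(3)[OF c(1)] by blast
  have l: "l \<in> Cell1 S" "l' \<in> Cell1 S" using c by (simp_all add: whiskerable_def)
  have l': "l' = l \<star> map1 r h"
    using C1.r_cmp[of h "map1 s l"] h s.map1_closed[OF l(1)] r_s_1[OF l(1)] r_s_1[OF l(2)] by simp
  have t: "tgt1 S (map1 r h) = src1 S l" "src1 S (map1 r h) \<in> Cell0 S"
    using r.map1_closed[of h] h(1,2) s.map1_closed[OF l(1)] r_s_0[OF S.src1_closed[OF l(1)]]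
      S.src1_closed[of "map1 r h"] by simp_all
  have "src1 S (map1 r h) = src1 S l"
    using arg_cong[OF rh, of "tgt1 S"] C1.idt_in[OF t(2)] t(1) by simp
  note rh[unfolded this]
  then show ?thesis using C1.idt_right[OF l(1)] l' by simp
qed

lemma right_whisker_maximal:
  assumes c: "primitive c" "whiskerable S l c r'" "whiskerable S l' c' r''"
    "bwhisk S l c r' = bwhisk S l' c' r''"
    and h: "h \<in> paths (graph G)" "path_src h = path_tgt (map1 s r')" "map1 s r'' = path_comp h (map1 s r')"
  shows "r'' = r'"
proof -
  let ?H = "free_sesquicat G"
  have sc: "map2 s c \<in> Cell2 ?H" using s.map2_closed primitiveD(2)[OF c(1)] by simp
  have ne: "path_edges (map2 s c) \<noteq> []"
    by (rule primitive_walk_nonempty[OF c(1)])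
  have div: "\<exists>b'\<in>paths (graph G). path_src b' = path_tgt h \<and> b = path_comp b' h"
    if mem: "(a, d, b) \<in> set (path_edges (map2 s c))" for a d b
  proof -
    obtain a' b' where *: "(a', d, b') \<in> set (path_edges (map2 s c'))"
        "path_comp b (map1 s r') = path_comp b' (map1 s r'')"
      using bwhisk_edge_match[OF c(2-4) mem] by metis
    note e = whisker_edge_composable[OF c(2) mem] and e' = whisker_edge_composable[OF c(3) *(1)]
    have "b = path_comp b' h"
      by (rule path_comp_cancel_right[of _ "map1 s r'"]) (use * e e' h in \<open>simp_all add: path_comp_assoc\<close>)
    then show ?thesis using e' h by auto
  qed
  obtain x where x: "x \<in> Cell2 ?H" "path_src (path_src x) = path_tgt h" "map2 s c = x \<rhd>\<^bsub>?H\<^esub> h"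
    by (rule G.divide_right[OF sc ne div])
  let ?i = "id1 ?H (tgt1 ?H (src2 ?H x))"
  have "x \<rhd>\<^bsub>?H\<^esub> h \<in> hom2 ?H (path_comp (path_src x) h) (path_comp (path_tgt x) h)"
    using G.free.rwhisk_hom[of h "path_src h" "path_tgt h" "path_src x" "path_tgt (path_src x)" x "path_tgt x"]
      x h G.free.src2_closed[OF x(1)] by (simp add: hom1_iff hom2_iff)
  then have i: "?i \<in> Cell1 ?H" "whiskerable ?H ?i x h" "?i \<lhd>\<^bsub>?H\<^esub> (x \<rhd>\<^bsub>?H\<^esub> h) = x \<rhd>\<^bsub>?H\<^esub> h"
    using G.free.bwhisk_id1(2)[OF x(1)] x h G.free.src2_closed[OF x(1)] G.graph.path_comp_in_paths[of h "path_src x"]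
      G.free.lwhisk_id1[of "path_comp (path_src x) h" "path_src h" "path_tgt (path_src x)" "x \<rhd>\<^bsub>?H\<^esub> h"
        "path_comp (path_tgt x) h"]
    by (simp_all add: whiskerable_def hom1_iff)
  then have "c = bwhisk S (map1 r ?i) (map2 r x) (map1 r h)" "whiskerable S (map1 r ?i) (map2 r x) (map1 r h)"
    using r.map2_bwhisk[OF i(2)] x(3) r_s_2[OF primitiveD(2)[OF c(1)]] by (simp_all add: bwhisk_def)
  then have rh: "map1 r h = id1 S (src1 S (map1 r h))" using primitiveD(4)[OF c(1)] by blast
  have l: "r' \<in> Cell1 S" "r'' \<in> Cell1 S" using c by (simp_all add: whiskerable_def)
  have r'': "r'' = map1 r h \<star> r'"
    using C1.r_cmp[of "map1 s r'" h] h s.map1_closed[OF l(1)] r_s_1[OF l(1)] r_s_1[OF l(2)] by simp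
  have "src1 S (map1 r h) = tgt1 S r'"
    using r.map1_closed[of h] h(1,2) s.map1_closed[OF l(1)] r_s_0[OF S.tgt1_closed[OF l(1)]] by simp
  note rh[unfolded this]
  then show ?thesis using C1.idt_left[OF l(1)] r'' by simp
qed

text \<open>
  Any arc of the walk of \<open>c\<close> exhibits the two left whiskers as final segments of one path and the two
  right whiskers as initial segments of another. They are thus comparable, and the longer one is no
  proper extension by the two preceding lemmas. Once the whiskers agree, cancelling them in each
  arc identifies \<open>c\<close> with \<open>c'\<close>.
\<close>

lemma primitive_unique:
  assumes c: "primitive c" "whiskerable S l c r'" and c': "primitive c'" "whiskerable S l' c' r''"
    and eq: "bwhisk S l c r' = bwhisk S l' c' r''"
  shows "l = l'" "c = c'" "r' = r''"
proof -
  let ?H = "free_sesquicat G"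
  have "path_edges (map2 s c) \<noteq> []"
    by (rule primitive_walk_nonempty[OF c(1)])
  then obtain a d b where e: "(a, d, b) \<in> set (path_edges (map2 s c))"
    by (metis hd_in_set prod_cases3)
  then obtain a' b' where e': "(a', d, b') \<in> set (path_edges (map2 s c'))"
      "path_comp (map1 s l) a = path_comp (map1 s l') a'" "path_comp b (map1 s r') = path_comp b' (map1 s r'')"
    using bwhisk_edge_match[OF c(2) c'(2) eq] by metis
  note comp = whisker_edge_composable[OF c(2) e] whisker_edge_composable[OF c'(2) e'(1)]
  show l: "l = l'"
  proof (rule G.graph.path_levi[of a "map1 s l" a' "map1 s l'"], goal_cases)
    case (8 h)
    then show ?case using left_whisker_maximal[OF c'(1,2) c(2) eq[symmetric], of h] comp by simp
  next
    case (9 h)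
    then show ?case using left_whisker_maximal[OF c(1,2) c'(2) eq, of h] comp by simp
  qed (use comp e' in auto)
  show r: "r' = r''"
  proof (rule G.graph.path_levi[of "map1 s r'" b "map1 s r''" b'], goal_cases)
    case (8 h)
    then show ?case using right_whisker_maximal[OF c(1,2) c'(2) eq, of h] comp by simp
  next
    case (9 h)
    then show ?case using right_whisker_maximal[OF c'(1,2) c(2) eq[symmetric], of h] comp by simp
  qed (use comp e' in auto)
  have bw: "bwhisk ?H (map1 s l) (map2 s c) (map1 s r') = bwhisk ?H (map1 s l) (map2 s c') (map1 s r')"
    using arg_cong[OF eq, of "map2 s"] s.map2_bwhisk(1)[OF c(2)] s.map2_bwhisk(1)[OF c'(2)] l r by simp
  have cancel: "p = q" if "path_comp (map1 s l) (path_comp p (map1 s r')) = path_comp (map1 s l) (path_comp q (map1 s r'))"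
    "path_tgt p = path_src (map1 s l)" "path_src p = path_tgt (map1 s r')"
    "path_tgt q = path_src (map1 s l)" "path_src q = path_tgt (map1 s r')" for p q
    using path_comp_cancel_left[OF that(1)] that path_comp_cancel_right[of p "map1 s r'" q] by simp
  have "map2 s c = map2 s c'"
  proof -
    have es: "path_edges (map2 s c) = path_edges (map2 s c')"
    proof (rule map_inj_on)
      show "map (whisk_edge (map1 s l) (map1 s r')) (path_edges (map2 s c)) =
          map (whisk_edge (map1 s l) (map1 s r')) (path_edges (map2 s c'))"
        using bw by (simp add: G.bwhisk_free)
      show "inj_on (whisk_edge (map1 s l) (map1 s r')) (set (path_edges (map2 s c)) \<union> set (path_edges (map2 s c')))"
      proof (rule inj_onI)
        fix x y
        assume xy: "x \<in> set (path_edges (map2 s c)) \<union> set (path_edges (map2 s c'))"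
          "y \<in> set (path_edges (map2 s c)) \<union> set (path_edges (map2 s c'))"
          "whisk_edge (map1 s l) (map1 s r') x = whisk_edge (map1 s l) (map1 s r') y"
        obtain a d b where x: "x = (a, d, b)" by (cases x)
        obtain a' d' b' where y: "y = (a', d', b')" by (cases y)
        have "path_tgt a = path_src (map1 s l)" "path_src b = path_tgt (map1 s r')"
          "path_tgt a' = path_src (map1 s l)" "path_src b' = path_tgt (map1 s r')"
          using whisker_edge_composable(5,6)[OF c(2)] whisker_edge_composable(5,6)[OF c'(2)] l r xy(1,2)
          unfolding x y by blast+
        then show "x = y"
          using xy(3) path_comp_cancel_left[of "map1 s l" a a'] path_comp_cancel_right[of b "map1 s r'" b']
          by (simp add: x y)
      qed
    qed
    have "path_src (map2 s c) = path_src (map2 s c')"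
      by (rule cancel) (use bw s.map2_bwhisk(2)[OF c(2)] s.map2_bwhisk(2)[OF c'(2)] l r in
        \<open>simp_all add: G.bwhisk_free whiskerable_def\<close>)
    moreover have "map2 s c \<in> paths (whisker_graph G)" "map2 s c' \<in> paths (whisker_graph G)"
      using s.map2_closed primitiveD(2) c c' by auto
    ultimately show ?thesis
      using es G.whisker.awalk_end_unique by (cases "map2 s c"; cases "map2 s c'") auto
  qed
  then show "c = c'" using r_s_2 primitiveD(2) c c' by metis
qed

definition atom_graph :: "('o, 'm) pre_digraph" where
  "atom_graph = \<lparr>verts = Cell0 S, arcs = {f. C1.atom f}, tail = src1 S, head = tgt1 S\<rparr>"

definition word :: "'m \<Rightarrow> ('o, 'm) path" where
  "word f = (SOME p. p \<in> paths atom_graph \<and> path_composite S p = f)"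

text \<open>
  A 2-cell of a computad has paths as source and target, so the boundary of a primitive 2-cell is
  recorded through the unique decompositions of 1-cells into atoms.
\<close>

definition primitive_computad :: "('o, 'm, 't) computad" where
  "primitive_computad = \<lparr>graph = atom_graph, gens = {c. primitive c},
    dom2 = \<lambda>c. word (src2 S c), cod2 = \<lambda>c. word (tgt2 S c)\<rparr>"

lemma primitive_computad_simps:
  "graph primitive_computad = atom_graph" "gens primitive_computad = {c. primitive c}"
  "dom2 primitive_computad c = word (src2 S c)" "cod2 primitive_computad c = word (tgt2 S c)"
  by (simp_all add: primitive_computad_def)

lemma atom_graph_simps [simp]:
  "verts atom_graph = Cell0 S" "arcs atom_graph = {f. C1.atom f}" "tail atom_graph = src1 S"
  "head atom_graph = tgt1 S"
  by (simp_all add: atom_graph_def)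

lemma wf_atom_graph: "wf_digraph atom_graph"
  by unfold_locales (auto dest: C1.atom_in simp: S.src1_closed S.tgt1_closed)

lemma atom_paths: "p \<in> paths atom_graph \<Longrightarrow> p \<in> paths (underlying_graph S)"
proof -
  assume p: "p \<in> paths atom_graph"
  have "path_map (\<lambda>x. x) (\<lambda>x. x) p \<in> paths (underlying_graph S)"
    by (rule path_map_in_paths[OF wf_atom_graph S.wf_underlying_graph _ _ p])
      (auto simp: underlying_graph_def dest: C1.atom_in)
  then show ?thesis by (cases p) simp
qed

lemma bij_path_composite: "bij_betw (path_composite S) (paths atom_graph) (Cell1 S)"
proof (rule C1.bij_betw_paths_if_edges_are_atoms[OF wf_atom_graph, where k = "\<lambda>x. x"])
  interpret E: path_extension "underlying_graph S" "Cell0 S" "hom1 S" "id1 S" "comp1 S" "\<lambda>x. x" "\<lambda>f. f"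
    by (rule S.underlying_path_extension)
  show "path_composite S p \<in> Cell1 S \<and> src1 S (path_composite S p) = path_src p \<and>
      tgt1 S (path_composite S p) = path_tgt p" if "p \<in> paths atom_graph" for p
    using S.path_composite_hom[OF atom_paths[OF that]] by (simp add: hom1_iff)
  show "path_composite S (path_comp q p) = path_composite S q \<star> path_composite S p"
    if "p \<in> paths atom_graph" "q \<in> paths atom_graph" "path_tgt p = path_src q" for p q
    using E.ext_comp[OF atom_paths[OF that(1)] atom_paths[OF that(2)] that(3)]
    by (simp add: S.path_composite_eq_ext)
  have "path_composite S (src1 S e, [e], tgt1 S e) = e" if "C1.atom e" for e
    using E.ext_arc[of e] C1.atom_in[OF that] by (simp add: S.path_composite_eq_ext underlying_graph_def)
  then show "bij_betw (\<lambda>e. path_composite S (tail atom_graph e, [e], head atom_graph e)) (arcs atom_graph) {f. C1.atom f}"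
    by (auto simp: bij_betw_def inj_on_def image_iff)
qed (simp_all add: path_composite_def path_id_def bij_betw_def)

lemma word:
  assumes "f \<in> Cell1 S"
  shows "word f \<in> paths atom_graph" "path_composite S (word f) = f"
    "path_src (word f) = src1 S f" "path_tgt (word f) = tgt1 S f"
proof -
  have "\<exists>p. p \<in> paths atom_graph \<and> path_composite S p = f"
    using bij_path_composite assms by (metis bij_betw_imp_surj_on imageE)
  then have w: "word f \<in> paths atom_graph \<and> path_composite S (word f) = f"
    unfolding word_def by (rule someI_ex)
  then show "word f \<in> paths atom_graph" "path_composite S (word f) = f" by auto
  show "path_src (word f) = src1 S f" "path_tgt (word f) = tgt1 S f"
    using S.path_composite_hom[OF atom_paths, of "word f"] w by (simp_all add: hom1_iff)
qed

lemma computad_primitive: "computad primitive_computad"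
  by unfold_locales
    (auto simp: primitive_computad_def wf_digraph.wellformed[OF wf_atom_graph, simplified] word
      S.src2_closed S.tgt2_closed S.globular_src S.globular_tgt dest!: primitiveD(2)
      simp del: mem_paths_iff)

text \<open>
  Arcs \<open>(l, c, r)\<close> of the whisker graph are paths \<open>l\<close>, \<open>r\<close> of atoms and a primitive \<open>c\<close>; replacing the
  paths by their composites turns unique decomposition of atoms into this bijection.
\<close>

lemma whisker_edges_bij:
  assumes F: "sesquifunctor (free_sesquicat primitive_computad) S F"
    and F1: "\<And>p. p \<in> paths atom_graph \<Longrightarrow> map1 F p = path_composite S p"
    and F2: "\<And>c. primitive c \<Longrightarrow> map2 F (fst (snd (map2 (free_unit primitive_computad) c))) = c"
  defines "W \<equiv> whisker_graph primitive_computad"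
  shows "bij_betw (\<lambda>w. map2 F (tail W w, [w], head W w)) (arcs W) {\<alpha>. C2.atom \<alpha>}"
proof -
  interpret P: computad primitive_computad by (rule computad_primitive)
  interpret F: sesquifunctor "free_sesquicat primitive_computad" S F by (rule F)
  let ?H = "free_sesquicat primitive_computad"
  let ?c = "\<lambda>c. fst (snd (map2 (free_unit primitive_computad) c))"
  have arc: "primitive c \<and> whiskerable S (path_composite S l) c (path_composite S q) \<and>
      map2 F (tail W (l, c, q), [(l, c, q)], head W (l, c, q))
        = bwhisk S (path_composite S l) c (path_composite S q)
      \<and> l \<in> paths atom_graph \<and> q \<in> paths atom_graph"
    if "(l, c, q) \<in> arcs W" for l c q
  proof -
    have lcq: "l \<in> paths atom_graph" "primitive c" "q \<in> paths atom_graph"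
      "path_src l = path_tgt (word (src2 S c))" "path_tgt q = path_src (word (src2 S c))"
      using that by (simp_all add: W_def P.whisker_arc_iff primitive_computad_simps del: mem_paths_iff)
    have c: "c \<in> gens primitive_computad" using lcq(2) by (simp add: primitive_computad_simps)
    have "?c c \<in> Cell2 ?H"
      using P.unit_cell[OF c] P.whisker.arc_implies_awalk[OF P.unit_cell(1)[OF c]] by simp
    moreover have "path_src (?c c) = word (src2 S c)" by (simp add: primitive_computad_simps)
    ultimately    have w: "whiskerable ?H l (?c c) q"
      using lcq by (simp add: whiskerable_def primitive_computad_simps del: mem_paths_iff P.free_unit_simps)
    have "(tail W (l, c, q), [(l, c, q)], head W (l, c, q)) = bwhisk ?H l (?c c) q"
      using P.whiskered_eq[of l c q] that unfolding W_def bwhisk_def by simp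
    then have "map2 F (tail W (l, c, q), [(l, c, q)], head W (l, c, q)) = bwhisk S (map1 F l) c (map1 F q)"
      "whiskerable S (map1 F l) c (map1 F q)"
      using F.map2_bwhisk[OF w] F2[OF lcq(2)] by simp_all
    then show ?thesis using F1 lcq by simp
  qed
  have "inj_on (\<lambda>w. map2 F (tail W w, [w], head W w)) (arcs W)"
  proof (rule inj_onI)
    fix v w
    assume v: "v \<in> arcs W" and w: "w \<in> arcs W"
      and eq: "map2 F (tail W v, [v], head W v) = map2 F (tail W w, [w], head W w)"
    obtain l c q l' c' q' where vw: "v = (l, c, q)" "w = (l', c', q')" by (cases v; cases w)
    note a = arc[OF v[unfolded vw]] arc[OF w[unfolded vw]]
    have "bwhisk S (path_composite S l) c (path_composite S q) =
        bwhisk S (path_composite S l') c' (path_composite S q')"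
      using a eq vw by simp
    then have "path_composite S l = path_composite S l'" "c = c'" "path_composite S q = path_composite S q'"
      using primitive_unique a by blast+
    then show "v = w" using bij_path_composite a vw by (auto simp: bij_betw_def inj_on_def)
  qed
  moreover have sub: "C2.atom (map2 F (tail W w, [w], head W w))" if "w \<in> arcs W" for w
    using arc that atom_bwhisk_iff primitiveD(1) by (cases w) auto
  have sup: "\<exists>w \<in> arcs W. \<alpha> = map2 F (tail W w, [w], head W w)" if at: "C2.atom \<alpha>" for \<alpha>
  proof -
    obtain l c q where lcq: "primitive c" "whiskerable S l c q" "\<alpha> = bwhisk S l c q"
      using ex_primitive[OF at] by blast
    then have l: "l \<in> Cell1 S" "q \<in> Cell1 S" "src2 S c \<in> Cell1 S"
      using S.src2_closed by (auto simp: whiskerable_def)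
    have "(word l, c, word q) \<in> arcs W"
      using lcq word l by (simp add: W_def P.whisker_arc_iff primitive_computad_simps whiskerable_def del: mem_paths_iff)
    then show ?thesis using arc lcq word l by (intro bexI[of _ "(word l, c, word q)"]) auto
  qed
  have "(\<lambda>w. map2 F (tail W w, [w], head W w)) ` arcs W = {\<alpha>. C2.atom \<alpha>}"
    by (intro equalityI image_subsetI subsetI CollectI; (elim CollectE)?) (use sub sup in blast)+
  ultimately show ?thesis by (simp add: bij_betw_def)
qed

theorem free_on_computad: "free_on_computad S"
proof -
  interpret P: computad primitive_computad by (rule computad_primitive)
  interpret V: computad "underlying_computad S" by (rule S.computad_underlying)
  have id: "path_map (\<lambda>x. x) (\<lambda>x. x) p = p" for p :: "('o, 'm) path" by (cases p) simp
  define \<phi> :: "('o, 'm, 't, 'o, 'm, ('o, 'm) path \<times> 't \<times> ('o, 'm) path) cellmap" where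
    "\<phi> = \<lparr>map0 = \<lambda>x. x, map1 = \<lambda>x. x, map2 = \<lambda>c. (word (src2 S c), c, word (tgt2 S c))\<rparr>"
  have "computad_morphism primitive_computad (underlying_computad S) \<phi>"
  proof (unfold_locales, goal_cases)
    case (5 c)
    then have c: "c \<in> Cell2 S" using primitiveD(2) by (simp add: primitive_computad_simps)
    then show ?case
      using word[OF S.src2_closed[OF c]] word[OF S.tgt2_closed[OF c]] S.globular_src S.globular_tgt atom_paths
      by (simp add: \<phi>_def underlying_computad_def hom2_iff del: mem_paths_iff)
  qed (auto simp: primitive_computad_simps \<phi>_def underlying_computad_def underlying_graph_def id dest: C1.atom_in)
  then obtain F where F: "sesquifunctor (free_sesquicat primitive_computad) S F"
      and ext: "extends_along_unit primitive_computad F \<phi>"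
    using free_sesquicat_universal[OF S.sesquicategory_axioms] by blast
  interpret F: sesquifunctor "free_sesquicat primitive_computad" S F by (rule F)
  note simps = free_extension_simps[OF computad_primitive F ext]
  have F0: "map0 F x = x" if "x \<in> Cell0 S" for x using simps(1)[of x] that by (simp add: primitive_computad_simps \<phi>_def)
  have F1: "map1 F p = path_composite S p" if "p \<in> paths atom_graph" for p
    using simps(2)[of p] that by (simp add: primitive_computad_simps \<phi>_def id)
  have F2: "map2 F (fst (snd (map2 (free_unit primitive_computad) c))) = c" if "primitive c" for c
    using simps(3)[of c] that by (simp add: primitive_computad_simps \<phi>_def)
  have b1: "bij_betw (map1 F) (paths atom_graph) (Cell1 S)"
    by (rule bij_betw_cong[THEN iffD2, OF _ bij_path_composite]) (rule F1)
  have b2: "bij_betw (map2 F) (paths (whisker_graph primitive_computad)) (Cell2 S)"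
  proof (rule C2.bij_betw_paths_if_edges_are_atoms[where k = "map1 F"])
    show "wf_digraph (whisker_graph primitive_computad)" by (rule P.whisker.wf_digraph_axioms)
    show "bij_betw (map1 F) (verts (whisker_graph primitive_computad)) (Cell1 S)"
      using b1 by (simp add: primitive_computad_simps)
    show "map2 F (path_comp q p) = map2 F q \<cdot> map2 F p" if "p \<in> paths (whisker_graph primitive_computad)"
      "q \<in> paths (whisker_graph primitive_computad)" "path_tgt p = path_src q" for p q
      using F.map2_comp2[of p _ _ q] that by (simp add: hom2_iff)
  qed (use F.map2_closed F.map2_id2 whisker_edges_bij[OF F F1 F2] in simp_all)
  have "sesquicat_isomorphic S (free_sesquicat primitive_computad)"
  proof (rule F.isomorphic_if_bij)
    have "bij_betw (map0 F) (Cell0 S) (Cell0 S)"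
      by (rule bij_betw_cong[THEN iffD2, OF F0 bij_betw_id[unfolded id_def]])
    then show "bij_betw (map0 F) (Cell0 (free_sesquicat primitive_computad)) (Cell0 S)"
      by (simp add: primitive_computad_simps)
  qed (use b1 b2 in \<open>simp_all add: primitive_computad_simps\<close>)
  then show ?thesis unfolding free_on_computad_def using computad_primitive by blast
qed

end

section \<open>Gray-functors and 3-cells\<close>

definition hom3 :: "('o, 'm, 't, 'r) gray \<Rightarrow> 't \<Rightarrow> 't \<Rightarrow> 'r set" where
  "hom3 \<A> \<alpha> \<beta> = {\<Phi> \<in> Cell3 \<A>. src3 \<A> \<Phi> = \<alpha> \<and> tgt3 \<A> \<Phi> = \<beta>}"

lemma hom1_hom_2cat_iff: "\<alpha> \<in> hom1 (hom_2cat \<A> x y) f g \<longleftrightarrow> f \<in> hom1 \<A> x y \<and> \<alpha> \<in> hom2 \<A> f g"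
  by (auto simp: hom1_iff hom2_iff Cell1_hom_2cat)

lemma hom2_hom_2cat_iff: "\<Phi> \<in> hom2 (hom_2cat \<A> x y) \<alpha> \<beta> \<longleftrightarrow> src2 \<A> \<alpha> \<in> hom1 \<A> x y \<and> \<Phi> \<in> hom3 \<A> \<alpha> \<beta>"
  by (auto simp: hom2_iff hom_2cat_def hom3_def)

lemma hom2_src2: "\<alpha> \<in> hom2 S f g \<Longrightarrow> src2 S \<alpha> = f"
  by (simp add: hom2_iff)

definition underlying_map ::
  "('o, 'm, 't, 'o2, 'm2, 't2, 'r, 'r2) graymap \<Rightarrow> ('o, 'm, 't, 'o2, 'm2, 't2) cellmap" where
  "underlying_map F = \<lparr>map0 = map0 F, map1 = map1 F, map2 = map2 F\<rparr>"

lemma underlying_map_simps [simp]: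
  "map0 (underlying_map F) = map0 F" "map1 (underlying_map F) = map1 F" "map2 (underlying_map F) = map2 F"
  by (simp_all add: underlying_map_def)

lemma hom_map_simps [simp]:
  "map0 (hom_map F) = map1 F" "map1 (hom_map F) = map2 F" "map2 (hom_map F) = map3 F"
  by (simp_all add: hom_map_def)

context gray_category
begin

sublocale U: sesquicategory "underlying_sesquicat \<A>"
  rewrites "Cell0 (underlying_sesquicat \<A>) = Cell0 \<A>" and "Cell1 (underlying_sesquicat \<A>) = Cell1 \<A>"
    and "Cell2 (underlying_sesquicat \<A>) = Cell2 \<A>"
    and "src1 (underlying_sesquicat \<A>) = src1 \<A>" and "tgt1 (underlying_sesquicat \<A>) = tgt1 \<A>"
    and "id1 (underlying_sesquicat \<A>) = id1 \<A>" and "comp1 (underlying_sesquicat \<A>) = comp1 \<A>"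
    and "src2 (underlying_sesquicat \<A>) = src2 \<A>" and "tgt2 (underlying_sesquicat \<A>) = tgt2 \<A>"
    and "id2 (underlying_sesquicat \<A>) = id2 \<A>" and "comp2 (underlying_sesquicat \<A>) = comp2 \<A>"
    and "lwhisk (underlying_sesquicat \<A>) = lwhisk \<A>" and "rwhisk (underlying_sesquicat \<A>) = rwhisk \<A>"
    and "hom1 (underlying_sesquicat \<A>) = hom1 \<A>" and "hom2 (underlying_sesquicat \<A>) = hom2 \<A>"
  by (rule sesquicategory_underlying) simp_all

lemma hom3_parallel:
  assumes "f \<in> hom1 \<A> x y" "\<alpha> \<in> hom2 \<A> f g" "\<Phi> \<in> hom3 \<A> \<alpha> \<beta>"
  shows "\<beta> \<in> hom2 \<A> f g"
proof -
  interpret H: sesquicategory "hom_2cat \<A> x y" using hom_sesquicategory assms(1) .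
  have "\<Phi> \<in> Cell2 (hom_2cat \<A> x y)" using assms by (auto simp: hom_2cat_def hom3_def hom2_iff)
  then show ?thesis
    using H.tgt2_closed[of \<Phi>] H.globular_src[of \<Phi>] H.globular_tgt[of \<Phi>] assms
    by (auto simp: hom3_def hom2_iff hom_2cat_def)
qed

lemma id3_hom: "\<lbrakk>f \<in> hom1 \<A> x y; \<alpha> \<in> hom2 \<A> f g\<rbrakk> \<Longrightarrow> id3 \<A> \<alpha> \<in> hom3 \<A> \<alpha> \<alpha>"
  using sesquicategory.id2_hom[OF hom_sesquicategory, of f x y \<alpha>] hom2_Cell1
  by (auto simp: hom2_hom_2cat_iff)

lemma comp3_hom:
  "\<lbrakk>f \<in> hom1 \<A> x y; \<alpha> \<in> hom2 \<A> f g; \<Phi> \<in> hom3 \<A> \<alpha> \<beta>; \<Psi> \<in> hom3 \<A> \<beta> \<gamma>\<rbrakk>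
    \<Longrightarrow> comp3 \<A> \<Psi> \<Phi> \<in> hom3 \<A> \<alpha> \<gamma>"
  using sesquicategory.comp2_hom[OF hom_sesquicategory, of f x y \<Phi> \<alpha> \<beta> \<Psi> \<gamma>] hom3_parallel[of f x y \<alpha> g \<Phi> \<beta>]
  by (auto simp: hom2_hom_2cat_iff hom2_src2)

lemma lwhisk23_hom:
  "\<lbrakk>f \<in> hom1 \<A> x y; \<alpha> \<in> hom2 \<A> f g; \<Phi> \<in> hom3 \<A> \<alpha> \<alpha>'; \<beta> \<in> hom2 \<A> g h\<rbrakk>
    \<Longrightarrow> lwhisk23 \<A> \<beta> \<Phi> \<in> hom3 \<A> (\<beta> \<cdot> \<alpha>) (\<beta> \<cdot> \<alpha>')"
  using sesquicategory.lwhisk_hom[OF hom_sesquicategory, of f x y \<alpha> f g \<Phi> \<alpha>' \<beta> h] hom2_parallel[of f x y \<alpha> g]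
  by (simp add: hom2_hom_2cat_iff hom1_hom_2cat_iff hom2_src2)

lemma rwhisk23_hom:
  "\<lbrakk>f \<in> hom1 \<A> x y; \<alpha> \<in> hom2 \<A> f g; \<beta> \<in> hom2 \<A> g h; \<Psi> \<in> hom3 \<A> \<beta> \<beta>'\<rbrakk>
    \<Longrightarrow> rwhisk23 \<A> \<Psi> \<alpha> \<in> hom3 \<A> (\<beta> \<cdot> \<alpha>) (\<beta>' \<cdot> \<alpha>)"
  using sesquicategory.rwhisk_hom[OF hom_sesquicategory, of f x y \<alpha> f g \<beta> h \<Psi> \<beta>'] hom2_parallel[of f x y \<alpha> g]
  by (simp add: hom2_hom_2cat_iff hom1_hom_2cat_iff hom2_src2)

lemma lwhisk13_hom:
  "\<lbrakk>f \<in> hom1 \<A> x y; \<alpha> \<in> hom2 \<A> f f'; \<Phi> \<in> hom3 \<A> \<alpha> \<alpha>'; g \<in> hom1 \<A> y z\<rbrakk>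
    \<Longrightarrow> lwhisk13 \<A> g \<Phi> \<in> hom3 \<A> (g \<lhd> \<alpha>) (g \<lhd> \<alpha>')"
  using sesquifunctor.map2_hom[OF lwhisk_functor, of f x y g z \<Phi> \<alpha> \<alpha>']
  by (simp add: hom2_hom_2cat_iff hom2_src2)

lemma rwhisk13_hom:
  "\<lbrakk>f \<in> hom1 \<A> x y; g \<in> hom1 \<A> y z; \<beta> \<in> hom2 \<A> g g'; \<Psi> \<in> hom3 \<A> \<beta> \<beta>'\<rbrakk>
    \<Longrightarrow> rwhisk13 \<A> \<Psi> f \<in> hom3 \<A> (\<beta> \<rhd> f) (\<beta>' \<rhd> f)"
  using sesquifunctor.map2_hom[OF rwhisk_functor, of f x y g z \<Psi> \<beta> \<beta>']
  by (simp add: hom2_hom_2cat_iff hom2_src2)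

lemma interchanger_hom:
  "\<lbrakk>f \<in> hom1 \<A> x y; \<alpha> \<in> hom2 \<A> f f'; g \<in> hom1 \<A> y z; \<beta> \<in> hom2 \<A> g g'\<rbrakk>
    \<Longrightarrow> interchanger \<A> \<beta> \<alpha> \<in> hom3 \<A> ((g' \<lhd> \<alpha>) \<cdot> (\<beta> \<rhd> f)) ((\<beta> \<rhd> f') \<cdot> (g \<lhd> \<alpha>))"
  using gray_tensor_functor.\<Gamma>_hom[OF composition, of x y z \<beta> g g' \<alpha> f f'] ends_closed[of f x y] ends_closed[of g y z]
  by (simp add: hom2_hom_2cat_iff hom1_hom_2cat_iff)

end

text \<open>
  The conditions on 3-cells stated with explicit boundaries. This replaces the quantification over
  hom-2-categories in the definition, and separates the 3-cells from the underlying sesquifunctor.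
\<close>

lemma gray_functorI:
  assumes "gray_category \<A>" "gray_category \<B>"
    and "sesquifunctor (underlying_sesquicat \<A>) (underlying_sesquicat \<B>) (underlying_map F)"
    and hom: "\<And>x y f g \<alpha> \<beta> \<Phi>. \<lbrakk>f \<in> hom1 \<A> x y; \<alpha> \<in> hom2 \<A> f g; \<Phi> \<in> hom3 \<A> \<alpha> \<beta>\<rbrakk>
      \<Longrightarrow> map3 F \<Phi> \<in> hom3 \<B> (map2 F \<alpha>) (map2 F \<beta>)"
    and id: "\<And>x y f g \<alpha>. \<lbrakk>f \<in> hom1 \<A> x y; \<alpha> \<in> hom2 \<A> f g\<rbrakk> \<Longrightarrow> map3 F (id3 \<A> \<alpha>) = id3 \<B> (map2 F \<alpha>)"
    and comp: "\<And>x y f g \<alpha> \<beta> \<gamma> \<Phi> \<Psi>. \<lbrakk>f \<in> hom1 \<A> x y; \<alpha> \<in> hom2 \<A> f g; \<Phi> \<in> hom3 \<A> \<alpha> \<beta>; \<Psi> \<in> hom3 \<A> \<beta> \<gamma>\<rbrakk>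
      \<Longrightarrow> map3 F (comp3 \<A> \<Psi> \<Phi>) = comp3 \<B> (map3 F \<Psi>) (map3 F \<Phi>)"
    and l23: "\<And>x y f g h \<alpha> \<alpha>' \<beta> \<Phi>. \<lbrakk>f \<in> hom1 \<A> x y; \<alpha> \<in> hom2 \<A> f g; \<Phi> \<in> hom3 \<A> \<alpha> \<alpha>'; \<beta> \<in> hom2 \<A> g h\<rbrakk>
      \<Longrightarrow> map3 F (lwhisk23 \<A> \<beta> \<Phi>) = lwhisk23 \<B> (map2 F \<beta>) (map3 F \<Phi>)"
    and r23: "\<And>x y f g h \<alpha> \<beta> \<beta>' \<Psi>. \<lbrakk>f \<in> hom1 \<A> x y; \<alpha> \<in> hom2 \<A> f g; \<beta> \<in> hom2 \<A> g h; \<Psi> \<in> hom3 \<A> \<beta> \<beta>'\<rbrakk>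
      \<Longrightarrow> map3 F (rwhisk23 \<A> \<Psi> \<alpha>) = rwhisk23 \<B> (map3 F \<Psi>) (map2 F \<alpha>)"
    and l13: "\<And>x y z f f' g \<alpha> \<alpha>' \<Phi>. \<lbrakk>f \<in> hom1 \<A> x y; \<alpha> \<in> hom2 \<A> f f'; \<Phi> \<in> hom3 \<A> \<alpha> \<alpha>'; g \<in> hom1 \<A> y z\<rbrakk>
      \<Longrightarrow> map3 F (lwhisk13 \<A> g \<Phi>) = lwhisk13 \<B> (map1 F g) (map3 F \<Phi>)"
    and r13: "\<And>x y z f g g' \<beta> \<beta>' \<Psi>. \<lbrakk>f \<in> hom1 \<A> x y; g \<in> hom1 \<A> y z; \<beta> \<in> hom2 \<A> g g'; \<Psi> \<in> hom3 \<A> \<beta> \<beta>'\<rbrakk>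
      \<Longrightarrow> map3 F (rwhisk13 \<A> \<Psi> f) = rwhisk13 \<B> (map3 F \<Psi>) (map1 F f)"
    and int: "\<And>x y z f f' g g' \<alpha> \<beta>. \<lbrakk>f \<in> hom1 \<A> x y; \<alpha> \<in> hom2 \<A> f f'; g \<in> hom1 \<A> y z; \<beta> \<in> hom2 \<A> g g'\<rbrakk>
      \<Longrightarrow> map3 F (interchanger \<A> \<beta> \<alpha>) = interchanger \<B> (map2 F \<beta>) (map2 F \<alpha>)"
  shows "gray_functor \<A> \<B> F"
proof -
  interpret A: gray_category \<A> by fact
  interpret B: gray_category \<B> by fact
  interpret U: sesquifunctor "underlying_sesquicat \<A>" "underlying_sesquicat \<B>" "underlying_map F" by fact
  note U = U.map0_closed U.map1_hom U.map2_hom U.map1_id1 U.map1_comp1 U.map2_id2 U.map2_comp2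
    U.map2_lwhisk U.map2_rwhisk
  note U' = U[unfolded underlying_simps hom_underlying underlying_map_simps]
  have cell1: "\<alpha> \<in> Cell1 (hom_2cat \<A> x y) \<Longrightarrow> \<alpha> \<in> hom2 \<A> (src2 \<A> \<alpha>) (tgt2 \<A> \<alpha>) \<and> src2 \<A> \<alpha> \<in> hom1 \<A> x y" for \<alpha> x y
    by (simp add: Cell1_hom_2cat hom2_iff)
  have cell2: "\<exists>\<alpha> \<beta> f g. f \<in> hom1 \<A> x y \<and> \<alpha> \<in> hom2 \<A> f g \<and> \<Phi> \<in> hom3 \<A> \<alpha> \<beta>"
    if "\<Phi> \<in> Cell2 (hom_2cat \<A> x y)" for \<Phi> x y
    using that A.src3_closed by (auto simp: hom_2cat_def hom3_def hom2_iff)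
  show ?thesis
  proof (intro gray_functor.intro gray_functor_axioms.intro A.gray_category_axioms B.gray_category_axioms, goal_cases)
    case 1 then show ?case by (rule U')
  next
    case (2 x y)
    interpret HA: two_category "hom_2cat \<A> x y" using A.hom_two_category 2 by blast
    interpret HB: two_category "hom_2cat \<B> (map0 F x) (map0 F y)" using B.hom_two_category 2 U'(1) by blast
    show ?case
    proof (intro sesquifunctor.intro sesquifunctor_axioms.intro HA.sesquicategory_axioms HB.sesquicategory_axioms,
        unfold hom_map_simps hom_2cat_simps hom1_hom_2cat_iff hom2_hom_2cat_iff, goal_cases)
      case 1 then show ?case by (rule U')
    next
      case (2 \<alpha> f g) then show ?case using U'(2)[of f x y] U'(3)[of \<alpha> f g] by blast
    next
      case (3 \<Phi> \<alpha> \<beta>)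
      then have \<alpha>: "\<alpha> \<in> hom2 \<A> (src2 \<A> \<alpha>) (tgt2 \<A> \<alpha>)" using A.src3_closed[of \<Phi>] by (auto simp: hom2_iff hom3_def)
      then show ?case
        using 3 hom[OF _ \<alpha>, of x y \<Phi> \<beta>] U'(2)[of "src2 \<A> \<alpha>" x y] hom2_src2[OF U'(3)[OF \<alpha>]] by simp
    next
      case (4 x) then show ?case using U'(6) by (simp add: hom1_iff)
    next
      case (5 \<alpha> f g \<beta> h) then show ?case using U'(7)[of \<alpha> f g \<beta> h] by blast
    next
      case (6 \<alpha>) then show ?case using id[of "src2 \<A> \<alpha>" x y \<alpha> "tgt2 \<A> \<alpha>"] cell1[of \<alpha> x y] by blast
    next
      case (7 \<Phi> \<alpha> \<beta> \<Psi> \<gamma>)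
      then have \<alpha>: "\<alpha> \<in> hom2 \<A> (src2 \<A> \<alpha>) (tgt2 \<A> \<alpha>)" using A.src3_closed[of \<Phi>] by (auto simp: hom2_iff hom3_def)
      then show ?case using comp[OF _ \<alpha>, of x y \<Phi> \<beta> \<Psi> \<gamma>] 7 by blast
    next
      case (8 \<alpha> f g \<Phi> \<alpha>' \<beta> h) then show ?case using l23[of f x y \<alpha> g \<Phi> \<alpha>' \<beta> h] by (simp add: hom2_src2)
    next
      case (9 \<alpha> f g \<beta> h \<Psi> \<beta>') then show ?case using r23[of f x y \<alpha> g \<beta> h \<Psi> \<beta>'] by (simp add: hom2_src2)
    qed
  next
    case 3 then show ?case by (rule U')
  next
    case 4 then show ?case by (rule U')
  next
    case (5 f x y \<beta> z) then show ?case
      using U'(9)[of f x y "src2 \<A> \<beta>" z \<beta> "tgt2 \<A> \<beta>"] cell1[of \<beta> y z] by blast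
  next
    case (6 \<alpha> x y g z) then show ?case
      using U'(8)[of "src2 \<A> \<alpha>" x y \<alpha> "tgt2 \<A> \<alpha>" g z] cell1[of \<alpha> x y] by blast
  next
    case (7 f x y \<Psi> z) then show ?case using cell2[of \<Psi> y z] r13[OF 7(1), of _ z _ _ \<Psi>] by blast
  next
    case (8 \<Phi> x y g z) then show ?case using cell2[of \<Phi> x y] l13[of _ x y _ _ \<Phi> _ g z] by blast
  next
    case (9 \<alpha> x y \<beta> z) then show ?case
      using int[of "src2 \<A> \<alpha>" x y \<alpha> "tgt2 \<A> \<alpha>" "src2 \<A> \<beta>" z \<beta> "tgt2 \<A> \<beta>"] cell1[of \<alpha> x y] cell1[of \<beta> y z]
      by blast
  qed
qed

context gray_functor
begin

lemma underlying_sesquifunctor: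
  "sesquifunctor (underlying_sesquicat \<A>) (underlying_sesquicat \<B>) (underlying_map F)"
proof -
  interpret SA: sesquicategory "underlying_sesquicat \<A>" by (rule A.sesquicategory_underlying)
  interpret SB: sesquicategory "underlying_sesquicat \<B>" by (rule B.sesquicategory_underlying)
  have hf: "sesquifunctor (hom_2cat \<A> x y) (hom_2cat \<B> (map0 F x) (map0 F y)) (hom_map F)"
    if "f \<in> hom1 \<A> x y" for f x y
    using hom_functor A.ends_closed[OF that] by blast
  note M = sesquifunctor.map0_closed[OF hf] sesquifunctor.map1_hom[OF hf] sesquifunctor.map1_id1[OF hf]
    sesquifunctor.map1_comp1[OF hf]
  note M' = M[unfolded hom_2cat_simps hom_map_simps hom1_hom_2cat_iff]
  have f: "f \<in> Cell1 \<A> \<Longrightarrow> f \<in> hom1 \<A> (src1 \<A> f) (tgt1 \<A> f)" for f by (simp add: hom1_iff)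
  have src: "\<alpha> \<in> hom2 \<A> f g \<Longrightarrow> f \<in> Cell1 \<A>" for \<alpha> f g using A.src2_closed by (auto simp: hom2_iff)
  show ?thesis
  proof (unfold_locales, unfold underlying_simps hom_underlying underlying_map_simps, goal_cases)
    case 1 then show ?case by (rule map0_closed)
  next
    case 2 then show ?case by (intro M'(1))
  next
    case (3 \<alpha> f g) then show ?case using M'(2)[OF f[OF src[OF 3]], of f \<alpha> g] f[OF src[OF 3]] by blast
  next
    case 4 then show ?case by (rule map_unit)
  next
    case 5 then show ?case by (rule map_comp1)
  next
    case 6 then show ?case by (intro M'(3)[OF f f])
  next
    case (7 \<alpha> f g \<beta> h)
    note f' = f[OF src[OF 7(1)]]
    show ?case using M'(4)[OF f', of f \<alpha> g \<beta> h] f' 7 A.hom2_parallel[OF f' 7(1)] by blast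
  next
    case 8 then show ?case by (intro map_lwhisk A.hom2_Cell1)
  next
    case 9 then show ?case by (intro map_rwhisk A.hom2_Cell1)
  qed
qed

sublocale U: sesquifunctor "underlying_sesquicat \<A>" "underlying_sesquicat \<B>" "underlying_map F"
  by (rule underlying_sesquifunctor)

lemma hom_functor': "f \<in> hom1 \<A> x y \<Longrightarrow> sesquifunctor (hom_2cat \<A> x y) (hom_2cat \<B> (map0 F x) (map0 F y)) (hom_map F)"
  using hom_functor A.ends_closed by blast

lemma map3_hom:
  "\<lbrakk>f \<in> hom1 \<A> x y; \<alpha> \<in> hom2 \<A> f g; \<Phi> \<in> hom3 \<A> \<alpha> \<beta>\<rbrakk> \<Longrightarrow> map3 F \<Phi> \<in> hom3 \<B> (map2 F \<alpha>) (map2 F \<beta>)"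
  using sesquifunctor.map2_hom[OF hom_functor', of f x y \<Phi> \<alpha> \<beta>] by (simp add: hom2_hom_2cat_iff hom2_src2)

lemma map3_id3: "\<lbrakk>f \<in> hom1 \<A> x y; \<alpha> \<in> hom2 \<A> f g\<rbrakk> \<Longrightarrow> map3 F (id3 \<A> \<alpha>) = id3 \<B> (map2 F \<alpha>)"
  using sesquifunctor.map2_id2[OF hom_functor', of f x y \<alpha>] A.hom2_Cell1 by simp

lemma map3_comp3:
  "\<lbrakk>f \<in> hom1 \<A> x y; \<alpha> \<in> hom2 \<A> f g; \<Phi> \<in> hom3 \<A> \<alpha> \<beta>; \<Psi> \<in> hom3 \<A> \<beta> \<gamma>\<rbrakk>
    \<Longrightarrow> map3 F (comp3 \<A> \<Psi> \<Phi>) = comp3 \<B> (map3 F \<Psi>) (map3 F \<Phi>)"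
  using sesquifunctor.map2_comp2[OF hom_functor', of f x y \<Phi> \<alpha> \<beta> \<Psi> \<gamma>] A.hom3_parallel[of f x y \<alpha> g \<Phi> \<beta>]
  by (simp add: hom2_hom_2cat_iff hom2_src2)

lemma map3_lwhisk23:
  "\<lbrakk>f \<in> hom1 \<A> x y; \<alpha> \<in> hom2 \<A> f g; \<Phi> \<in> hom3 \<A> \<alpha> \<alpha>'; \<beta> \<in> hom2 \<A> g h\<rbrakk>
    \<Longrightarrow> map3 F (lwhisk23 \<A> \<beta> \<Phi>) = lwhisk23 \<B> (map2 F \<beta>) (map3 F \<Phi>)"
  using sesquifunctor.map2_lwhisk[OF hom_functor', of f x y \<alpha> f g \<Phi> \<alpha>' \<beta> h] A.hom2_parallel[of f x y \<alpha> g]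
  by (simp add: hom2_hom_2cat_iff hom1_hom_2cat_iff hom2_src2)

lemma map3_rwhisk23:
  "\<lbrakk>f \<in> hom1 \<A> x y; \<alpha> \<in> hom2 \<A> f g; \<beta> \<in> hom2 \<A> g h; \<Psi> \<in> hom3 \<A> \<beta> \<beta>'\<rbrakk>
    \<Longrightarrow> map3 F (rwhisk23 \<A> \<Psi> \<alpha>) = rwhisk23 \<B> (map3 F \<Psi>) (map2 F \<alpha>)"
  using sesquifunctor.map2_rwhisk[OF hom_functor', of f x y \<alpha> f g \<beta> h \<Psi> \<beta>'] A.hom2_parallel[of f x y \<alpha> g]
  by (simp add: hom2_hom_2cat_iff hom1_hom_2cat_iff hom2_src2)

lemma map3_lwhisk13:
  "\<lbrakk>f \<in> hom1 \<A> x y; \<alpha> \<in> hom2 \<A> f f'; \<Phi> \<in> hom3 \<A> \<alpha> \<alpha>'; g \<in> hom1 \<A> y z\<rbrakk>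
    \<Longrightarrow> map3 F (lwhisk13 \<A> g \<Phi>) = lwhisk13 \<B> (map1 F g) (map3 F \<Phi>)"
  using map_lwhisk13[of \<Phi> x y g z] by (simp add: hom_2cat_def hom3_def hom2_iff)

lemma map3_rwhisk13:
  "\<lbrakk>f \<in> hom1 \<A> x y; g \<in> hom1 \<A> y z; \<beta> \<in> hom2 \<A> g g'; \<Psi> \<in> hom3 \<A> \<beta> \<beta>'\<rbrakk>
    \<Longrightarrow> map3 F (rwhisk13 \<A> \<Psi> f) = rwhisk13 \<B> (map3 F \<Psi>) (map1 F f)"
  using map_rwhisk13[of f x y \<Psi> z] by (simp add: hom_2cat_def hom3_def hom2_iff)

lemma map3_interchanger:
  "\<lbrakk>f \<in> hom1 \<A> x y; \<alpha> \<in> hom2 \<A> f f'; g \<in> hom1 \<A> y z; \<beta> \<in> hom2 \<A> g g'\<rbrakk>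
    \<Longrightarrow> map3 F (interchanger \<A> \<beta> \<alpha>) = interchanger \<B> (map2 F \<beta>) (map2 F \<alpha>)"
  using map_interchanger[of \<alpha> x y \<beta> z] A.hom2_Cell1 by blast

end

definition fully_faithful_on_3cells where
  "fully_faithful_on_3cells \<X> \<Y> p \<longleftrightarrow>
    (\<forall>x y. \<forall>f\<in>hom1 \<X> x y. \<forall>g. \<forall>\<alpha>\<in>hom2 \<X> f g. \<forall>\<beta>\<in>hom2 \<X> f g.
      bij_betw (map3 p) (hom3 \<X> \<alpha> \<beta>) (hom3 \<Y> (map2 p \<alpha>) (map2 p \<beta>)))"

text \<open>
  The value of \<open>D\<close> on a 3-cell is forced: it has the boundary prescribed by \<open>d\<close> and the image
  prescribed by \<open>v\<close>. Every equation required of \<open>D\<close> compares two parallel 3-cells of \<open>X\<close> with the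
  same image in \<open>Y\<close>, so it follows from the corresponding equation for \<open>v\<close> and \<open>p\<close>.
\<close>

theorem gray_functor_lift:
  assumes "gray_functor \<X> \<Y> p" and ff: "fully_faithful_on_3cells \<X> \<Y> p"
    and "gray_functor \<A> \<Y> v"
    and "sesquifunctor (underlying_sesquicat \<A>) (underlying_sesquicat \<X>) d"
    and pd: "\<And>\<alpha>. \<alpha> \<in> Cell2 \<A> \<Longrightarrow> map2 p (map2 d \<alpha>) = map2 v \<alpha>"
      "\<And>f. f \<in> Cell1 \<A> \<Longrightarrow> map1 p (map1 d f) = map1 v f"
  obtains D where "gray_functor \<A> \<X> D" "underlying_map D = d"
    "\<And>\<Phi>. \<Phi> \<in> Cell3 \<A> \<Longrightarrow> map3 p (map3 D \<Phi>) = map3 v \<Phi>"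
proof -
  interpret p: gray_functor \<X> \<Y> p by fact
  interpret v: gray_functor \<A> \<Y> v by fact
  interpret d: sesquifunctor "underlying_sesquicat \<A>" "underlying_sesquicat \<X>" d by fact
  note d1 = d.map1_hom[unfolded underlying_simps hom_underlying]
    and d2 = d.map2_hom[unfolded underlying_simps hom_underlying]
  note dp = d.map1_comp1[unfolded underlying_simps hom_underlying] d.map2_comp2[unfolded underlying_simps hom_underlying]
    d.map2_lwhisk[unfolded underlying_simps hom_underlying] d.map2_rwhisk[unfolded underlying_simps hom_underlying]
  have pd2: "map2 p (map2 d \<alpha>) = map2 v \<alpha>" if "\<alpha> \<in> hom2 \<A> f g" for \<alpha> f g
    using that pd by (simp add: hom2_iff)
  have pd1: "map1 p (map1 d f) = map1 v f" if "f \<in> hom1 \<A> x y" for f x y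
    using that pd by (simp add: hom1_iff)
  define D3 where "D3 \<Phi> = (SOME \<Psi>. \<Psi> \<in> hom3 \<X> (map2 d (src3 \<A> \<Phi>)) (map2 d (tgt3 \<A> \<Phi>)) \<and> map3 p \<Psi> = map3 v \<Phi>)" for \<Phi>
  define D where "D = \<lparr>map0 = map0 d, map1 = map1 d, map2 = map2 d, map3 = D3\<rparr>"
  have D3: "D3 \<Phi> \<in> hom3 \<X> (map2 d \<alpha>) (map2 d \<beta>)" "map3 p (D3 \<Phi>) = map3 v \<Phi>"
    if "f \<in> hom1 \<A> x y" "\<alpha> \<in> hom2 \<A> f g" "\<Phi> \<in> hom3 \<A> \<alpha> \<beta>" for x y f g \<alpha> \<beta> \<Phi>
  proof -
    note \<beta> = v.A.hom3_parallel[OF that]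
    have "map3 v \<Phi> \<in> hom3 \<Y> (map2 p (map2 d \<alpha>)) (map2 p (map2 d \<beta>))"
      using v.map3_hom[OF that] pd2[OF that(2)] pd2[OF \<beta>] by simp
    moreover have "bij_betw (map3 p) (hom3 \<X> (map2 d \<alpha>) (map2 d \<beta>)) (hom3 \<Y> (map2 p (map2 d \<alpha>)) (map2 p (map2 d \<beta>)))"
      using ff d1[OF that(1)] d2[OF that(2)] d2[OF \<beta>] unfolding fully_faithful_on_3cells_def by blast
    ultimately have "\<exists>\<Psi>. \<Psi> \<in> hom3 \<X> (map2 d \<alpha>) (map2 d \<beta>) \<and> map3 p \<Psi> = map3 v \<Phi>"
      unfolding bij_betw_def by (metis imageE)
    then have "D3 \<Phi> \<in> hom3 \<X> (map2 d \<alpha>) (map2 d \<beta>) \<and> map3 p (D3 \<Phi>) = map3 v \<Phi>"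
      using someI_ex[of "\<lambda>\<Psi>. \<Psi> \<in> hom3 \<X> (map2 d \<alpha>) (map2 d \<beta>) \<and> map3 p \<Psi> = map3 v \<Phi>"] that(3)
      by (simp add: D3_def hom3_def)
    then show "D3 \<Phi> \<in> hom3 \<X> (map2 d \<alpha>) (map2 d \<beta>)" "map3 p (D3 \<Phi>) = map3 v \<Phi>" by auto
  qed
  have eqI: "\<Phi> = \<Psi>" if "f \<in> hom1 \<X> x y" "\<alpha> \<in> hom2 \<X> f g" "\<Phi> \<in> hom3 \<X> \<alpha> \<beta>" "\<Psi> \<in> hom3 \<X> \<alpha> \<beta>"
    "map3 p \<Phi> = map3 p \<Psi>" for x y f g \<alpha> \<beta> \<Phi> \<Psi>
  proof -
    have "inj_on (map3 p) (hom3 \<X> \<alpha> \<beta>)"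
      using ff p.A.hom3_parallel[OF that(1-3)] that(1,2) unfolding fully_faithful_on_3cells_def bij_betw_def by blast
    then show ?thesis using that by (auto dest: inj_onD)
  qed
  have Dsimps: "map0 D = map0 d" "map1 D = map1 d" "map2 D = map2 d" "map3 D = D3" by (simp_all add: D_def)
  have U: "underlying_map D = d" by (simp add: underlying_map_def D_def)
  have "gray_functor \<A> \<X> D"
  proof (rule gray_functorI, unfold Dsimps U, goal_cases)
    case 1 show ?case by (rule v.A.gray_category_axioms)
  next
    case 2 show ?case by (rule p.A.gray_category_axioms)
  next
    case 3 show ?case by fact
  next
    case 4 then show ?case by (rule D3)
  next
    case (5 x y f g \<alpha>)
    note i = v.A.id3_hom[OF 5]
    show ?case
      by (rule eqI[OF d1[OF 5(1)] d2[OF 5(2)] D3(1)[OF 5 i] p.A.id3_hom[OF d1[OF 5(1)] d2[OF 5(2)]]])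
        (simp add: D3(2)[OF 5 i] v.map3_id3[OF 5] p.map3_id3[OF d1[OF 5(1)] d2[OF 5(2)]] pd2[OF 5(2)])
  next
    case (6 x y f g \<alpha> \<beta> \<gamma> \<Phi> \<Psi>)
    note t = d1[OF 6(1)] d2[OF 6(2)] and \<Phi> = D3[OF 6(1-3)] and \<Psi> = D3[OF 6(1) v.A.hom3_parallel[OF 6(1-3)] 6(4)]
    note i = D3[OF 6(1,2) v.A.comp3_hom[OF 6]]
    show ?case
      by (rule eqI[OF t i(1) p.A.comp3_hom[OF t \<Phi>(1) \<Psi>(1)]])
        (simp add: i(2) v.map3_comp3[OF 6] p.map3_comp3[OF t \<Phi>(1) \<Psi>(1)] \<Phi>(2) \<Psi>(2))
  next
    case (7 x y f g h \<alpha> \<alpha>' \<beta> \<Phi>)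
    note t = d1[OF 7(1)] d2[OF 7(2)] and \<Phi> = D3[OF 7(1-3)] and \<alpha>' = v.A.hom3_parallel[OF 7(1-3)]
    note i = D3[OF 7(1) v.A.U.comp2_hom[OF 7(2,4)] v.A.lwhisk23_hom[OF 7]]
    note e = dp(2)[OF 7(2,4)] dp(2)[OF \<alpha>' 7(4)]
    show ?case
      by (rule eqI[OF t(1) p.A.U.comp2_hom[OF t(2) d2[OF 7(4)]] i(1)[unfolded e] p.A.lwhisk23_hom[OF t \<Phi>(1) d2[OF 7(4)]]])
        (simp add: i(2) v.map3_lwhisk23[OF 7] p.map3_lwhisk23[OF t \<Phi>(1) d2[OF 7(4)]] \<Phi>(2) pd2[OF 7(4)])
  next
    case (8 x y f g h \<alpha> \<beta> \<beta>' \<Psi>)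
    note g = v.A.hom2_parallel[OF 8(1,2)]
    note t = d1[OF 8(1)] d2[OF 8(2)] d2[OF 8(3)] and \<Psi> = D3[OF g 8(3,4)] and \<beta>' = v.A.hom3_parallel[OF g 8(3,4)]
    note i = D3[OF 8(1) v.A.U.comp2_hom[OF 8(2,3)] v.A.rwhisk23_hom[OF 8]]
    note e = dp(2)[OF 8(2,3)] dp(2)[OF 8(2) \<beta>']
    show ?case
      by (rule eqI[OF t(1) p.A.U.comp2_hom[OF t(2,3)] i(1)[unfolded e] p.A.rwhisk23_hom[OF t \<Psi>(1)]])
        (simp add: i(2) v.map3_rwhisk23[OF 8] p.map3_rwhisk23[OF t \<Psi>(1)] \<Psi>(2) pd2[OF 8(2)])
  next
    case (9 x y z f f' g \<alpha> \<alpha>' \<Phi>)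
    note t = d1[OF 9(1)] d2[OF 9(2)] and \<Phi> = D3[OF 9(1-3)] and \<alpha>' = v.A.hom3_parallel[OF 9(1-3)]
      and g = d1[OF 9(4)]
    note i = D3[OF v.A.U.comp1_hom[OF 9(1,4)] v.A.U.lwhisk_hom[OF 9(1,2,4)] v.A.lwhisk13_hom[OF 9]]
    note e = dp(3)[OF 9(1,2,4)] dp(3)[OF 9(1) \<alpha>' 9(4)]
    show ?case
      by (rule eqI[OF p.A.U.comp1_hom[OF t(1) g] p.A.U.lwhisk_hom[OF t g] i(1)[unfolded e] p.A.lwhisk13_hom[OF t \<Phi>(1) g]])
        (simp add: i(2) v.map3_lwhisk13[OF 9] p.map3_lwhisk13[OF t \<Phi>(1) g] \<Phi>(2) pd1[OF 9(4)])
  next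
    case (10 x y z f g g' \<beta> \<beta>' \<Psi>)
    note t = d1[OF 10(1)] d1[OF 10(2)] d2[OF 10(3)] and \<Psi> = D3[OF 10(2-4)] and \<beta>' = v.A.hom3_parallel[OF 10(2-4)]
    note i = D3[OF v.A.U.comp1_hom[OF 10(1,2)] v.A.U.rwhisk_hom[OF 10(1-3)] v.A.rwhisk13_hom[OF 10]]
    note e = dp(4)[OF 10(1-3)] dp(4)[OF 10(1,2) \<beta>']
    show ?case
      by (rule eqI[OF p.A.U.comp1_hom[OF t(1,2)] p.A.U.rwhisk_hom[OF t] i(1)[unfolded e] p.A.rwhisk13_hom[OF t \<Psi>(1)]])
        (simp add: i(2) v.map3_rwhisk13[OF 10] p.map3_rwhisk13[OF t \<Psi>(1)] \<Psi>(2) pd1[OF 10(1)])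
  next
    case (11 x y z f f' g g' \<alpha> \<beta>)
    note t = d1[OF 11(1)] d2[OF 11(2)] d1[OF 11(3)] d2[OF 11(4)]
    note f' = v.A.hom2_parallel[OF 11(1,2)] and g' = v.A.hom2_parallel[OF 11(3,4)]
    note s = v.A.U.rwhisk_hom[OF 11(1,3,4)] v.A.U.lwhisk_hom[OF 11(1,2) g']
    note s' = v.A.U.lwhisk_hom[OF 11(1-3)] v.A.U.rwhisk_hom[OF f' 11(3,4)]
    note i = D3[OF v.A.U.comp1_hom[OF 11(1,3)] v.A.U.comp2_hom[OF s] v.A.interchanger_hom[OF 11]]
    note e = dp(2)[OF s] dp(2)[OF s'] dp(4)[OF 11(1,3,4)] dp(3)[OF 11(1,2) g'] dp(3)[OF 11(1-3)] dp(4)[OF f' 11(3,4)]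
    show ?case
      by (rule eqI[OF p.A.U.comp1_hom[OF t(1,3)]
            p.A.U.comp2_hom[OF p.A.U.rwhisk_hom[OF t(1,3,4)] p.A.U.lwhisk_hom[OF t(1,2) d1[OF g']]]
            i(1)[unfolded e] p.A.interchanger_hom[OF t]])
        (simp add: i(2) v.map3_interchanger[OF 11] p.map3_interchanger[OF t] pd2[OF 11(2)] pd2[OF 11(4)])
  qed
  moreover have "map3 p (map3 D \<Phi>) = map3 v \<Phi>" if "\<Phi> \<in> Cell3 \<A>" for \<Phi>
    unfolding Dsimps
    by (rule D3(2)[of "src2 \<A> (src3 \<A> \<Phi>)" "src1 \<A> (src2 \<A> (src3 \<A> \<Phi>))" "tgt1 \<A> (src2 \<A> (src3 \<A> \<Phi>))"
          "src3 \<A> \<Phi>" "tgt2 \<A> (src3 \<A> \<Phi>)" _ "tgt3 \<A> \<Phi>"])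
      (use that v.A.src3_closed[OF that] v.A.src2_closed in \<open>auto simp: hom1_iff hom2_iff hom3_def\<close>)
  ultimately show ?thesis using that U by blast
qed

section \<open>Pulling back 3-cells along a sesquifunctor\<close>

text \<open>
  The Gray-category with underlying sesquicategory \<open>T\<close> in which a 3-cell \<open>\<alpha> \<rightarrow> \<beta>\<close> is a 3-cell
  \<open>F \<alpha> \<rightarrow> F \<beta>\<close> of \<open>\<B>\<close>. Since \<open>F\<close> need not be injective, a 3-cell has to remember its boundary. The
  injection \<open>enc\<close> codes the resulting triples in a prescribed type, so that all cells can be taken
  from one universe.
\<close>

locale gray_pullback = B: gray_category \<B> + T: sesquicategory T + F: sesquifunctor T "underlying_sesquicat \<B>" F
  for \<B> :: "('o, 'm, 't, 'r) gray" and T :: "('o2, 'm2, 't2) sesquicat" (structure)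
    and F :: "('o2, 'm2, 't2, 'o, 'm, 't) cellmap" +
  fixes enc :: "'t2 \<times> 'r \<times> 't2 \<Rightarrow> 'r2"
  assumes inj_enc: "inj enc"
begin

definition "dom3 \<Phi> = fst (inv enc \<Phi>)"
definition "image3 \<Phi> = fst (snd (inv enc \<Phi>))"
definition "cod3 \<Phi> = snd (snd (inv enc \<Phi>))"

lemma enc_simps [simp]:
  "dom3 (enc (\<alpha>, \<Phi>, \<beta>)) = \<alpha>" "image3 (enc (\<alpha>, \<Phi>, \<beta>)) = \<Phi>" "cod3 (enc (\<alpha>, \<Phi>, \<beta>)) = \<beta>"
  by (simp_all add: dom3_def image3_def cod3_def inv_f_f inj_enc)

lemma enc_eq_iff [simp]: "enc p = enc q \<longleftrightarrow> p = q"
  using inj_enc by (rule inj_eq)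

definition pb :: "('o2, 'm2, 't2, 'r2) gray" where
  "pb = \<lparr>Cell0 = Cell0 T, Cell1 = Cell1 T, Cell2 = Cell2 T, src1 = src1 T, tgt1 = tgt1 T,
    id1 = id1 T, comp1 = comp1 T, src2 = src2 T, tgt2 = tgt2 T, id2 = id2 T, comp2 = comp2 T,
    lwhisk = lwhisk T, rwhisk = rwhisk T,
    Cell3 = {enc (\<alpha>, \<Phi>, \<beta>) | \<alpha> \<Phi> \<beta>. \<exists>f g. \<alpha> \<in> hom2 T f g \<and> \<beta> \<in> hom2 T f g \<and> \<Phi> \<in> hom3 \<B> (map2 F \<alpha>) (map2 F \<beta>)},
    src3 = dom3, tgt3 = cod3, id3 = \<lambda>\<alpha>. enc (\<alpha>, id3 \<B> (map2 F \<alpha>), \<alpha>),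
    comp3 = \<lambda>\<Psi> \<Phi>. enc (dom3 \<Phi>, comp3 \<B> (image3 \<Psi>) (image3 \<Phi>), cod3 \<Psi>),
    lwhisk23 = \<lambda>\<beta> \<Phi>. enc (\<beta> \<cdot> dom3 \<Phi>, lwhisk23 \<B> (map2 F \<beta>) (image3 \<Phi>), \<beta> \<cdot> cod3 \<Phi>),
    rwhisk23 = \<lambda>\<Psi> \<alpha>. enc (dom3 \<Psi> \<cdot> \<alpha>, rwhisk23 \<B> (image3 \<Psi>) (map2 F \<alpha>), cod3 \<Psi> \<cdot> \<alpha>),
    lwhisk13 = \<lambda>g \<Phi>. enc (g \<lhd> dom3 \<Phi>, lwhisk13 \<B> (map1 F g) (image3 \<Phi>), g \<lhd> cod3 \<Phi>),
    rwhisk13 = \<lambda>\<Psi> f. enc (dom3 \<Psi> \<rhd> f, rwhisk13 \<B> (image3 \<Psi>) (map1 F f), cod3 \<Psi> \<rhd> f),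
    interchanger = \<lambda>\<beta> \<alpha>. enc ((tgt2 T \<beta> \<lhd> \<alpha>) \<cdot> (\<beta> \<rhd> src2 T \<alpha>),
      interchanger \<B> (map2 F \<beta>) (map2 F \<alpha>), (\<beta> \<rhd> tgt2 T \<alpha>) \<cdot> (src2 T \<beta> \<lhd> \<alpha>))\<rparr>"

lemma pb_simps [simp]:
  "Cell0 pb = Cell0 T" "Cell1 pb = Cell1 T" "Cell2 pb = Cell2 T" "src1 pb = src1 T" "tgt1 pb = tgt1 T"
  "id1 pb = id1 T" "comp1 pb = comp1 T" "src2 pb = src2 T" "tgt2 pb = tgt2 T" "id2 pb = id2 T"
  "comp2 pb = comp2 T" "lwhisk pb = lwhisk T" "rwhisk pb = rwhisk T" "src3 pb = dom3" "tgt3 pb = cod3"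
  "id3 pb \<alpha> = enc (\<alpha>, id3 \<B> (map2 F \<alpha>), \<alpha>)"
  "comp3 pb \<Psi> \<Phi> = enc (dom3 \<Phi>, comp3 \<B> (image3 \<Psi>) (image3 \<Phi>), cod3 \<Psi>)"
  "lwhisk23 pb \<beta> \<Phi> = enc (\<beta> \<cdot> dom3 \<Phi>, lwhisk23 \<B> (map2 F \<beta>) (image3 \<Phi>), \<beta> \<cdot> cod3 \<Phi>)"
  "rwhisk23 pb \<Psi> \<alpha> = enc (dom3 \<Psi> \<cdot> \<alpha>, rwhisk23 \<B> (image3 \<Psi>) (map2 F \<alpha>), cod3 \<Psi> \<cdot> \<alpha>)"
  "lwhisk13 pb g \<Phi> = enc (g \<lhd> dom3 \<Phi>, lwhisk13 \<B> (map1 F g) (image3 \<Phi>), g \<lhd> cod3 \<Phi>)"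
  "rwhisk13 pb \<Psi> f = enc (dom3 \<Psi> \<rhd> f, rwhisk13 \<B> (image3 \<Psi>) (map1 F f), cod3 \<Psi> \<rhd> f)"
  "interchanger pb \<beta> \<alpha> = enc ((tgt2 T \<beta> \<lhd> \<alpha>) \<cdot> (\<beta> \<rhd> src2 T \<alpha>),
      interchanger \<B> (map2 F \<beta>) (map2 F \<alpha>), (\<beta> \<rhd> tgt2 T \<alpha>) \<cdot> (src2 T \<beta> \<lhd> \<alpha>))"
  by (simp_all add: pb_def)

lemma pb_homs [simp]: "hom1 pb = hom1 T" "hom2 pb = hom2 T"
  by (simp_all add: fun_eq_iff hom1_def hom2_def)

lemma underlying_pb: "underlying_sesquicat pb = T"
  by (simp add: underlying_sesquicat_def sesquicat.truncate_def)

lemma Cell3_pb: "\<Phi> \<in> Cell3 pb \<longleftrightarrow> (\<exists>\<alpha> \<Psi> \<beta> f g. \<Phi> = enc (\<alpha>, \<Psi>, \<beta>) \<and>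
    \<alpha> \<in> hom2 T f g \<and> \<beta> \<in> hom2 T f g \<and> \<Psi> \<in> hom3 \<B> (map2 F \<alpha>) (map2 F \<beta>))"
  by (auto simp: pb_def)

lemma hom3_pbI [intro]:
  "\<lbrakk>\<alpha> \<in> hom2 T f g; \<beta> \<in> hom2 T f g; \<Phi> \<in> hom3 \<B> (map2 F \<alpha>) (map2 F \<beta>)\<rbrakk> \<Longrightarrow> enc (\<alpha>, \<Phi>, \<beta>) \<in> hom3 pb \<alpha> \<beta>"
  by (auto simp: hom3_def[of pb] Cell3_pb)

lemma hom3_pbD:
  assumes "\<Phi> \<in> hom3 pb \<alpha> \<beta>"
  shows "dom3 \<Phi> = \<alpha>" "cod3 \<Phi> = \<beta>" "\<Phi> = enc (\<alpha>, image3 \<Phi>, \<beta>)"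
    "image3 \<Phi> \<in> hom3 \<B> (map2 F \<alpha>) (map2 F \<beta>)" "\<alpha> \<in> hom2 T f g \<Longrightarrow> \<beta> \<in> hom2 T f g"
    "\<exists>f g. \<alpha> \<in> hom2 T f g \<and> \<beta> \<in> hom2 T f g"
proof -
  obtain \<Psi> f' g' where *: "\<Phi> = enc (\<alpha>, \<Psi>, \<beta>)" "\<alpha> \<in> hom2 T f' g'" "\<beta> \<in> hom2 T f' g'"
      "\<Psi> \<in> hom3 \<B> (map2 F \<alpha>) (map2 F \<beta>)"
    using assms by (auto simp: hom3_def[of pb] Cell3_pb)
  then show "dom3 \<Phi> = \<alpha>" "cod3 \<Phi> = \<beta>" "\<Phi> = enc (\<alpha>, image3 \<Phi>, \<beta>)"
    "image3 \<Phi> \<in> hom3 \<B> (map2 F \<alpha>) (map2 F \<beta>)" by simp_all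
  show "\<alpha> \<in> hom2 T f g \<Longrightarrow> \<beta> \<in> hom2 T f g" using *(2,3) by (simp add: hom2_iff)
  show "\<exists>f g. \<alpha> \<in> hom2 T f g \<and> \<beta> \<in> hom2 T f g" using * by blast
qed

lemmas F_hom = F.map1_hom[unfolded underlying_simps hom_underlying] F.map2_hom[unfolded underlying_simps hom_underlying]
lemmas F_ops = F.map1_id1[unfolded underlying_simps hom_underlying] F.map1_comp1[unfolded underlying_simps hom_underlying]
  F.map2_id2[unfolded underlying_simps hom_underlying] F.map2_comp2[unfolded underlying_simps hom_underlying]
  F.map2_lwhisk[unfolded underlying_simps hom_underlying] F.map2_rwhisk[unfolded underlying_simps hom_underlying]

lemma image_hom1: "\<alpha> \<in> hom1 (hom_2cat pb x y) f g \<Longrightarrow>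
    map2 F \<alpha> \<in> hom1 (hom_2cat \<B> (map0 F x) (map0 F y)) (map1 F f) (map1 F g)"
  using F_hom by (simp add: hom1_hom_2cat_iff)

lemma image_hom2:
  assumes "\<Phi> \<in> hom2 (hom_2cat pb x y) \<alpha> \<beta>"
  shows "image3 \<Phi> \<in> hom2 (hom_2cat \<B> (map0 F x) (map0 F y)) (map2 F \<alpha>) (map2 F \<beta>)"
proof -
  have a: "src2 T \<alpha> \<in> hom1 T x y" "\<Phi> \<in> hom3 pb \<alpha> \<beta>" using assms by (simp_all add: hom2_hom_2cat_iff)
  obtain f g where fg: "\<alpha> \<in> hom2 T f g" using hom3_pbD(6)[OF a(2)] by blast
  then show ?thesis using a hom3_pbD(4)[OF a(2)] F_hom(1)[OF a(1)] hom2_src2[OF F_hom(2)[OF fg]] hom2_src2[OF fg]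
    by (simp add: hom2_hom_2cat_iff)
qed

lemma hom2_pbD:
  assumes "\<Phi> \<in> hom2 (hom_2cat pb x y) \<alpha> \<beta>"
  shows "dom3 \<Phi> = \<alpha>" "cod3 \<Phi> = \<beta>" "\<alpha> \<in> hom2 T (src2 T \<alpha>) (tgt2 T \<alpha>)" "\<beta> \<in> hom2 T (src2 T \<alpha>) (tgt2 T \<alpha>)"
    "\<Phi> = enc (\<alpha>, image3 \<Phi>, \<beta>)" "src2 T \<alpha> \<in> hom1 T x y"
proof -
  have a: "src2 T \<alpha> \<in> hom1 T x y" "\<Phi> \<in> hom3 pb \<alpha> \<beta>" using assms by (simp_all add: hom2_hom_2cat_iff)
  then show "dom3 \<Phi> = \<alpha>" "cod3 \<Phi> = \<beta>" "\<Phi> = enc (\<alpha>, image3 \<Phi>, \<beta>)" "src2 T \<alpha> \<in> hom1 T x y"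
    using hom3_pbD by blast+
  show "\<alpha> \<in> hom2 T (src2 T \<alpha>) (tgt2 T \<alpha>)" "\<beta> \<in> hom2 T (src2 T \<alpha>) (tgt2 T \<alpha>)"
    using hom3_pbD(6)[OF a(2)] by (auto simp: hom2_iff)
qed

lemma hom2_pbI:
  assumes "f \<in> hom1 T x y" "\<alpha> \<in> hom2 T f g" "\<beta> \<in> hom2 T f g"
    "\<Phi> \<in> hom2 (hom_2cat \<B> (map0 F x) (map0 F y)) (map2 F \<alpha>) (map2 F \<beta>)"
  shows "enc (\<alpha>, \<Phi>, \<beta>) \<in> hom2 (hom_2cat pb x y) \<alpha> \<beta>"
  using assms hom3_pbI[of \<alpha> f g \<beta> \<Phi>] by (simp add: hom2_hom_2cat_iff hom2_src2)

lemma Cell2_hom_pb: "\<Phi> \<in> Cell2 (hom_2cat pb x y) \<Longrightarrow> \<Phi> \<in> hom2 (hom_2cat pb x y) (dom3 \<Phi>) (cod3 \<Phi>)"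
  by (simp add: hom2_iff[of _ "hom_2cat pb x y"])

text \<open>
  A 3-cell is determined by its boundary and its image in \<open>\<B>\<close>. Each law for 3-cells thus splits into
  a law of \<open>T\<close> for the boundaries and the same law of \<open>\<B>\<close> for the images; the same holds for the
  laws of composition below.
\<close>

lemma two_category_hom_pb:
  assumes xy: "x \<in> Cell0 T" "y \<in> Cell0 T"
  shows "two_category (hom_2cat pb x y)"
proof -
  interpret H: two_category "hom_2cat \<B> (map0 F x) (map0 F y)"
    using B.hom_two_category F.map0_closed xy by simp
  have F2: "map2 F \<alpha> \<in> hom1 (hom_2cat \<B> (map0 F x) (map0 F y)) (map1 F f) (map1 F g)"
    if "f \<in> hom1 T x y" "\<alpha> \<in> hom2 T f g" for \<alpha> f g
    using F_hom that by (simp add: hom1_hom_2cat_iff)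
  have F1: "map1 F f \<in> Cell0 (hom_2cat \<B> (map0 F x) (map0 F y))" if "f \<in> hom1 T x y" for f
    using F_hom that by simp
  note D = hom2_pbD and I = hom2_pbI and M = image_hom2
  have H1: "\<alpha> \<in> hom1 (hom_2cat pb x y) f g \<longleftrightarrow> f \<in> hom1 T x y \<and> \<alpha> \<in> hom2 T f g" for \<alpha> f g
    by (simp add: hom1_hom_2cat_iff)
  have par: "\<lbrakk>f \<in> hom1 T x y; \<alpha> \<in> hom2 T f g\<rbrakk> \<Longrightarrow> g \<in> hom1 T x y" for f \<alpha> g by (rule T.hom2_hom1)
  show ?thesis
  proof (intro two_category.intro two_category_axioms.intro sesquicategory.intro, goal_cases)
    case (1 \<alpha>) then show ?case by (simp add: Cell1_hom_2cat)
  next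
    case (2 \<alpha>)
    then show ?case using par[of "src2 T \<alpha>" \<alpha> "tgt2 T \<alpha>"] by (simp add: Cell1_hom_2cat hom2_iff)
  next
    case (3 f) then show ?case using T.id2_hom[of f] by (simp add: H1 hom1_iff[of f])
  next
    case (4 \<alpha> f g \<beta> h) then show ?case using T.comp2_hom by (auto simp: H1)
  next
    case 5 then show ?case using T.comp2_id_right by (auto simp: H1)
  next
    case 6 then show ?case using T.comp2_id_left by (auto simp: H1)
  next
    case 7 then show ?case using T.comp2_assoc by (auto simp: H1)
  next
    case (8 \<Phi>) note d = D[OF Cell2_hom_pb[OF 8]]
    show ?case using d(3,6) by (simp add: Cell1_hom_2cat hom2_iff)
  next
    case (9 \<Phi>) note d = D[OF Cell2_hom_pb[OF 9]]
    show ?case using d(4,6) by (simp add: Cell1_hom_2cat hom2_iff)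
  next
    case (10 \<Phi>) note d = D[OF Cell2_hom_pb[OF 10]]
    show ?case using d(4) by (simp add: hom2_iff)
  next
    case (11 \<Phi>) note d = D[OF Cell2_hom_pb[OF 11]]
    show ?case using d(4) by (simp add: hom2_iff)
  next
    case (12 \<alpha>)
    then have a: "src2 T \<alpha> \<in> hom1 T x y" "\<alpha> \<in> hom2 T (src2 T \<alpha>) (tgt2 T \<alpha>)" by (simp_all add: Cell1_hom_2cat hom2_iff)
    show ?case using I[OF a a(2)] H.id2_hom[of "map2 F \<alpha>"] F2[OF a] by (simp add: hom1_iff)
  next
    case (13 \<Phi> \<alpha> \<beta> \<Psi> \<gamma>)
    note d = D[OF 13(1)] and d' = D[OF 13(2)]
    have "\<gamma> \<in> hom2 T (src2 T \<alpha>) (tgt2 T \<alpha>)" using d(4) d'(4) by (simp add: hom2_iff)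
    then show ?case using I[OF d(6,3) _ H.comp2_hom[OF M[OF 13(1)] M[OF 13(2)]]] d d' by simp
  next
    case (14 \<Phi> \<alpha> \<beta>)
    note d = D[OF 14]
    show ?case by (subst (2) d(5)) (simp add: d(1,2) H.comp2_id_right[OF M[OF 14], simplified])
  next
    case (15 \<Phi> \<alpha> \<beta>)
    note d = D[OF 15]
    show ?case by (subst (2) d(5)) (simp add: d(1,2) H.comp2_id_left[OF M[OF 15], simplified])
  next
    case (16 \<Phi> \<alpha> \<beta> \<Psi> \<gamma> X \<delta>)
    show ?case
      using D(1,2)[OF 16(1)] D(1,2)[OF 16(2)] D(1,2)[OF 16(3)] H.comp2_assoc[OF M[OF 16(1)] M[OF 16(2)] M[OF 16(3)]] by simp
  next
    case (17 \<alpha> f g \<Phi> \<alpha>' \<beta> h)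
    then have t: "f \<in> hom1 T x y" "\<alpha> \<in> hom2 T f g" "g \<in> hom1 T x y" "\<beta> \<in> hom2 T g h" by (simp_all add: H1)
    note d = D[OF 17(2)]
    then have \<alpha>': "\<alpha>' \<in> hom2 T f g" using t(2) by (simp add: hom2_iff)
    show ?case
      using I[OF t(1) T.comp2_hom[OF t(2,4)] T.comp2_hom[OF \<alpha>' t(4)]] d(1,2)
        H.lwhisk_hom[OF F2[OF t(1,2)] M[OF 17(2)] F2[OF t(3,4)]] F_ops(4)[OF t(2,4)] F_ops(4)[OF \<alpha>' t(4)] by simp
  next
    case (18 \<alpha> f g \<beta> h)
    then have t: "f \<in> hom1 T x y" "\<alpha> \<in> hom2 T f g" "g \<in> hom1 T x y" "\<beta> \<in> hom2 T g h" by (simp_all add: H1)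
    show ?case using H.lwhisk_id2[OF F2[OF t(1,2)] F2[OF t(3,4)]] F_ops(4)[OF t(2,4)] by simp
  next
    case (19 \<alpha> f g \<Phi> \<alpha>' \<Phi>' \<alpha>'' \<beta> h)
    then have t: "f \<in> hom1 T x y" "\<alpha> \<in> hom2 T f g" "g \<in> hom1 T x y" "\<beta> \<in> hom2 T g h" by (simp_all add: H1)
    show ?case
      using H.lwhisk_comp2[OF F2[OF t(1,2)] M[OF 19(2)] M[OF 19(3)] F2[OF t(3,4)]] D(1,2)[OF 19(2)] D(1,2)[OF 19(3)] by simp
  next
    case (20 \<alpha> f g \<Phi> \<alpha>')
    then have t: "f \<in> hom1 T x y" "\<alpha> \<in> hom2 T f g" by (simp_all add: H1)
    note g = par[OF t]
    note d = D[OF 20(2)]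
    then have \<alpha>': "\<alpha>' \<in> hom2 T f g" using t(2) by (simp add: hom2_iff)
    have "map2 F (id2 T g) = id2 \<B> (map1 F g)" using F_ops(3) g by (simp add: hom1_iff)
    then show ?case using H.lwhisk_id1[OF F2[OF t] M[OF 20(2)]]
      T.comp2_id_left[OF t(2)] T.comp2_id_left[OF \<alpha>'] d(1,2,5) by simp
  next
    case (21 \<alpha> f g \<Phi> \<alpha>' \<beta> h \<gamma> k)
    then have t: "f \<in> hom1 T x y" "\<alpha> \<in> hom2 T f g" "g \<in> hom1 T x y" "\<beta> \<in> hom2 T g h" "h \<in> hom1 T x y" "\<gamma> \<in> hom2 T h k"
      by (simp_all add: H1)
    note d = D[OF 21(2)]
    then have \<alpha>': "\<alpha>' \<in> hom2 T f g" using t(2) by (simp add: hom2_iff)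
    show ?case
      using H.lwhisk_comp1[OF F2[OF t(1,2)] M[OF 21(2)] F2[OF t(3,4)] F2[OF t(5,6)]] d(1,2) F_ops(4)[OF t(4,6)]
        T.comp2_assoc[OF t(2,4,6)] T.comp2_assoc[OF \<alpha>' t(4,6)] by simp
  next
    case (22 \<alpha> f g \<beta> h \<Psi> \<beta>')
    then have t: "f \<in> hom1 T x y" "\<alpha> \<in> hom2 T f g" "g \<in> hom1 T x y" "\<beta> \<in> hom2 T g h" by (simp_all add: H1)
    note d = D[OF 22(3)]
    then have \<beta>': "\<beta>' \<in> hom2 T g h" using t(4) by (simp add: hom2_iff)
    show ?case
      using I[OF t(1) T.comp2_hom[OF t(2,4)] T.comp2_hom[OF t(2) \<beta>']] d(1,2)
        H.rwhisk_hom[OF F2[OF t(1,2)] F2[OF t(3,4)] M[OF 22(3)]] F_ops(4)[OF t(2,4)] F_ops(4)[OF t(2) \<beta>'] by simp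
  next
    case (23 \<alpha> f g \<beta> h)
    then have t: "f \<in> hom1 T x y" "\<alpha> \<in> hom2 T f g" "g \<in> hom1 T x y" "\<beta> \<in> hom2 T g h" by (simp_all add: H1)
    show ?case using H.rwhisk_id2[OF F2[OF t(1,2)] F2[OF t(3,4)]] F_ops(4)[OF t(2,4)] by simp
  next
    case (24 \<alpha> f g \<beta> h \<Psi> \<beta>' \<Psi>' \<beta>'')
    then have t: "f \<in> hom1 T x y" "\<alpha> \<in> hom2 T f g" "g \<in> hom1 T x y" "\<beta> \<in> hom2 T g h" by (simp_all add: H1)
    show ?case
      using H.rwhisk_comp2[OF F2[OF t(1,2)] F2[OF t(3,4)] M[OF 24(3)] M[OF 24(4)]] D(1,2)[OF 24(3)] D(1,2)[OF 24(4)] by simp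
  next
    case (25 \<beta> g h \<Psi> \<beta>')
    then have t: "g \<in> hom1 T x y" "\<beta> \<in> hom2 T g h" by (simp_all add: H1)
    note d = D[OF 25(2)]
    then have \<beta>': "\<beta>' \<in> hom2 T g h" using t(2) by (simp add: hom2_iff)
    have "map2 F (id2 T g) = id2 \<B> (map1 F g)" using F_ops(3) t by (simp add: hom1_iff)
    then show ?case using H.rwhisk_id1[OF F2[OF t] M[OF 25(2)]]
      T.comp2_id_right[OF t(2)] T.comp2_id_right[OF \<beta>'] d(1,2,5) by simp
  next
    case (26 \<alpha> f g \<beta> h \<gamma> k X \<gamma>')
    then have t: "f \<in> hom1 T x y" "\<alpha> \<in> hom2 T f g" "g \<in> hom1 T x y" "\<beta> \<in> hom2 T g h" "h \<in> hom1 T x y" "\<gamma> \<in> hom2 T h k"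
      by (simp_all add: H1)
    note d = D[OF 26(4)]
    then have \<gamma>': "\<gamma>' \<in> hom2 T h k" using t(6) by (simp add: hom2_iff)
    show ?case
      using H.rwhisk_comp1[OF F2[OF t(1,2)] F2[OF t(3,4)] F2[OF t(5,6)] M[OF 26(4)]] d(1,2) F_ops(4)[OF t(2,4)]
        T.comp2_assoc[OF t(2,4,6)] T.comp2_assoc[OF t(2,4) \<gamma>'] by simp
  next
    case (27 \<alpha> f g \<beta> h \<Psi> \<beta>' \<gamma> k)
    then have t: "f \<in> hom1 T x y" "\<alpha> \<in> hom2 T f g" "g \<in> hom1 T x y" "\<beta> \<in> hom2 T g h" "h \<in> hom1 T x y" "\<gamma> \<in> hom2 T h k"
      by (simp_all add: H1)
    note d = D[OF 27(3)]
    then have \<beta>': "\<beta>' \<in> hom2 T g h" using t(4) by (simp add: hom2_iff)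
    show ?case
      using H.whisk_whisk[OF F2[OF t(1,2)] F2[OF t(3,4)] M[OF 27(3)] F2[OF t(5,6)]] d(1,2)
        T.comp2_assoc[OF t(2,4,6)] T.comp2_assoc[OF t(2) \<beta>' t(6)] by simp
  next
    case (28 \<alpha> f g \<Phi> \<alpha>' \<beta> h \<Psi> \<beta>')
    then have t: "f \<in> hom1 T x y" "\<alpha> \<in> hom2 T f g" "g \<in> hom1 T x y" "\<beta> \<in> hom2 T g h"
      by (simp_all add: H1)
    show ?case
      using H.interchange[OF F2[OF t(1,2)] M[OF 28(2)] F2[OF t(3,4)] M[OF 28(4)]] D(1,2)[OF 28(2)] D(1,2)[OF 28(4)]
      by simp
  qed
qed

context
  fixes x y z
  assumes xyz: "x \<in> Cell0 T" "y \<in> Cell0 T" "z \<in> Cell0 T"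
begin

interpretation G: gray_tensor_functor "hom_2cat \<B> (map0 F y) (map0 F z)" "hom_2cat \<B> (map0 F x) (map0 F y)"
  "hom_2cat \<B> (map0 F x) (map0 F z)"
  "\<lambda>f. \<lparr>map0 = \<lambda>g. g \<star>\<^bsub>\<B>\<^esub> f, map1 = \<lambda>\<beta>. \<beta> \<rhd>\<^bsub>\<B>\<^esub> f, map2 = \<lambda>\<Psi>. rwhisk13 \<B> \<Psi> f\<rparr>"
  "\<lambda>g. \<lparr>map0 = \<lambda>f. g \<star>\<^bsub>\<B>\<^esub> f, map1 = \<lambda>\<alpha>. g \<lhd>\<^bsub>\<B>\<^esub> \<alpha>, map2 = \<lambda>\<Phi>. lwhisk13 \<B> g \<Phi>\<rparr>"
  "interchanger \<B>"
  using B.composition F.map0_closed xyz by simp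

lemma rwhisk_functor_pb:
  assumes f: "f \<in> hom1 T x y"
  shows "sesquifunctor (hom_2cat pb y z) (hom_2cat pb x z)
    \<lparr>map0 = \<lambda>g. g \<star>\<^bsub>pb\<^esub> f, map1 = \<lambda>\<beta>. \<beta> \<rhd>\<^bsub>pb\<^esub> f, map2 = \<lambda>\<Psi>. rwhisk13 pb \<Psi> f\<rparr>"
proof -
  interpret HA: two_category "hom_2cat pb y z" using two_category_hom_pb xyz by blast
  interpret HB: two_category "hom_2cat pb x z" using two_category_hom_pb xyz by blast
  have "map1 F f \<in> Cell0 (hom_2cat \<B> (map0 F x) (map0 F y))" using F_hom(1)[OF f] by simp
  note P = G.P_functor[OF this]
  show ?thesis
  proof (intro sesquifunctor.intro sesquifunctor_axioms.intro HA.sesquicategory_axioms HB.sesquicategory_axioms,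
      unfold cellmap.simps pb_simps pb_homs hom_2cat_simps hom1_hom_2cat_iff, goal_cases)
    case 1 then show ?case by (rule T.comp1_hom[OF f])
  next
    case (2 \<beta> g g')
    then show ?case using T.comp1_hom[OF f] T.rwhisk_hom[OF f] by blast
  next
    case (3 \<Psi> \<beta> \<beta>')
    note d = hom2_pbD[OF 3]
    note r = T.rwhisk_hom[OF f d(6)]
    show ?case
      using hom2_pbI[OF T.comp1_hom[OF f d(6)] r[OF d(3)] r[OF d(4)]] sesquifunctor.map2_hom[OF P image_hom2[OF 3]]
        F_ops(6)[OF f d(6) d(3)] F_ops(6)[OF f d(6) d(4)] by (simp add: d(1,2))
  next
    case 4 then show ?case by (rule T.rwhisk_id2[OF f])
  next
    case 5 then show ?case using T.rwhisk_comp2[OF f] by blast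
  next
    case (6 \<beta>)
    then have b: "\<beta> \<in> hom2 T (src2 T \<beta>) (tgt2 T \<beta>)" "src2 T \<beta> \<in> hom1 T y z" by (simp_all add: Cell1_hom_2cat hom2_iff)
    show ?case using sesquifunctor.map2_id2[OF P, of "map2 F \<beta>"] F_ops(6)[OF f b(2,1)]
        B.hom2_Cell1[OF F_hom(1)[OF b(2)] F_hom(2)[OF b(1)]] by simp
  next
    case (7 \<Phi> \<alpha> \<beta> \<Psi> \<gamma>)
    show ?case using sesquifunctor.map2_comp2[OF P image_hom2[OF 7(1)] image_hom2[OF 7(2)]] by simp
  next
    case (8 \<alpha> g h \<Phi> \<alpha>' \<beta> k)
    note d = hom2_pbD[OF 8(2)]
    then have \<alpha>': "\<alpha>' \<in> hom2 T g h" using 8(1) by (simp add: hom2_iff)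
    have h: "\<alpha> \<in> hom1 (hom_2cat pb y z) g h" "\<beta> \<in> hom1 (hom_2cat pb y z) h k"
      using 8 by (simp_all add: hom1_hom_2cat_iff)
    show ?case
      using sesquifunctor.map2_lwhisk[OF P image_hom1[OF h(1)] image_hom2[OF 8(2)] image_hom1[OF h(2)]]
        d(1,2) T.rwhisk_comp2[OF f] 8 \<alpha>' F_ops(6)[OF f, of h z \<beta> k] by auto
  next
    case (9 \<alpha> g h \<beta> k \<Psi> \<beta>')
    note d = hom2_pbD[OF 9(3)]
    then have \<beta>': "\<beta>' \<in> hom2 T h k" using 9(2) by (simp add: hom2_iff)
    have h: "\<alpha> \<in> hom1 (hom_2cat pb y z) g h" "\<beta> \<in> hom1 (hom_2cat pb y z) h k"
      using 9 by (simp_all add: hom1_hom_2cat_iff)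
    show ?case
      using sesquifunctor.map2_rwhisk[OF P image_hom1[OF h(1)] image_hom1[OF h(2)] image_hom2[OF 9(3)]]
        d(1,2) T.rwhisk_comp2[OF f] 9 \<beta>' F_ops(6)[OF f, of g z \<alpha> h] by auto
  qed
qed

lemma lwhisk_functor_pb:
  assumes g: "g \<in> hom1 T y z"
  shows "sesquifunctor (hom_2cat pb x y) (hom_2cat pb x z)
    \<lparr>map0 = \<lambda>f. g \<star>\<^bsub>pb\<^esub> f, map1 = \<lambda>\<alpha>. g \<lhd>\<^bsub>pb\<^esub> \<alpha>, map2 = \<lambda>\<Phi>. lwhisk13 pb g \<Phi>\<rparr>"
proof -
  interpret HA: two_category "hom_2cat pb x y" using two_category_hom_pb xyz by blast
  interpret HB: two_category "hom_2cat pb x z" using two_category_hom_pb xyz by blast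
  have "map1 F g \<in> Cell0 (hom_2cat \<B> (map0 F y) (map0 F z))" using F_hom(1)[OF g] by simp
  note Q = G.Q_functor[OF this]
  show ?thesis
  proof (intro sesquifunctor.intro sesquifunctor_axioms.intro HA.sesquicategory_axioms HB.sesquicategory_axioms,
      unfold cellmap.simps pb_simps pb_homs hom_2cat_simps hom1_hom_2cat_iff, goal_cases)
    case 1 then show ?case by (rule T.comp1_hom[OF _ g])
  next
    case (2 \<alpha> f f')
    then show ?case using T.comp1_hom[OF _ g] T.lwhisk_hom[OF _ _ g] by blast
  next
    case (3 \<Phi> \<alpha> \<alpha>')
    note d = hom2_pbD[OF 3]
    note r = T.lwhisk_hom[OF d(6) _ g]
    show ?case
      using hom2_pbI[OF T.comp1_hom[OF d(6) g] r[OF d(3)] r[OF d(4)]] sesquifunctor.map2_hom[OF Q image_hom2[OF 3]]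
        F_ops(5)[OF d(6) d(3) g] F_ops(5)[OF d(6) d(4) g] by (simp add: d(1,2))
  next
    case 4 then show ?case by (rule T.lwhisk_id2[OF _ g])
  next
    case 5 then show ?case using T.lwhisk_comp2[OF _ _ _ g] by blast
  next
    case (6 \<beta>)
    then have b: "\<beta> \<in> hom2 T (src2 T \<beta>) (tgt2 T \<beta>)" "src2 T \<beta> \<in> hom1 T x y" by (simp_all add: Cell1_hom_2cat hom2_iff)
    show ?case using sesquifunctor.map2_id2[OF Q, of "map2 F \<beta>"] F_ops(5)[OF b(2,1) g]
        B.hom2_Cell1[OF F_hom(1)[OF b(2)] F_hom(2)[OF b(1)]] by simp
  next
    case (7 \<Phi> \<alpha> \<beta> \<Psi> \<gamma>)
    show ?case using sesquifunctor.map2_comp2[OF Q image_hom2[OF 7(1)] image_hom2[OF 7(2)]] by simp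
  next
    case (8 \<alpha> f h \<Phi> \<alpha>' \<beta> k)
    note d = hom2_pbD[OF 8(2)]
    then have \<alpha>': "\<alpha>' \<in> hom2 T f h" using 8(1) by (simp add: hom2_iff)
    have h: "\<alpha> \<in> hom1 (hom_2cat pb x y) f h" "\<beta> \<in> hom1 (hom_2cat pb x y) h k"
      using 8 by (simp_all add: hom1_hom_2cat_iff)
    show ?case
      using sesquifunctor.map2_lwhisk[OF Q image_hom1[OF h(1)] image_hom2[OF 8(2)] image_hom1[OF h(2)]]
        d(1,2) T.lwhisk_comp2[OF _ _ _ g] 8 \<alpha>' F_ops(5)[of h x y \<beta> k g z] g by auto
  next
    case (9 \<alpha> f h \<beta> k \<Psi> \<beta>')
    note d = hom2_pbD[OF 9(3)]
    then have \<beta>': "\<beta>' \<in> hom2 T h k" using 9(2) by (simp add: hom2_iff)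
    have h: "\<alpha> \<in> hom1 (hom_2cat pb x y) f h" "\<beta> \<in> hom1 (hom_2cat pb x y) h k"
      using 9 by (simp_all add: hom1_hom_2cat_iff)
    show ?case
      using sesquifunctor.map2_rwhisk[OF Q image_hom1[OF h(1)] image_hom1[OF h(2)] image_hom2[OF 9(3)]]
        d(1,2) T.lwhisk_comp2[OF _ _ _ g] 9 \<beta>' F_ops(5)[of f x y \<alpha> h g z] g by auto
  qed
qed

lemma composition_pb:
  "gray_tensor_functor (hom_2cat pb y z) (hom_2cat pb x y) (hom_2cat pb x z)
    (\<lambda>f. \<lparr>map0 = \<lambda>g. g \<star>\<^bsub>pb\<^esub> f, map1 = \<lambda>\<beta>. \<beta> \<rhd>\<^bsub>pb\<^esub> f, map2 = \<lambda>\<Psi>. rwhisk13 pb \<Psi> f\<rparr>)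
    (\<lambda>g. \<lparr>map0 = \<lambda>f. g \<star>\<^bsub>pb\<^esub> f, map1 = \<lambda>\<alpha>. g \<lhd>\<^bsub>pb\<^esub> \<alpha>, map2 = \<lambda>\<Phi>. lwhisk13 pb g \<Phi>\<rparr>)
    (interchanger pb)"
proof -
  have ends: "src2 T \<alpha> = f" "tgt2 T \<alpha> = g" if "\<alpha> \<in> hom2 T f g" for \<alpha> f g using that by (simp_all add: hom2_iff)
  have cells: "(g' \<lhd> \<alpha>) \<cdot> (\<beta> \<rhd> f) \<in> hom2 T (g \<star> f) (g' \<star> f')" "(\<beta> \<rhd> f') \<cdot> (g \<lhd> \<alpha>) \<in> hom2 T (g \<star> f) (g' \<star> f')"
    "map2 F ((g' \<lhd> \<alpha>) \<cdot> (\<beta> \<rhd> f)) = (map1 F g' \<lhd>\<^bsub>\<B>\<^esub> map2 F \<alpha>) \<cdot>\<^bsub>\<B>\<^esub> (map2 F \<beta> \<rhd>\<^bsub>\<B>\<^esub> map1 F f)"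
    "map2 F ((\<beta> \<rhd> f') \<cdot> (g \<lhd> \<alpha>)) = (map2 F \<beta> \<rhd>\<^bsub>\<B>\<^esub> map1 F f') \<cdot>\<^bsub>\<B>\<^esub> (map1 F g \<lhd>\<^bsub>\<B>\<^esub> map2 F \<alpha>)"
    if "f \<in> hom1 T x y" "\<alpha> \<in> hom2 T f f'" "g \<in> hom1 T y z" "\<beta> \<in> hom2 T g g'" for f f' g g' \<alpha> \<beta>
  proof -
    note f' = T.hom2_hom1[OF that(1,2)] and g' = T.hom2_hom1[OF that(3,4)]
    note a = T.rwhisk_hom[OF that(1,3,4)] T.lwhisk_hom[OF that(1,2) g']
      and b = T.lwhisk_hom[OF that(1,2,3)] T.rwhisk_hom[OF f' that(3,4)]
    show "(g' \<lhd> \<alpha>) \<cdot> (\<beta> \<rhd> f) \<in> hom2 T (g \<star> f) (g' \<star> f')" "(\<beta> \<rhd> f') \<cdot> (g \<lhd> \<alpha>) \<in> hom2 T (g \<star> f) (g' \<star> f')"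
      using T.comp2_hom[OF a] T.comp2_hom[OF b] .
    show "map2 F ((g' \<lhd> \<alpha>) \<cdot> (\<beta> \<rhd> f)) = (map1 F g' \<lhd>\<^bsub>\<B>\<^esub> map2 F \<alpha>) \<cdot>\<^bsub>\<B>\<^esub> (map2 F \<beta> \<rhd>\<^bsub>\<B>\<^esub> map1 F f)"
      by (simp only: F_ops(4)[OF a] F_ops(5)[OF that(1,2) g'] F_ops(6)[OF that(1,3,4)])
    show "map2 F ((\<beta> \<rhd> f') \<cdot> (g \<lhd> \<alpha>)) = (map2 F \<beta> \<rhd>\<^bsub>\<B>\<^esub> map1 F f') \<cdot>\<^bsub>\<B>\<^esub> (map1 F g \<lhd>\<^bsub>\<B>\<^esub> map2 F \<alpha>)"
      by (simp only: F_ops(4)[OF b] F_ops(5)[OF that(1,2,3)] F_ops(6)[OF f' that(3,4)])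
  qed
  have h1: "map2 F \<alpha> \<in> hom1 (hom_2cat \<B> (map0 F u) (map0 F v)) (map1 F f) (map1 F g)"
    if "f \<in> hom1 T u v" "\<alpha> \<in> hom2 T f g" for u v f g \<alpha>
    using F_hom that by (simp add: hom1_hom_2cat_iff)
  note \<Gamma>B = G.\<Gamma>_hom[OF h1 h1, unfolded cellmap.simps hom_2cat_simps]
    G.\<Gamma>_invertible[OF h1 h1, unfolded cellmap.simps hom_2cat_simps]
  show ?thesis
  proof (intro gray_tensor_functor.intro gray_tensor_functor_axioms.intro two_category_hom_pb xyz
      rwhisk_functor_pb lwhisk_functor_pb,
      unfold cellmap.simps pb_simps pb_homs hom_2cat_simps hom1_hom_2cat_iff, goal_cases)
    case 1 then show ?case .
  next
    case 2 then show ?case .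
  next
    case 3 show ?case ..
  next
    case (4 \<beta> g g' \<alpha> f f')
    then have t: "f \<in> hom1 T x y" "\<alpha> \<in> hom2 T f f'" "g \<in> hom1 T y z" "\<beta> \<in> hom2 T g g'" by auto
    note c = cells[OF t]
    show ?case
      using hom2_pbI[OF T.comp1_hom[OF t(1,3)] c(1,2), unfolded c(3,4), OF \<Gamma>B(1)[OF t(3,4,1,2)]]
      by (simp add: ends[OF t(2)] ends[OF t(4)])
  next
    case (5 \<beta> g g' \<alpha> f f')
    then have t: "f \<in> hom1 T x y" "\<alpha> \<in> hom2 T f f'" "g \<in> hom1 T y z" "\<beta> \<in> hom2 T g g'" by auto
    note c = cells[OF t]
    obtain \<Delta> where \<Delta>: "\<Delta> \<in> hom2 (hom_2cat \<B> (map0 F x) (map0 F z)) (map2 F ((\<beta> \<rhd> f') \<cdot> (g \<lhd> \<alpha>))) (map2 F ((g' \<lhd> \<alpha>) \<cdot> (\<beta> \<rhd> f)))"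
      "comp3 \<B> \<Delta> (interchanger \<B> (map2 F \<beta>) (map2 F \<alpha>)) = id3 \<B> (map2 F ((g' \<lhd> \<alpha>) \<cdot> (\<beta> \<rhd> f)))"
      "comp3 \<B> (interchanger \<B> (map2 F \<beta>) (map2 F \<alpha>)) \<Delta> = id3 \<B> (map2 F ((\<beta> \<rhd> f') \<cdot> (g \<lhd> \<alpha>)))"
      using \<Gamma>B(2)[OF t(3,4,1,2)] unfolding c(3,4) by blast
    show ?case
      by (rule bexI[OF _ hom2_pbI[OF T.comp1_hom[OF t(1,3)] c(2,1) \<Delta>(1)]])
        (simp add: ends[OF t(2)] ends[OF t(4)] \<Delta>(2,3))
  next
    case (6 g \<alpha> f f')
    then have t: "f \<in> hom1 T x y" "\<alpha> \<in> hom2 T f f'" "g \<in> hom1 T y z" by auto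
    note f' = T.hom2_hom1[OF t(1,2)] and l = T.lwhisk_hom[OF t]
    have i: "src2 T (id2 T g) = g" "tgt2 T (id2 T g) = g" "map2 F (id2 T g) = id2 \<B> (map1 F g)"
      using T.id2_hom[of g] F_ops(3)[of g] t(3) by (simp_all add: hom1_iff hom2_iff)
    show ?case
      using G.\<Gamma>_id_left[of "map1 F g", OF _ h1[OF t(1,2)]] F_hom(1)[OF t(3)] T.comp2_id_left[OF l] T.comp2_id_right[OF l]
      by (simp add: ends[OF t(2)] i T.rwhisk_id2[OF t(1,3)] T.rwhisk_id2[OF f' t(3)] F_ops(5)[OF t])
  next
    case (7 \<beta> g g' f)
    then have t: "f \<in> hom1 T x y" "g \<in> hom1 T y z" "\<beta> \<in> hom2 T g g'" by auto
    note g' = T.hom2_hom1[OF t(2,3)] and l = T.rwhisk_hom[OF t]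
    have i: "src2 T (id2 T f) = f" "tgt2 T (id2 T f) = f" "map2 F (id2 T f) = id2 \<B> (map1 F f)"
      using T.id2_hom[of f] F_ops(3)[of f] t(1) by (simp_all add: hom1_iff hom2_iff)
    show ?case
      using G.\<Gamma>_id_right[OF h1[OF t(2,3)], of "map1 F f"] F_hom(1)[OF t(1)] T.comp2_id_left[OF l] T.comp2_id_right[OF l]
      by (simp add: ends[OF t(3)] i T.lwhisk_id2[OF t(1,2)] T.lwhisk_id2[OF t(1) g'] F_ops(6)[OF t])
  next
    case (8 \<beta> g g' \<beta>' g'' \<alpha> f f')
    then have t: "f \<in> hom1 T x y" "\<alpha> \<in> hom2 T f f'" "g \<in> hom1 T y z" "\<beta> \<in> hom2 T g g'" "g' \<in> hom1 T y z"
      "\<beta>' \<in> hom2 T g' g''" by auto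
    note f' = T.hom2_hom1[OF t(1,2)] and g'' = T.hom2_hom1[OF t(5,6)]
    note e = ends[OF t(2)] ends[OF t(4)] ends[OF t(6)] ends[OF T.comp2_hom[OF t(4,6)]]
    show ?case
      using G.\<Gamma>_comp_left[OF h1[OF t(3,4)] h1[OF t(5,6)] h1[OF t(1,2)]]
        T.comp2_assoc[OF T.rwhisk_hom[OF t(1,3,4)] T.rwhisk_hom[OF t(1,5,6)] T.lwhisk_hom[OF t(1,2) g'']]
        T.comp2_assoc[OF T.lwhisk_hom[OF t(1,2,3)] T.rwhisk_hom[OF f' t(3,4)] T.rwhisk_hom[OF f' t(5,6)]]
      by (simp add: e T.rwhisk_comp2[OF t(1,3,4,6)] T.rwhisk_comp2[OF f' t(3,4,6)] F_ops(4)[OF t(4,6)]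
          F_ops(6)[OF f' t(5,6)] F_ops(6)[OF t(1,3,4)])
  next
    case (9 \<beta> g g' \<alpha> f f' \<alpha>' f'')
    then have t: "f \<in> hom1 T x y" "\<alpha> \<in> hom2 T f f'" "f' \<in> hom1 T x y" "\<alpha>' \<in> hom2 T f' f''"
      "g \<in> hom1 T y z" "\<beta> \<in> hom2 T g g'" by auto
    note f'' = T.hom2_hom1[OF t(3,4)] and g' = T.hom2_hom1[OF t(5,6)]
    note e = ends[OF t(2)] ends[OF t(4)] ends[OF t(6)] ends[OF T.comp2_hom[OF t(2,4)]]
    show ?case
      using G.\<Gamma>_comp_right[OF h1[OF t(5,6)] h1[OF t(1,2)] h1[OF t(3,4)]]
        T.comp2_assoc[OF T.rwhisk_hom[OF t(1,5,6)] T.lwhisk_hom[OF t(1,2) g'] T.lwhisk_hom[OF t(3,4) g']]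
        T.comp2_assoc[OF T.lwhisk_hom[OF t(1,2,5)] T.lwhisk_hom[OF t(3,4,5)] T.rwhisk_hom[OF f'' t(5,6)]]
      by (simp add: e T.lwhisk_comp2[OF t(1,2,4,5)] T.lwhisk_comp2[OF t(1,2,4) g'] F_ops(4)[OF t(2,4)]
          F_ops(5)[OF t(1,2,5)] F_ops(5)[OF t(3,4) g'])
  next
    case (10 \<beta> g g' \<Psi> \<beta>' \<alpha> f f')
    then have t: "f \<in> hom1 T x y" "\<alpha> \<in> hom2 T f f'" "g \<in> hom1 T y z" "\<beta> \<in> hom2 T g g'" by auto
    note g' = T.hom2_hom1[OF t(3,4)] and d = hom2_pbD[OF 10(2)]
    have \<beta>': "\<beta>' \<in> hom2 T g g'" using d t(4) by (simp add: hom2_iff)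
    note e = ends[OF t(2)] ends[OF t(4)] ends[OF \<beta>']
    show ?case
      using G.\<Gamma>_natural_left[OF h1[OF t(3,4)] image_hom2[OF 10(2)] h1[OF t(1,2)]]
      by (simp add: e d(1,2) F_ops(5)[OF t(1,2) g'] F_ops(5)[OF t(1,2,3)])
  next
    case (11 \<beta> g g' \<alpha> f f' \<Phi> \<alpha>')
    then have t: "f \<in> hom1 T x y" "\<alpha> \<in> hom2 T f f'" "g \<in> hom1 T y z" "\<beta> \<in> hom2 T g g'" by auto
    note f' = T.hom2_hom1[OF t(1,2)] and d = hom2_pbD[OF 11(3)]
    have \<alpha>': "\<alpha>' \<in> hom2 T f f'" using d t(2) by (simp add: hom2_iff)
    note e = ends[OF t(2)] ends[OF t(4)] ends[OF \<alpha>']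
    show ?case
      using G.\<Gamma>_natural_right[OF h1[OF t(3,4)] h1[OF t(1,2)] image_hom2[OF 11(3)]]
      by (simp add: e d(1,2) F_ops(6)[OF t(1,3,4)] F_ops(6)[OF f' t(3,4)])
  qed
qed

end

theorem gray_category_pb: "gray_category pb"
proof -
  have cell1: "\<alpha> \<in> hom2 T (src2 T \<alpha>) (tgt2 T \<alpha>)" "src2 T \<alpha> \<in> hom1 T x y"
      "map2 F \<alpha> \<in> Cell1 (hom_2cat \<B> (map0 F x) (map0 F y))" "tgt2 T \<alpha> \<in> hom1 T x y"
    if "\<alpha> \<in> Cell1 (hom_2cat pb x y)" for \<alpha> x y
  proof -
    show *: "\<alpha> \<in> hom2 T (src2 T \<alpha>) (tgt2 T \<alpha>)" "src2 T \<alpha> \<in> hom1 T x y"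
      using that by (simp_all add: Cell1_hom_2cat hom2_iff)
    show "map2 F \<alpha> \<in> Cell1 (hom_2cat \<B> (map0 F x) (map0 F y))"
      by (rule B.hom2_Cell1[OF F_hom(1)[OF *(2)] F_hom(2)[OF *(1)]])
    show "tgt2 T \<alpha> \<in> hom1 T x y" by (rule T.hom2_hom1[OF *(2,1)])
  qed
  have cell2: "dom3 \<Phi> \<in> hom2 T (src2 T (dom3 \<Phi>)) (tgt2 T (dom3 \<Phi>))"
    "cod3 \<Phi> \<in> hom2 T (src2 T (dom3 \<Phi>)) (tgt2 T (dom3 \<Phi>))" "src2 T (dom3 \<Phi>) \<in> hom1 T x y"
      "image3 \<Phi> \<in> Cell2 (hom_2cat \<B> (map0 F x) (map0 F y))" "enc (dom3 \<Phi>, image3 \<Phi>, cod3 \<Phi>) = \<Phi>"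
    if "\<Phi> \<in> Cell2 (hom_2cat pb x y)" for \<Phi> x y
    using hom2_pbD[OF Cell2_hom_pb[OF that]] image_hom2[OF Cell2_hom_pb[OF that]]
    by (simp_all add: hom2_iff[of _ "hom_2cat \<B> _ _"])
  note F1 = F_hom(1) and F_c = F_ops(2)
  show ?thesis
  proof (intro gray_category.intro, goal_cases)
    case 1 then show ?case using T.src1_closed by simp
  next
    case 2 then show ?case using T.tgt1_closed by simp
  next
    case 3 then show ?case using T.src2_closed by simp
  next
    case 4 then show ?case by (auto simp: Cell3_pb hom2_iff)
  next
    case 5 then show ?case using two_category_hom_pb by simp
  next
    case 6 then show ?case using T.id1_hom by simp
  next
    case 7 then show ?case using composition_pb by simp
  next
    case 8 then show ?case using T.comp1_id_right by simp
  next
    case 9 then show ?case using T.rwhisk_id1[OF cell1(2,1)] by simp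
  next
    case (10 \<Phi> x y)
    note c = cell2[OF 10]
    show ?case
      using T.rwhisk_id1[OF c(3,1)] T.rwhisk_id1[OF c(3,2)] B.unit_right(3)[OF c(4)] F_ops(1)[of x] T.src1_closed c(3,5)
      by (auto simp: hom1_iff)
  next
    case 11 then show ?case using T.comp1_id_left by simp
  next
    case 12 then show ?case using T.lwhisk_id1[OF cell1(2,1)] by simp
  next
    case (13 \<Phi> x y)
    note c = cell2[OF 13]
    show ?case
      using T.lwhisk_id1[OF c(3,1)] T.lwhisk_id1[OF c(3,2)] B.unit_left(3)[OF c(4)] F_ops(1)[of y] T.tgt1_closed c(3,5)
      by (auto simp: hom1_iff)
  next
    case 14 then show ?case using T.comp1_assoc by simp
  next
    case 15 then show ?case using T.lwhisk_comp1[OF cell1(2,1)] by simp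
  next
    case (16 f x y \<beta> z h w) then show ?case using T.whisk_whisk[OF _ cell1(2,1)[OF 16(2)]] by simp
  next
    case (17 f x y g z \<gamma> w) then show ?case using T.rwhisk_comp1[OF _ _ cell1(2,1)[OF 17(3)]] by simp
  next
    case (18 \<Phi> x y g z h w)
    note c = cell2[OF 18(1)] and gh = 18(2,3)[unfolded pb_homs]
    show ?case
      using T.lwhisk_comp1[OF c(3,1) gh] T.lwhisk_comp1[OF c(3,2) gh] B.assoc_2(1)[OF c(4) F1[OF gh(1)] F1[OF gh(2)]] F_c[OF gh]
      by simp
  next
    case (19 f x y \<Psi> z h w)
    note c = cell2[OF 19(2)] and f = 19(1)[unfolded pb_homs] and h = 19(3)[unfolded pb_homs]
    show ?case
      using T.whisk_whisk[OF f c(3,1) h] T.whisk_whisk[OF f c(3,2) h] B.assoc_2(2)[OF F1[OF f] c(4) F1[OF h]] by simp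
  next
    case (20 f x y g z X w)
    note c = cell2[OF 20(3)] and fg = 20(1,2)[unfolded pb_homs]
    show ?case
      using T.rwhisk_comp1[OF fg c(3,1)] T.rwhisk_comp1[OF fg c(3,2)] B.assoc_2(3)[OF F1[OF fg(1)] F1[OF fg(2)] c(4)] F_c[OF fg]
      by simp
  next
    case (21 \<alpha> x y \<beta> z h w)
    note a = cell1[OF 21(1)] and b = cell1[OF 21(2)] and h = 21(3)[unfolded pb_homs]
    note hb = T.lwhisk_hom[OF b(2,1) h]
    show ?case
      using B.assoc_interchanger(1)[OF a(3) b(3) F1[OF h]] F_ops(5)[OF b(2,1) h] hb
        T.lwhisk_comp1[OF a(2,1) b(4) h] T.lwhisk_comp1[OF a(2,1) b(2) h]
        T.whisk_whisk[OF a(2) b(2,1) h] T.whisk_whisk[OF a(4) b(2,1) h]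
        T.lwhisk_comp2[OF T.comp1_hom[OF a(2) b(2)] T.rwhisk_hom[OF a(2) b(2,1)] T.lwhisk_hom[OF a(2,1) b(4)] h]
        T.lwhisk_comp2[OF T.comp1_hom[OF a(2) b(2)] T.lwhisk_hom[OF a(2,1) b(2)] T.rwhisk_hom[OF a(4) b(2,1)] h]
      by (simp add: hom2_iff)
  next
    case (22 \<alpha> x y g z \<gamma> w)
    note a = cell1[OF 22(1)] and c = cell1[OF 22(3)] and g = 22(2)[unfolded pb_homs]
    show ?case
      using B.assoc_interchanger(2)[OF a(3) F1[OF g] c(3)] F_ops(6)[OF g c(2,1)] F_ops(5)[OF a(2,1) g]
        T.rwhisk_hom[OF g c(2,1)] T.lwhisk_hom[OF a(2,1) g] T.lwhisk_comp1[OF a(2,1) g c(4)] T.lwhisk_comp1[OF a(2,1) g c(2)]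
        T.rwhisk_comp1[OF a(2) g c(2,1)] T.rwhisk_comp1[OF a(4) g c(2,1)]
      by (simp add: hom2_iff)
  next
    case (23 f x y \<beta> z \<gamma> w)
    note f = 23(1)[unfolded pb_homs] and b = cell1[OF 23(2)] and c = cell1[OF 23(3)]
    note bc = T.comp1_hom[OF b(2) c(2)]
    show ?case
      using B.assoc_interchanger(3)[OF F1[OF f] b(3) c(3)] F_ops(6)[OF f b(2,1)] T.rwhisk_hom[OF f b(2,1)]
        T.whisk_whisk[OF f b(2,1) c(4)] T.whisk_whisk[OF f b(2,1) c(2)]
        T.rwhisk_comp1[OF f b(2) c(2,1)] T.rwhisk_comp1[OF f b(4) c(2,1)]
        T.rwhisk_comp2[OF f bc T.rwhisk_hom[OF b(2) c(2,1)] T.lwhisk_hom[OF b(2,1) c(4)]]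
        T.rwhisk_comp2[OF f bc T.lwhisk_hom[OF b(2,1) c(2)] T.rwhisk_hom[OF b(4) c(2,1)]]
      by (simp add: hom2_iff)
  qed
qed

definition projection where
  "projection = \<lparr>map0 = map0 F, map1 = map1 F, map2 = map2 F, map3 = image3\<rparr>"

lemma projection_simps [simp]:
  "map0 projection = map0 F" "map1 projection = map1 F" "map2 projection = map2 F" "map3 projection = image3"
  "underlying_map projection = F"
  by (simp_all add: projection_def underlying_map_def)

theorem gray_functor_projection: "gray_functor pb \<B> projection"
  by (rule gray_functorI[OF gray_category_pb B.gray_category_axioms])
    (simp_all add: underlying_pb F.sesquifunctor_axioms hom3_pbD(4))

theorem projection_fully_faithful: "fully_faithful_on_3cells pb \<B> projection"
  unfolding fully_faithful_on_3cells_def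
proof (intro allI ballI bij_betwI')
  fix x y f g \<alpha> \<beta> \<Phi> \<Psi>
  assume "\<Phi> \<in> hom3 pb \<alpha> \<beta>" "\<Psi> \<in> hom3 pb \<alpha> \<beta>"
  then show "(map3 projection \<Phi> = map3 projection \<Psi>) = (\<Phi> = \<Psi>)"
    using hom3_pbD(3)[of \<Phi> \<alpha> \<beta>] hom3_pbD(3)[of \<Psi> \<alpha> \<beta>] by auto
next
  fix \<Phi> \<alpha> \<beta> assume "\<Phi> \<in> hom3 pb \<alpha> \<beta>"
  then show "map3 projection \<Phi> \<in> hom3 \<B> (map2 projection \<alpha>) (map2 projection \<beta>)" using hom3_pbD(4) by simp
next
  fix f g \<alpha> \<beta> \<Psi>
  assume "\<alpha> \<in> hom2 pb f g" "\<beta> \<in> hom2 pb f g" "\<Psi> \<in> hom3 \<B> (map2 projection \<alpha>) (map2 projection \<beta>)"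
  then show "\<exists>\<Phi>\<in>hom3 pb \<alpha> \<beta>. \<Psi> = map3 projection \<Phi>"
    using hom3_pbI[of \<alpha> f g \<beta> \<Psi>] by (intro bexI[of _ "enc (\<alpha>, \<Psi>, \<beta>)"]) auto
qed

end

section \<open>Copies of cells in a universe\<close>

lemma ex_inj_prod:
  assumes "infinite (UNIV :: 'u set)" "\<exists>f :: 'a \<Rightarrow> 'u. inj f" "\<exists>f :: 'b \<Rightarrow> 'u. inj f"
  shows "\<exists>f :: 'a \<times> 'b \<Rightarrow> 'u. inj f"
proof -
  obtain i :: "'a \<Rightarrow> 'u" and j :: "'b \<Rightarrow> 'u" where ij: "inj i" "inj j" using assms by blast
  have "\<exists>k :: 'u \<times> 'u \<Rightarrow> 'u. inj_on k (UNIV \<times> UNIV) \<and> k ` (UNIV \<times> UNIV) \<subseteq> UNIV"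
    by (rule card_of_ordLeq[THEN iffD2, OF ordIso_imp_ordLeq[OF card_of_Times_same_infinite[OF assms(1)]]])
  then obtain k :: "'u \<times> 'u \<Rightarrow> 'u" where k: "inj k" by (auto simp only: UNIV_Times_UNIV)
  have "inj (\<lambda>p. k (i (fst p), j (snd p)))"
    by (rule injI) (simp add: inj_eq[OF k] inj_eq[OF ij(1)] inj_eq[OF ij(2)] prod_eq_iff)
  then show ?thesis by blast
qed

text \<open>
  Iterated pairing is injective on the lists of any given length, but may give lists of different
  lengths the same code; pairing with the length repairs this.
\<close>

lemma ex_inj_list:
  assumes "infinite (UNIV :: 'u set)" "\<exists>f :: 'a \<Rightarrow> 'u. inj f"
  shows "\<exists>f :: 'a list \<Rightarrow> 'u. inj f"
proof -
  obtain n :: "nat \<Rightarrow> 'u" where n: "inj n" using infinite_countable_subset[OF assms(1)] by blast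
  have u: "\<exists>f :: 'u \<Rightarrow> 'u. inj f" using inj_on_id by blast
  obtain k :: "'a \<times> 'u \<Rightarrow> 'u" where k: "inj k"
    using ex_inj_prod[OF assms u] by blast
  obtain m :: "nat \<times> 'u \<Rightarrow> 'u" where m: "inj m"
    using ex_inj_prod[OF assms(1) exI[of inj, OF n] u] by blast
  define c where "c xs = foldr (\<lambda>x u. k (x, u)) xs (n 0)" for xs
  have c: "c xs = c ys \<Longrightarrow> xs = ys" if "length xs = length ys" for xs ys
    using that by (induction xs ys rule: list_induct2) (simp_all add: c_def inj_eq[OF k])
  have "inj (\<lambda>xs. m (length xs, c xs))"
    by (rule injI) (use c in \<open>simp add: inj_eq[OF m]\<close>)
  then show ?thesis by blast
qed

definition transport where
  "transport i j k S = \<lparr>Cell0 = i ` Cell0 S, Cell1 = j ` Cell1 S, Cell2 = k ` Cell2 S,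
    src1 = \<lambda>f. i (src1 S (inv j f)), tgt1 = \<lambda>f. i (tgt1 S (inv j f)), id1 = \<lambda>x. j (id1 S (inv i x)),
    comp1 = \<lambda>g f. j (inv j g \<star>\<^bsub>S\<^esub> inv j f),
    src2 = \<lambda>\<alpha>. j (src2 S (inv k \<alpha>)), tgt2 = \<lambda>\<alpha>. j (tgt2 S (inv k \<alpha>)), id2 = \<lambda>f. k (id2 S (inv j f)),
    comp2 = \<lambda>\<beta> \<alpha>. k (inv k \<beta> \<cdot>\<^bsub>S\<^esub> inv k \<alpha>), lwhisk = \<lambda>g \<alpha>. k (inv j g \<lhd>\<^bsub>S\<^esub> inv k \<alpha>),
    rwhisk = \<lambda>\<beta> f. k (inv k \<beta> \<rhd>\<^bsub>S\<^esub> inv j f)\<rparr>"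

lemma (in sesquicategory) ex_transport:
  fixes i :: "'o \<Rightarrow> 'o2" and j :: "'m \<Rightarrow> 'm2" and k :: "'t \<Rightarrow> 't2"
  assumes inj: "inj i" "inj j" "inj k"
  obtains T :: "('o2, 'm2, 't2) sesquicat" where "sesquicategory T" "sesquicat_isomorphic T S"
proof -
  define T where "T = transport i j k S"
  have [simp]: "i x = i y \<longleftrightarrow> x = y" "j f = j g \<longleftrightarrow> f = g" "k \<alpha> = k \<beta> \<longleftrightarrow> \<alpha> = \<beta>"
    "inv i (i x) = x" "inv j (j f) = f" "inv k (k \<alpha>) = \<alpha>" for x y f g \<alpha> \<beta>
    using inj by (simp_all add: inj_eq)
  have simps [simp]: "Cell0 T = i ` Cell0 S" "Cell1 T = j ` Cell1 S" "Cell2 T = k ` Cell2 S"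
    "src1 T (j f) = i (src1 S f)" "tgt1 T (j f) = i (tgt1 S f)" "id1 T (i x) = j (id1 S x)"
    "j g \<star>\<^bsub>T\<^esub> j f = j (g \<star> f)" "src2 T (k \<alpha>) = j (src2 S \<alpha>)" "tgt2 T (k \<alpha>) = j (tgt2 S \<alpha>)"
    "id2 T (j f) = k (id2 S f)" "k \<beta> \<cdot>\<^bsub>T\<^esub> k \<alpha> = k (\<beta> \<cdot> \<alpha>)" "j g \<lhd>\<^bsub>T\<^esub> k \<alpha> = k (g \<lhd> \<alpha>)" "k \<beta> \<rhd>\<^bsub>T\<^esub> j f = k (\<beta> \<rhd> f)"
    for f g x \<alpha> \<beta>
    by (simp_all add: T_def transport_def)
  have h1 [simp]: "j f \<in> hom1 T (i x) (i y) \<longleftrightarrow> f \<in> hom1 S x y" for f x y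
    by (auto simp: hom1_iff)
  have h2 [simp]: "k \<alpha> \<in> hom2 T (j f) (j g) \<longleftrightarrow> \<alpha> \<in> hom2 S f g" for \<alpha> f g
    by (auto simp: hom2_iff)
  have hom1E: "\<exists>f' x' y'. f = j f' \<and> x = i x' \<and> y = i y' \<and> f' \<in> hom1 S x' y'" if "f \<in> hom1 T x y" for f x y
    using that by (auto simp: hom1_iff)
  have hom2E: "\<exists>\<alpha>' f' g'. \<alpha> = k \<alpha>' \<and> f = j f' \<and> g = j g' \<and> \<alpha>' \<in> hom2 S f' g'" if "\<alpha> \<in> hom2 T f g" for \<alpha> f g
    using that by (auto simp: hom2_iff)
  have "sesquicategory T"
  proof (unfold_locales, goal_cases)
    case 1 then show ?case using src1_closed by auto
  next
    case 2 then show ?case using tgt1_closed by auto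
  next
    case 3 then show ?case using id1_hom by auto
  next
    case 4 from 4[THEN hom1E] show ?case using comp1_hom by auto
  next
    case 5 from 5[THEN hom1E] show ?case using comp1_id_right by auto
  next
    case 6 from 6[THEN hom1E] show ?case using comp1_id_left by auto
  next
    case 7 from 7[THEN hom1E] show ?case using comp1_assoc by auto
  next
    case 8 then show ?case using src2_closed by auto
  next
    case 9 then show ?case using tgt2_closed by auto
  next
    case 10 then show ?case using globular_src by auto
  next
    case 11 then show ?case using globular_tgt by auto
  next
    case 12 then show ?case using id2_hom by auto
  next
    case 13 from 13[THEN hom2E] show ?case using comp2_hom by auto
  next
    case 14 from 14[THEN hom2E] show ?case using comp2_id_right by auto
  next
    case 15 from 15[THEN hom2E] show ?case using comp2_id_left by auto
  next
    case 16 from 16[THEN hom2E] show ?case using comp2_assoc by auto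
  next
    case 17 from 17(1,3)[THEN hom1E] 17(2)[THEN hom2E] show ?case using lwhisk_hom by auto
  next
    case 18 from 18(1,2)[THEN hom1E] show ?case using lwhisk_id2 by auto
  next
    case 19 from 19(1,4)[THEN hom1E] 19(2,3)[THEN hom2E] show ?case using lwhisk_comp2 by auto
  next
    case 20 from 20(1)[THEN hom1E] 20(2)[THEN hom2E] show ?case using lwhisk_id1 by auto
  next
    case 21 from 21(1,3,4)[THEN hom1E] 21(2)[THEN hom2E] show ?case using lwhisk_comp1 by auto
  next
    case 22 from 22(1,2)[THEN hom1E] 22(3)[THEN hom2E] show ?case using rwhisk_hom by auto
  next
    case 23 from 23(1,2)[THEN hom1E] show ?case using rwhisk_id2 by auto
  next
    case 24 from 24(1,2)[THEN hom1E] 24(3,4)[THEN hom2E] show ?case using rwhisk_comp2 by auto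
  next
    case 25 from 25(1)[THEN hom1E] 25(2)[THEN hom2E] show ?case using rwhisk_id1 by auto
  next
    case 26 from 26(1,2,3)[THEN hom1E] 26(4)[THEN hom2E] show ?case using rwhisk_comp1 by auto
  next
    case 27 from 27(1,2,4)[THEN hom1E] 27(3)[THEN hom2E] show ?case using whisk_whisk by auto
  qed
  then interpret T: sesquicategory T .
  interpret F: sesquifunctor S T "\<lparr>map0 = i, map1 = j, map2 = k\<rparr>"
    by unfold_locales auto
  have "sesquicat_isomorphic T S"
    by (rule F.isomorphic_if_bij) (auto simp: bij_betw_def inj_on_def)
  then show ?thesis using that T.sesquicategory_axioms by blast
qed

section \<open>Cofibrancy of Gray-categories on free sesquicategories\<close>

lemma path_map_path_map: "path_map a b (path_map a' b' p) = path_map (a \<circ> a') (b \<circ> b') p"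
  by (simp add: path_map_def)

lemma computad_morphism_comp:
  assumes "computad_morphism G H \<phi>" "computad_morphism H K \<psi>"
  shows "computad_morphism G K (cellmap_comp \<psi> \<phi>)"
proof -
  interpret \<phi>: computad_morphism G H \<phi> by fact
  interpret \<psi>: computad_morphism H K \<psi> by fact
  show ?thesis
    by unfold_locales
      (simp_all add: \<phi>.map_verts \<psi>.map_verts \<phi>.map_arcs \<psi>.map_arcs \<phi>.map_tail \<psi>.map_tail \<phi>.map_head
        \<psi>.map_head \<phi>.map_gens \<psi>.map_gens \<phi>.map_dom2 \<psi>.map_dom2 \<phi>.map_cod2 \<psi>.map_cod2
        path_map_path_map cellmap_comp_def comp_def)
qed

lemma path_map_cong:
  assumes "wf_digraph G" "p \<in> paths G" "\<And>v. v \<in> verts G \<Longrightarrow> a v = a' v" "\<And>e. e \<in> arcs G \<Longrightarrow> b e = b' e"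
  shows "path_map a b p = path_map a' b' p"
proof -
  interpret wf_digraph G by fact
  show ?thesis
    using assms path_src_in_verts[OF assms(2)] path_tgt_in_verts[OF assms(2)]
    by (cases p) (auto simp: awalk_def)
qed

abbreviation generator where
  "generator G c \<equiv> fst (snd (map2 (free_unit G) c))"

lemma (in computad) generator_hom: "c \<in> gens G \<Longrightarrow> generator G c \<in> hom2 (free_sesquicat G) (dom2 G c) (cod2 G c)"
  using unit_cell[of c] whisker.arc_implies_awalk[OF unit_cell(1)[of c]] by (simp add: hom2_iff)

text \<open>
  Both sesquifunctors extend the computad morphism that is the composite of the unit with the
  underlying morphism of \<open>F\<close>, and such an extension is unique.
\<close>

lemma free_functor_unique:
  assumes "computad G" "sesquifunctor (free_sesquicat G) S F" "sesquifunctor (free_sesquicat G) S F'"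
    and v: "\<And>x. x \<in> verts (graph G) \<Longrightarrow> map0 F' x = map0 F x"
    and e: "\<And>e. e \<in> arcs (graph G) \<Longrightarrow> map1 F' (computad.edge G e) = map1 F (computad.edge G e)"
    and c: "\<And>c. c \<in> gens G \<Longrightarrow> map2 F' (generator G c) = map2 F (generator G c)"
  shows "cellmap_eq_on (free_sesquicat G) F' F"
proof -
  interpret G: computad G by fact
  interpret F: sesquifunctor "free_sesquicat G" S F by fact
  define \<psi> where "\<psi> = cellmap_comp (underlying_computad_map F) (free_unit G)"
  have "computad_morphism G (underlying_computad S) \<psi>"
    unfolding \<psi>_def by (rule computad_morphism_comp[OF G.computad_morphism_free_unit F.computad_morphism_underlying])
  then obtain F0 where F0: "\<And>F'. sesquifunctor (free_sesquicat G) S F' \<Longrightarrow> extends_along_unit G F' \<psi> \<Longrightarrow>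
      cellmap_eq_on (free_sesquicat G) F' F0"
    using free_sesquicat_universal[OF F.T.sesquicategory_axioms] by blast
  have "extends_along_unit G F \<psi>"
    by (simp add: extends_along_unit_def \<psi>_def)
  moreover have "extends_along_unit G F' \<psi>"
    unfolding extends_along_unit_def
  proof (intro conjI ballI)
    fix x assume "x \<in> gens G"
    have "path_map (map0 F') (map1 F') (path_map (\<lambda>x. x) G.edge p) = path_map (map0 F) (map1 F) (path_map (\<lambda>x. x) G.edge p)"
      if "p \<in> paths (graph G)" for p
      unfolding path_map_path_map using that v e by (intro path_map_cong[OF G.wf_graph]) auto
    then show "map2 (underlying_computad_map F') (map2 (free_unit G) x) = map2 \<psi> x"
      using c[OF \<open>x \<in> gens G\<close>] G.dom2_path[OF \<open>x \<in> gens G\<close>] G.cod2_path[OF \<open>x \<in> gens G\<close>]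
      by (simp add: \<psi>_def underlying_computad_map_def)
  qed (use v e in \<open>auto simp: \<psi>_def underlying_computad_map_def\<close>)
  ultimately have "cellmap_eq_on (free_sesquicat G) F F0" "cellmap_eq_on (free_sesquicat G) F' F0"
    using F0 assms(2,3) by blast+
  then show ?thesis by (simp add: cellmap_eq_on_def)
qed

text \<open>
  Regrouping the conditions by dimension separates what concerns the underlying sesquifunctor from
  what concerns the 3-cells.
\<close>

lemma gray_trivial_fibration_iff:
  "gray_trivial_fibration \<X> \<Y> p \<longleftrightarrow> gray_functor \<X> \<Y> p \<and> map0 p ` Cell0 \<X> = Cell0 \<Y> \<and>
    (\<forall>x\<in>Cell0 \<X>. \<forall>y\<in>Cell0 \<X>. map1 p ` hom1 \<X> x y = hom1 \<Y> (map0 p x) (map0 p y)) \<and>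
    (\<forall>x y. \<forall>f\<in>hom1 \<X> x y. \<forall>g\<in>hom1 \<X> x y. map2 p ` hom2 \<X> f g = hom2 \<Y> (map1 p f) (map1 p g)) \<and>
    fully_faithful_on_3cells \<X> \<Y> p"
  (is "?L \<longleftrightarrow> ?R")
proof (cases "gray_functor \<X> \<Y> p")
  case False
  then show ?thesis by (simp add: gray_trivial_fibration_def)
next
  case True
  interpret p: gray_functor \<X> \<Y> p by fact
  note p1 = p.U.map1_hom[unfolded underlying_simps hom_underlying underlying_map_simps]
    and p2 = p.U.map2_hom[unfolded underlying_simps hom_underlying underlying_map_simps]
  have hom1_eq: "hom1 (hom_2cat \<A> x y) f g = hom2 \<A> f g" if "f \<in> hom1 \<A> x y"
    for \<A> :: "('x, 'y, 'z, 'w) gray" and x y f g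
    using that by (auto simp: hom1_hom_2cat_iff)
  have hom2_eq: "hom2 (hom_2cat \<A> x y) \<alpha> \<beta> = hom3 \<A> \<alpha> \<beta>" if "f \<in> hom1 \<A> x y" "\<alpha> \<in> hom2 \<A> f g"
    for \<A> :: "('x, 'y, 'z, 'w) gray" and x y f g \<alpha> \<beta>
    using that by (auto simp: hom2_hom_2cat_iff hom2_src2)
  have "two_trivial_fibration (hom_2cat \<X> x y) (hom_2cat \<Y> (map0 p x) (map0 p y)) (hom_map p) \<longleftrightarrow>
      map1 p ` hom1 \<X> x y = hom1 \<Y> (map0 p x) (map0 p y) \<and>
      (\<forall>f\<in>hom1 \<X> x y. \<forall>g\<in>hom1 \<X> x y. map2 p ` hom2 \<X> f g = hom2 \<Y> (map1 p f) (map1 p g) \<and>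
        (\<forall>\<alpha>\<in>hom2 \<X> f g. \<forall>\<beta>\<in>hom2 \<X> f g. bij_betw (map3 p) (hom3 \<X> \<alpha> \<beta>) (hom3 \<Y> (map2 p \<alpha>) (map2 p \<beta>))))"
    (is "?A \<longleftrightarrow> ?B") if xy: "x \<in> Cell0 \<X>" "y \<in> Cell0 \<X>" for x y
  proof -
    have "bij_betw (map3 p) (hom2 (hom_2cat \<X> x y) \<alpha> \<beta>) (hom2 (hom_2cat \<Y> (map0 p x) (map0 p y)) (map2 p \<alpha>) (map2 p \<beta>))
      \<longleftrightarrow> bij_betw (map3 p) (hom3 \<X> \<alpha> \<beta>) (hom3 \<Y> (map2 p \<alpha>) (map2 p \<beta>))"
      if "f \<in> hom1 \<X> x y" "\<alpha> \<in> hom2 \<X> f g" for f g \<alpha> \<beta>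
      by (simp add: hom2_eq[OF that] hom2_eq[OF p1[OF that(1)] p2[OF that(2)]])
    then show ?thesis
      using p.A.hom_two_category[OF xy] p.B.hom_two_category[OF p.map0_closed[OF xy(1)] p.map0_closed[OF xy(2)]]
        p.hom_functor[OF xy]
      by (simp add: two_trivial_fibration_def hom1_eq p1 cong: ball_cong)
  qed
  then have "?L \<longleftrightarrow> map0 p ` Cell0 \<X> = Cell0 \<Y> \<and> (\<forall>x\<in>Cell0 \<X>. \<forall>y\<in>Cell0 \<X>.
      map1 p ` hom1 \<X> x y = hom1 \<Y> (map0 p x) (map0 p y) \<and>
      (\<forall>f\<in>hom1 \<X> x y. \<forall>g\<in>hom1 \<X> x y. map2 p ` hom2 \<X> f g = hom2 \<Y> (map1 p f) (map1 p g) \<and>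
        (\<forall>\<alpha>\<in>hom2 \<X> f g. \<forall>\<beta>\<in>hom2 \<X> f g. bij_betw (map3 p) (hom3 \<X> \<alpha> \<beta>) (hom3 \<Y> (map2 p \<alpha>) (map2 p \<beta>)))))"
    (is "_ \<longleftrightarrow> ?M")
    using True by (simp add: gray_trivial_fibration_def)
  moreover have "(\<forall>x y. \<forall>f\<in>hom1 \<X> x y. \<forall>g\<in>hom1 \<X> x y. map2 p ` hom2 \<X> f g = hom2 \<Y> (map1 p f) (map1 p g)) \<longleftrightarrow>
      (\<forall>x\<in>Cell0 \<X>. \<forall>y\<in>Cell0 \<X>. \<forall>f\<in>hom1 \<X> x y. \<forall>g\<in>hom1 \<X> x y.
        map2 p ` hom2 \<X> f g = hom2 \<Y> (map1 p f) (map1 p g))"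
    using p.A.ends_closed by blast
  moreover have "fully_faithful_on_3cells \<X> \<Y> p \<longleftrightarrow>
      (\<forall>x\<in>Cell0 \<X>. \<forall>y\<in>Cell0 \<X>. \<forall>f\<in>hom1 \<X> x y. \<forall>g\<in>hom1 \<X> x y. \<forall>\<alpha>\<in>hom2 \<X> f g. \<forall>\<beta>\<in>hom2 \<X> f g.
        bij_betw (map3 p) (hom3 \<X> \<alpha> \<beta>) (hom3 \<Y> (map2 p \<alpha>) (map2 p \<beta>)))"
    (is "_ \<longleftrightarrow> ?ff")
  proof
    assume ?ff
    show "fully_faithful_on_3cells \<X> \<Y> p"
      unfolding fully_faithful_on_3cells_def
    proof (intro allI ballI)
      fix x y f g \<alpha> \<beta>
      assume *: "f \<in> hom1 \<X> x y" "\<alpha> \<in> hom2 \<X> f g" "\<beta> \<in> hom2 \<X> f g"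
      then show "bij_betw (map3 p) (hom3 \<X> \<alpha> \<beta>) (hom3 \<Y> (map2 p \<alpha>) (map2 p \<beta>))"
        using \<open>?ff\<close>[rule_format, of x y f g \<alpha> \<beta>] p.A.ends_closed[OF *(1)] p.A.hom2_parallel[OF *(1,2)] by simp
    qed
  qed (simp add: fully_faithful_on_3cells_def)
  ultimately show ?thesis using True by (simp add: ball_conj_distrib)
qed

text \<open>
  There is exactly one Gray-functor out of the initial Gray-category, so only the lower edge of a
  lifting square carries data.
\<close>

lemma cofibrant_iff:
  "cofibrant TYPE('u) \<A> \<longleftrightarrow> gray_category \<A> \<and>
    (\<forall>(\<X> :: ('u, 'u, 'u, 'u) gray) (\<Y> :: ('u, 'u, 'u, 'u) gray) p v.
      gray_trivial_fibration \<X> \<Y> p \<and> gray_functor \<A> \<Y> v \<longrightarrow>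
      (\<exists>d. gray_functor \<A> \<X> d \<and> graymap_eq_on \<A> (graymap_comp p d) v))"
proof -
  have "gray_functor initial_gray \<X> u" if "gray_trivial_fibration \<X> \<Y> p"
    for \<X> :: "('u, 'u, 'u, 'u) gray" and \<Y> :: "('u, 'u, 'u, 'u) gray" and p
      and u :: "(unit, unit, unit, 'u, 'u, 'u, unit, 'u) graymap"
    by (rule gray_functor_initial) (use that in \<open>simp add: gray_trivial_fibration_def gray_functor_def\<close>)
  then have "gray_trivial_fibration \<X> \<Y> p \<and> gray_functor initial_gray \<X> u \<and> P \<longleftrightarrow> gray_trivial_fibration \<X> \<Y> p \<and> P"
    for \<X> :: "('u, 'u, 'u, 'u) gray" and \<Y> :: "('u, 'u, 'u, 'u) gray" and p P
      and u :: "(unit, unit, unit, 'u, 'u, 'u, unit, 'u) graymap"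
    by blast
  then show ?thesis
    by (simp add: cofibrant_def llp_trivial_fibrations_def graymap_eq_on_initial)
qed

text \<open>
  Freeness lets a lift be chosen independently on the generators of each dimension. A lift of a
  generating 2-cell is sought between the composites of the lifts already chosen for the edges of
  its source and target, which is where fullness is used.
\<close>

lemma (in computad) lift_through_full_functor:
  fixes X :: "('ox, 'mx, 'tx) sesquicat" and Y :: "('oy, 'my, 'ty) sesquicat"
  assumes "sesquifunctor X Y p" and w: "sesquifunctor (free_sesquicat G) Y w"
    and surj0: "Cell0 Y \<subseteq> map0 p ` Cell0 X"
    and full1: "\<And>x y. \<lbrakk>x \<in> Cell0 X; y \<in> Cell0 X\<rbrakk> \<Longrightarrow> hom1 Y (map0 p x) (map0 p y) \<subseteq> map1 p ` hom1 X x y"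
    and full2: "\<And>x y f g. \<lbrakk>f \<in> hom1 X x y; g \<in> hom1 X x y\<rbrakk> \<Longrightarrow> hom2 Y (map1 p f) (map1 p g) \<subseteq> map2 p ` hom2 X f g"
  obtains F where "sesquifunctor (free_sesquicat G) X F" "cellmap_eq_on (free_sesquicat G) (cellmap_comp p F) w"
proof -
  interpret p: sesquifunctor X Y p by fact
  interpret w: sesquifunctor "free_sesquicat G" Y w by fact
  interpret VX: computad "underlying_computad X" by (rule p.S.computad_underlying)
  have edge: "edge e \<in> hom1 (free_sesquicat G) (tail (graph G) e) (head (graph G) e)" if "e \<in> arcs (graph G)" for e
    using graph.arc_implies_awalk[OF that] by (simp add: hom1_iff)
  have "\<exists>x \<in> Cell0 X. map0 p x = map0 w v" if "v \<in> verts (graph G)" for v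
  proof -
    have "map0 w v \<in> map0 p ` Cell0 X" using subsetD[OF surj0 w.map0_closed[of v]] that by simp
    then show ?thesis by (elim imageE) (intro bexI, simp_all)
  qed
  then obtain a where a: "\<And>v. v \<in> verts (graph G) \<Longrightarrow> a v \<in> Cell0 X \<and> map0 p (a v) = map0 w v" by metis
  have "\<exists>f \<in> hom1 X (a (tail (graph G) e)) (a (head (graph G) e)). map1 p f = map1 w (edge e)"
    if "e \<in> arcs (graph G)" for e
  proof -
    have "tail (graph G) e \<in> verts (graph G)" "head (graph G) e \<in> verts (graph G)" using that by simp_all
    note at = this[THEN a]
    have "map1 w (edge e) \<in> map1 p ` hom1 X (a (tail (graph G) e)) (a (head (graph G) e))"
      using subsetD[OF full1] w.map1_hom[OF edge[OF that]] at by simp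
    then show ?thesis by (elim imageE) (intro bexI, simp_all)
  qed
  then obtain b where b: "\<And>e. e \<in> arcs (graph G) \<Longrightarrow>
      b e \<in> hom1 X (a (tail (graph G) e)) (a (head (graph G) e)) \<and> map1 p (b e) = map1 w (edge e)" by metis
  have path: "path_map a b q \<in> paths (underlying_graph X)" if "q \<in> paths (graph G)" for q
    by (rule path_map_in_paths[OF wf_graph p.S.wf_underlying_graph _ _ that])
      (use a b in \<open>auto simp: underlying_graph_def hom1_iff\<close>)
  define E where "E q = path_composite X (path_map a b q)" for q
  have E: "E q \<in> hom1 X (a (path_src q)) (a (path_tgt q))" "map1 p (E q) = map1 w q" if q: "q \<in> paths (graph G)" for q
  proof -
    show "E q \<in> hom1 X (a (path_src q)) (a (path_tgt q))"
      using p.S.path_composite_hom[OF path[OF q]] by (simp add: E_def path_map_def)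
    have "path_map (map0 p) (map1 p) (path_map a b q) = path_map (map0 w) (map1 w) (path_map (\<lambda>x. x) edge q)"
      unfolding path_map_path_map using a b by (intro path_map_cong[OF wf_graph q]) auto
    then show "map1 p (E q) = map1 w q"
      unfolding E_def p.path_composite_map[OF path[OF q], symmetric]
      using w.path_composite_map[OF path_composite_edges(1)[OF q]] path_composite_edges(2)[OF q] by simp
  qed
  have "\<exists>\<alpha> \<in> hom2 X (E (dom2 G c)) (E (cod2 G c)). map2 p \<alpha> = map2 w (generator G c)" if c: "c \<in> gens G" for c
  proof -
    have "E (cod2 G c) \<in> hom1 X (a (path_src (dom2 G c))) (a (path_tgt (dom2 G c)))"
      using E(1)[OF cod2_path[OF c]] globular_src[OF c] globular_tgt[OF c] by simp
    note f = full2[OF E(1)[OF dom2_path[OF c]] this]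
    have "map2 w (generator G c) \<in> map2 p ` hom2 X (E (dom2 G c)) (E (cod2 G c))"
      using subsetD[OF f] w.map2_hom[OF generator_hom[OF c]] E(2)[OF dom2_path[OF c]] E(2)[OF cod2_path[OF c]]
      by (simp del: free_unit_simps)
    then show ?thesis by (elim imageE) (intro bexI, simp_all del: free_unit_simps)
  qed
  then obtain k where k: "\<And>c. c \<in> gens G \<Longrightarrow> k c \<in> hom2 X (E (dom2 G c)) (E (cod2 G c)) \<and>
      map2 p (k c) = map2 w (generator G c)" by metis
  define \<phi> :: "('v, 'e, 'c, 'ox, 'mx, ('ox, 'mx) path \<times> 'tx \<times> ('ox, 'mx) path) cellmap" where
    "\<phi> = \<lparr>map0 = a, map1 = b, map2 = \<lambda>c. (path_map a b (dom2 G c), k c, path_map a b (cod2 G c))\<rparr>"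
  have ends: "path_src (path_map a b q) = a (path_src q)" "path_tgt (path_map a b q) = a (path_tgt q)" for q
    by (simp_all add: path_map_def)
  have "computad_morphism G (underlying_computad X) \<phi>"
  proof (unfold_locales, goal_cases)
    case (5 c)
    then show ?case
      using k[OF 5] path dom2_path cod2_path globular_src globular_tgt
      by (simp add: \<phi>_def underlying_computad_def E_def ends del: mem_paths_iff)
  qed (use a b in \<open>auto simp: \<phi>_def underlying_computad_def underlying_graph_def hom1_iff\<close>)
  then obtain F where F: "sesquifunctor (free_sesquicat G) X F" "extends_along_unit G F \<phi>"
    using free_sesquicat_universal[OF p.S.sesquicategory_axioms] by blast
  note simps = free_extension_simps[OF computad_axioms F]
  have "cellmap_eq_on (free_sesquicat G) (cellmap_comp p F) w"
  proof (rule free_functor_unique[OF computad_axioms w sesquifunctor_comp[OF F(1) assms(1)]], unfold cellmap_comp_simps)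
    show "map0 p (map0 F x) = map0 w x" if "x \<in> verts (graph G)" for x
      using simps(1)[OF that] a[OF that] by (simp add: \<phi>_def)
    show "map1 p (map1 F (edge e)) = map1 w (edge e)" if "e \<in> arcs (graph G)" for e
    proof -
      have "edge e \<in> paths (graph G)" using edge[OF that] by (simp add: hom1_iff)
      then show ?thesis using simps(2)[of "edge e"] E(2)[of "edge e"] by (simp add: \<phi>_def E_def)
    qed
    show "map2 p (map2 F (generator G c)) = map2 w (generator G c)" if "c \<in> gens G" for c
      using simps(3)[OF that] k[OF that] by (simp add: \<phi>_def del: free_unit_simps)
  qed
  then show ?thesis using that F(1) by blast
qed

theorem cofibrant_if_free:
  fixes \<A> :: "('o, 'm, 't, 'r) gray"
  assumes "gray_category \<A>" "free_on_computad (underlying_sesquicat \<A>)"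
  shows "cofibrant TYPE('u) \<A>"
  unfolding cofibrant_iff
proof (intro conjI allI impI assms(1); elim conjE)
  fix \<X> \<Y> :: "('u, 'u, 'u, 'u) gray" and p v
  assume p: "gray_trivial_fibration \<X> \<Y> p" and v: "gray_functor \<A> \<Y> v"
  let ?A = "underlying_sesquicat \<A>"
  obtain G :: "('o, 'm, 't) computad" where "computad G" and iso: "sesquicat_isomorphic ?A (free_sesquicat G)"
    using assms(2) unfolding free_on_computad_def by blast
  then interpret G: computad G by simp
  obtain I J where IJ: "sesquifunctor ?A (free_sesquicat G) I" "sesquifunctor (free_sesquicat G) ?A J"
      "\<And>x. x \<in> Cell0 \<A> \<Longrightarrow> map0 J (map0 I x) = x" "\<And>f. f \<in> Cell1 \<A> \<Longrightarrow> map1 J (map1 I f) = f"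
      "\<And>\<alpha>. \<alpha> \<in> Cell2 \<A> \<Longrightarrow> map2 J (map2 I \<alpha>) = \<alpha>"
    using iso unfolding sesquicat_isomorphic_def by auto
  interpret I: sesquifunctor ?A "free_sesquicat G" I by (rule IJ)
  interpret p: gray_functor \<X> \<Y> p using p by (simp add: gray_trivial_fibration_iff)
  interpret v: gray_functor \<A> \<Y> v by (rule v)
  note w = sesquifunctor_comp[OF IJ(2) v.underlying_sesquifunctor]
  obtain F where F: "sesquifunctor (free_sesquicat G) (underlying_sesquicat \<X>) F"
    "cellmap_eq_on (free_sesquicat G) (cellmap_comp (underlying_map p) F) (cellmap_comp (underlying_map v) J)"
  proof (rule G.lift_through_full_functor[OF p.underlying_sesquifunctor w], unfold underlying_simps hom_underlying underlying_map_simps)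
    show "Cell0 \<Y> \<subseteq> map0 p ` Cell0 \<X>" using p by (simp add: gray_trivial_fibration_iff)
  qed (use p in \<open>auto simp: gray_trivial_fibration_iff\<close>)
  have pd: "\<And>x. x \<in> Cell0 \<A> \<Longrightarrow> map0 p (map0 F (map0 I x)) = map0 v x"
    "\<And>f. f \<in> Cell1 \<A> \<Longrightarrow> map1 p (map1 F (map1 I f)) = map1 v f"
    "\<And>\<alpha>. \<alpha> \<in> Cell2 \<A> \<Longrightarrow> map2 p (map2 F (map2 I \<alpha>)) = map2 v \<alpha>"
    using F(2) IJ(3-5) I.map0_closed I.map1_closed I.map2_closed unfolding cellmap_eq_on_def by simp_all
  obtain D where D: "gray_functor \<A> \<X> D" "underlying_map D = cellmap_comp F I"
    "\<And>\<Phi>. \<Phi> \<in> Cell3 \<A> \<Longrightarrow> map3 p (map3 D \<Phi>) = map3 v \<Phi>"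
    by (rule gray_functor_lift[OF p.gray_functor_axioms _ v sesquifunctor_comp[OF IJ(1) F(1)]])
      (use p pd in \<open>simp_all add: gray_trivial_fibration_iff\<close>)
  have "map0 D x = map0 F (map0 I x)" "map1 D f = map1 F (map1 I f)" "map2 D \<alpha> = map2 F (map2 I \<alpha>)" for x f \<alpha>
    using arg_cong[OF D(2), of map0] arg_cong[OF D(2), of map1] arg_cong[OF D(2), of map2]
    by (simp_all add: cellmap_comp_def)
  then have "graymap_eq_on \<A> (graymap_comp p D) v"
    using pd D(3) by (simp add: graymap_eq_on_def graymap_comp_def)
  then show "\<exists>d. gray_functor \<A> \<X> d \<and> graymap_eq_on \<A> (graymap_comp p d) v" using D(1) by blast
qed

section \<open>Freeness of cofibrant Gray-categories\<close>

lemma (in sesquicategory) counit: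
  defines "G \<equiv> underlying_computad S"
  obtains \<epsilon> where "sesquifunctor (free_sesquicat G) S \<epsilon>"
    "\<And>x. x \<in> Cell0 S \<Longrightarrow> map0 \<epsilon> x = x"
    "\<And>p. p \<in> paths (underlying_graph S) \<Longrightarrow> map1 \<epsilon> p = path_composite S p"
    "\<And>c. c \<in> gens G \<Longrightarrow> map2 \<epsilon> (generator G c) = fst (snd c)"
proof -
  interpret G: computad G unfolding G_def by (rule computad_underlying)
  have id: "path_map (\<lambda>x. x) (\<lambda>x. x) p = p" for p :: "('o, 'm) path" by (cases p) simp
  define \<phi> :: "('o, 'm, ('o, 'm) path \<times> 't \<times> ('o, 'm) path, 'o, 'm, ('o, 'm) path \<times> 't \<times> ('o, 'm) path) cellmap"
    where "\<phi> = \<lparr>map0 = \<lambda>x. x, map1 = \<lambda>x. x, map2 = \<lambda>x. x\<rparr>"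
  have g: "graph G = underlying_graph S" by (simp add: G_def underlying_computad_def)
  have "computad_morphism G (underlying_computad S) \<phi>"
    unfolding G_def[symmetric] by unfold_locales (simp_all add: \<phi>_def id)
  then obtain \<epsilon> where \<epsilon>: "sesquifunctor (free_sesquicat G) S \<epsilon>" "extends_along_unit G \<epsilon> \<phi>"
    using free_sesquicat_universal[OF sesquicategory_axioms] by blast
  note simps = free_extension_simps[OF G.computad_axioms \<epsilon>]
  show ?thesis
  proof (rule that[OF \<epsilon>(1)])
    show "map0 \<epsilon> x = x" if "x \<in> Cell0 S" for x
      using simps(1)[of x] that by (simp add: g \<phi>_def underlying_graph_def)
    show "map1 \<epsilon> p = path_composite S p" if "p \<in> paths (underlying_graph S)" for p
      using simps(2)[of p] that by (simp add: g \<phi>_def id)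
    show "map2 \<epsilon> (generator G c) = fst (snd c)" if "c \<in> gens G" for c
      using simps(3)[OF that] by (simp add: \<phi>_def)
  qed
qed

lemma gray_functor_id:
  assumes "gray_category \<A>"
  shows "gray_functor \<A> \<A> \<lparr>map0 = \<lambda>x. x, map1 = \<lambda>x. x, map2 = \<lambda>x. x, map3 = \<lambda>x. x\<rparr>"
proof -
  interpret gray_category \<A> by fact
  interpret S: sesquicategory "underlying_sesquicat \<A>" by (rule sesquicategory_underlying)
  have "sesquifunctor (underlying_sesquicat \<A>) (underlying_sesquicat \<A>) \<lparr>map0 = \<lambda>x. x, map1 = \<lambda>x. x, map2 = \<lambda>x. x\<rparr>"
    by unfold_locales auto
  then show ?thesis by (intro gray_functorI assms) (simp_all add: underlying_map_def)
qed

text \<open>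
  The trivial fibration is the projection from the pullback of \<open>Y\<close>, a copy of \<open>\<A>\<close>, along the counit.
  It is surjective and full because a vertex, an edge or a 2-cell of the underlying computad is a
  generator sent to itself by the counit; in particular the 2-cells of the computad come with
  arbitrary paths as source and target, which gives fullness on 2-cells between arbitrary 1-cells.
\<close>

theorem free_if_cofibrant:
  fixes \<A> :: "('o, 'm, 't, 'r) gray"
  assumes inf: "infinite (UNIV :: 'u set)" and inj: "\<exists>\<iota> :: 'o + 'm + 't + 'r \<Rightarrow> 'u. inj \<iota>"
    and cof: "cofibrant TYPE('u) \<A>"
  shows "free_on_computad (underlying_sesquicat \<A>)"
proof -
  interpret A: gray_category \<A> using cof by (simp add: cofibrant_def)
  let ?A = "underlying_sesquicat \<A>"
  obtain \<iota> :: "'o + 'm + 't + 'r \<Rightarrow> 'u" where \<iota>: "inj \<iota>" using inj by blast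
  have "inj (\<lambda>x. \<iota> (Inl x))" "inj (\<lambda>x. \<iota> (Inr (Inl x)))" "inj (\<lambda>x. \<iota> (Inr (Inr (Inl x))))"
    "inj (\<lambda>x. \<iota> (Inr (Inr (Inr x))))"
    using \<iota> by (auto simp: inj_def)
  note inj0 = this
  \<comment> \<open>Along the isomorphism \<open>L\<close> the pullback is merely a copy of \<open>\<A>\<close> with cells in \<open>'u\<close>.\<close>
  obtain T :: "('u, 'u, 'u) sesquicat" where T: "sesquicategory T" "sesquicat_isomorphic T ?A"
    using sesquicategory.ex_transport[OF A.sesquicategory_underlying inj0(1-3)] by blast
  interpret T: sesquicategory T by (rule T)
  obtain L K where LK: "sesquifunctor T ?A L" "sesquifunctor ?A T K"
    "\<And>x. x \<in> Cell0 \<A> \<Longrightarrow> map0 L (map0 K x) = x" "\<And>f. f \<in> Cell1 \<A> \<Longrightarrow> map1 L (map1 K f) = f"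
    "\<And>\<alpha>. \<alpha> \<in> Cell2 \<A> \<Longrightarrow> map2 L (map2 K \<alpha>) = \<alpha>"
    using T(2) unfolding sesquicat_isomorphic_def by auto
  note id_u = exI[of inj "\<lambda>x. x :: 'u", OF inj_on_id2]
  obtain e1 :: "'u \<times> 'r \<times> 'u \<Rightarrow> 'u" where e1: "inj e1"
    using ex_inj_prod[OF inf id_u ex_inj_prod[OF inf exI[of inj, OF inj0(4)] id_u]] by blast
  interpret PY: gray_pullback \<A> T L e1
    by (intro gray_pullback.intro gray_pullback_axioms.intro A.gray_category_axioms T LK(1) e1)
  let ?Y = PY.pb
  obtain v where v: "gray_functor \<A> ?Y v" "underlying_map v = K"
    by (rule gray_functor_lift[OF PY.gray_functor_projection PY.projection_fully_faithful
          gray_functor_id[OF A.gray_category_axioms], of K])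
      (use LK in \<open>simp_all add: PY.underlying_pb\<close>)

  let ?G = "underlying_computad T"
  let ?H = "free_sesquicat ?G"
  interpret G: computad ?G by (rule T.computad_underlying)
  have g: "graph ?G = underlying_graph T" by (simp add: underlying_computad_def)
  obtain \<epsilon> where \<epsilon>: "sesquifunctor ?H T \<epsilon>"
    "\<And>x. x \<in> Cell0 T \<Longrightarrow> map0 \<epsilon> x = x"
    "\<And>p. p \<in> paths (underlying_graph T) \<Longrightarrow> map1 \<epsilon> p = path_composite T p"
    "\<And>c. c \<in> gens ?G \<Longrightarrow> map2 \<epsilon> (generator ?G c) = fst (snd c)"
    by (rule T.counit) blast
  note prod = ex_inj_prod[OF inf] and list = ex_inj_list[OF inf]
  have paths: "\<exists>f :: ('u, 'u) path \<Rightarrow> 'u. inj f" by (intro prod list id_u)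
  have cells: "\<exists>f :: (('u, 'u) path, ('u, 'u, ('u, 'u) path \<times> 'u \<times> ('u, 'u) path) whisk) path \<Rightarrow> 'u. inj f"
    by (intro prod list paths id_u)
  obtain i1 :: "('u, 'u) path \<Rightarrow> 'u" and
    i2 :: "(('u, 'u) path, ('u, 'u, ('u, 'u) path \<times> 'u \<times> ('u, 'u) path) whisk) path \<Rightarrow> 'u"
    where i: "inj i1" "inj i2" using paths cells by blast
  obtain T' :: "('u, 'u, 'u) sesquicat" where T': "sesquicategory T'" "sesquicat_isomorphic T' ?H"
    using G.free.ex_transport[OF inj_on_id2 i] by blast
  interpret T': sesquicategory T' by (rule T')
  obtain L' K' where LK': "sesquifunctor T' ?H L'" "sesquifunctor ?H T' K'"
    "\<And>x. x \<in> Cell0 T' \<Longrightarrow> map0 K' (map0 L' x) = x" "\<And>f. f \<in> Cell1 T' \<Longrightarrow> map1 K' (map1 L' f) = f"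
    "\<And>x. x \<in> Cell0 ?H \<Longrightarrow> map0 L' (map0 K' x) = x" "\<And>f. f \<in> Cell1 ?H \<Longrightarrow> map1 L' (map1 K' f) = f"
    "\<And>\<alpha>. \<alpha> \<in> Cell2 ?H \<Longrightarrow> map2 L' (map2 K' \<alpha>) = \<alpha>"
    using T'(2) unfolding sesquicat_isomorphic_def by auto
  interpret L': sesquifunctor T' ?H L' by (rule LK')
  interpret K': sesquifunctor ?H T' K' by (rule LK')
  interpret \<epsilon>: sesquifunctor ?H T \<epsilon> by (rule \<epsilon>)
  obtain e2 :: "'u \<times> 'u \<times> 'u \<Rightarrow> 'u" where e2: "inj e2"
    using ex_inj_prod[OF inf id_u ex_inj_prod[OF inf id_u id_u]] by blast
  \<comment> \<open>The copy \<open>T'\<close> of \<open>HVT\<close> carries the 3-cells pulled back along the counit.\<close>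
  let ?F = "cellmap_comp \<epsilon> L'"
  interpret PX: gray_pullback ?Y T' ?F e2
    by (intro gray_pullback.intro gray_pullback_axioms.intro PY.gray_category_pb T' e2)
      (simp add: PY.underlying_pb sesquifunctor_comp[OF LK'(1) \<epsilon>(1)])
  let ?X = PX.pb
  have H0: "Cell0 ?H = Cell0 T" by (simp add: g underlying_graph_def)
  have s0: "map0 ?F ` Cell0 T' = Cell0 T"
  proof (intro equalityI subsetI)
    fix x assume "x \<in> Cell0 T"
    then show "x \<in> map0 ?F ` Cell0 T'"
      using K'.map0_closed[of x] LK'(5)[of x] \<epsilon>(2)[of x] H0 by (intro image_eqI[of _ _ "map0 K' x"]) simp_all
  qed (use L'.map0_closed \<epsilon>.map0_closed in auto)
  have s1: "map1 ?F ` hom1 T' x y = hom1 T (map0 \<epsilon> (map0 L' x)) (map0 \<epsilon> (map0 L' y))"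
    if xy: "x \<in> Cell0 T'" "y \<in> Cell0 T'" for x y
  proof (intro equalityI subsetI)
    fix f assume "f \<in> hom1 T (map0 \<epsilon> (map0 L' x)) (map0 \<epsilon> (map0 L' y))"
    then have f: "f \<in> hom1 T (map0 L' x) (map0 L' y)" using L'.map0_closed xy H0 \<epsilon>(2) by simp
    then have e: "f \<in> arcs (graph ?G)" "G.edge f \<in> hom1 ?H (map0 L' x) (map0 L' y)"
      using G.graph.arc_implies_awalk[of f] by (auto simp: g underlying_graph_def hom1_iff)
    have edge_cell: "G.edge f \<in> Cell1 ?H" using e(2) by (simp only: hom1_iff)
    have "map1 K' (G.edge f) \<in> hom1 T' x y" using K'.map1_hom[OF e(2)] LK'(3) xy by simp
    moreover have "map1 \<epsilon> (G.edge f) = f"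
    proof -
      interpret E: path_extension "underlying_graph T" "Cell0 T" "hom1 T" "id1 T" "comp1 T" "\<lambda>x. x" "\<lambda>f. f"
        by (rule T.underlying_path_extension)
      have "G.edge f \<in> paths (underlying_graph T)" using edge_cell by (simp only: G.free_simps g)
      then show ?thesis using \<epsilon>(3)[of "G.edge f"] e(1) E.ext_arc[of f] by (simp add: g T.path_composite_eq_ext)
    qed
    moreover have "map1 L' (map1 K' (G.edge f)) = G.edge f" by (rule LK'(6)[OF edge_cell])
    ultimately show "f \<in> map1 ?F ` hom1 T' x y" by (intro image_eqI[of _ _ "map1 K' (G.edge f)"]) simp_all
  qed (auto intro!: \<epsilon>.map1_hom L'.map1_hom)
  have s2: "map2 ?F ` hom2 T' f f' = hom2 T (map1 \<epsilon> (map1 L' f)) (map1 \<epsilon> (map1 L' f'))"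
    if f: "f \<in> hom1 T' x y" "f' \<in> hom1 T' x y" for x y f f'
  proof (intro equalityI subsetI)
    fix \<alpha> assume \<alpha>: "\<alpha> \<in> hom2 T (map1 \<epsilon> (map1 L' f)) (map1 \<epsilon> (map1 L' f'))"
    let ?c = "(map1 L' f, \<alpha>, map1 L' f')"
    have p: "map1 L' f \<in> paths (underlying_graph T)" "map1 L' f' \<in> paths (underlying_graph T)"
      "path_src (map1 L' f) = path_src (map1 L' f')" "path_tgt (map1 L' f) = path_tgt (map1 L' f')"
      using L'.map1_hom[OF f(1)] L'.map1_hom[OF f(2)] by (simp_all add: hom1_iff g)
    then have c: "?c \<in> gens ?G" "dom2 ?G ?c = map1 L' f" "cod2 ?G ?c = map1 L' f'"
      using \<alpha> \<epsilon>(3) by (simp_all add: underlying_computad_def del: mem_paths_iff)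
    note h = G.generator_hom[OF c(1), unfolded c(2,3)]
    have gen_cell: "generator ?G ?c \<in> Cell2 ?H" using h by (simp only: hom2_iff)
    have "map2 K' (generator ?G ?c) \<in> hom2 T' f f'"
      using K'.map2_hom[OF h] LK'(4) f by (simp add: hom1_iff)
    moreover have "map2 L' (map2 K' (generator ?G ?c)) = generator ?G ?c" by (rule LK'(7)[OF gen_cell])
    ultimately show "\<alpha> \<in> map2 ?F ` hom2 T' f f'"
      using \<epsilon>(4)[OF c(1)] by (intro image_eqI[of _ _ "map2 K' (generator ?G ?c)"]) simp_all
  qed (auto intro!: \<epsilon>.map2_hom L'.map2_hom)
  have "gray_trivial_fibration ?X ?Y PX.projection"
    unfolding gray_trivial_fibration_iff
    using PX.gray_functor_projection PX.projection_fully_faithful s0 s1 s2 by simp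
  then obtain d where d: "gray_functor \<A> ?X d" "graymap_eq_on \<A> (graymap_comp PX.projection d) v"
    using cof v(1) unfolding cofibrant_iff by blast
  \<comment> \<open>The composite of the counit with the lift \<open>d\<close> is the isomorphism from \<open>\<A>\<close> to its copy.\<close>
  let ?d = "underlying_map d"
  have sd: "sesquifunctor ?A T' ?d" using gray_functor.underlying_sesquifunctor[OF d(1)] by (simp add: PX.underlying_pb)
  have vK: "map0 v = map0 K" "map1 v = map1 K" "map2 v = map2 K" using v(2) by (auto simp: underlying_map_def)
  have "map0 \<epsilon> (map0 L' (map0 d x)) = map0 K x" if "x \<in> Cell0 \<A>" for x
    using d(2) that vK by (simp add: graymap_eq_on_def graymap_comp_def)
  moreover have "map1 \<epsilon> (map1 L' (map1 d x)) = map1 K x" if "x \<in> Cell1 \<A>" for x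
    using d(2) that vK by (simp add: graymap_eq_on_def graymap_comp_def)
  moreover have "map2 \<epsilon> (map2 L' (map2 d x)) = map2 K x" if "x \<in> Cell2 \<A>" for x
    using d(2) that vK by (simp add: graymap_eq_on_def graymap_comp_def)
  ultimately interpret R: free_sesquicat_retract ?A ?G "cellmap_comp L' ?d" "cellmap_comp L \<epsilon>"
    by (intro free_sesquicat_retract.intro free_sesquicat_retract_axioms.intro A.sesquicategory_underlying
        G.computad_axioms sesquifunctor_comp[OF sd LK'(1)] sesquifunctor_comp[OF \<epsilon>(1) LK(1)])
      (simp_all add: LK(3-5))
  show ?thesis by (rule R.free_on_computad)
qed

theorem corollary9p4:
  fixes \<A> :: "('o, 'm, 't, 'r) gray"
  assumes "infinite (UNIV :: 'u set)"
    and "\<exists>\<iota> :: 'o + 'm + 't + 'r \<Rightarrow> 'u. inj \<iota>"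
    and "gray_category \<A>"
  shows "cofibrant TYPE('u) \<A> \<longleftrightarrow> free_on_computad (underlying_sesquicat \<A>)"
  using free_if_cofibrant[OF assms(1,2)] cofibrant_if_free[OF assms(3)] by blast

end
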